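(* Let $(G,L)$ be a pure $(G,L)$-pair. Fix a unitary representation $\rho$ of the pair $(G,L)$. Then the restriction of $\rho$ to a sufficiently small subgroup $(G^\alpha,L^\alpha)\simeq(G,L)$ (that is, for $\alpha$ sufficiently large) contains a spherical subrepresentation. All spherical representations of $(G,L)$ obtained in this way (for all $\alpha$, via the isomorphisms $(G^\alpha,L^\alpha)\simeq(G,L)$) are equivalent.
   Context: Classical groups. A matrix $g$ over $\mathbb R,\mathbb C$ or $\mathbb H$ with rows and columns indexed by a countable basis is finite if $g-1$ has only finitely many nonzero entries. All groups below consist of finite invertible matrices satisfying the usual identities. The irreducible classical groups and their maximal heavy subgroups are: $\mathrm{GL}(\infty,\mathbb R)\supset \mathrm O(\infty)$; $\mathrm{GL}(\infty,\mathbb C)\supset \mathrm U(\infty)$; $\mathrm{GL}(\infty,\mathbb H)\supset\mathrm{Sp}(\infty)$; $\mathrm U(\infty,\infty)\supset \mathrm U(\infty)\times \mathrm U(\infty)$; $\mathrm{Sp}(2\infty,\mathbb R)\supset \mathrm U(\infty)$; $\mathrm{Sp}(2\infty,\mathbb C)\supset\mathrm{Sp}(\infty)$; $\mathrm{Sp}(\infty,\infty)\supset\mathrm{Sp}(\infty)\times\mathrm{Sp}(\infty)$; $\mathrm O(\infty,\infty)\supset\mathrm O(\infty)\times\mathrm O(\infty)$; $\mathrm O(\infty,\mathbb C)\supset\mathrm O(\infty)$; $\mathrm{SO}^*(2\infty)\supset\mathrm U(\infty)$; $\mathrm U(p,\infty)\supset\mathrm U(\infty)$; $\mathrm O(p,\infty)\supset\mathrm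 O(\infty)$; $\mathrm{Sp}(p,\infty)\supset\mathrm{Sp}(\infty)$ with $0\le p<\infty$ (for $p=0$: the groups $\mathrm U(\infty),\mathrm O(\infty),\mathrm{Sp}(\infty)$ themselves). Here $\mathrm{Sp}(\infty)$ is the quaternionic unitary group. A classical group is a finite product of irreducible ones; its maximal heavy subgroup $K$ is the product of the maximal heavy subgroups of the factors. A heavy group is a finite product of groups $\mathrm O(\infty),\mathrm U(\infty),\mathrm{Sp}(\infty)$ (called irreducible heavy groups). Straight homomorphisms. Trivial homomorphisms between irreducible heavy groups are: the identity maps, elementwise complex conjugation of $\mathrm U(\infty)$, and the obvious maps $\mathrm O(\infty)\to\mathrm U(\infty)$, $\mathrm O(\infty)\to\mathrm{Sp}(\infty)$, $\mathrm U(\infty)\to\mathrm{Sp}(\infty)$, $\mathrm U(\infty)\to\mathrm O(2\infty)$, $\mathrm{Sp}(\infty)\to\mathrm O(4\infty)$, $\mathrm{Sp}(\infty)\to\mathrm U(2\infty)$. For $L=L_1\times\dots\times L_p$ heavy and $K$ irreducible heavy, a homomorphism $L\to K$ is straight if it has the block diagonal form $(g_1,\dots,g_p)\mapsto\mathrm{diag}(1_a,\tau_1(g_{m_1}),\dots,\tau_N(g_{m_N}))$ with $\tau_j$ trivial, $0<N<\infty$, $a\in\{0,1,2,\dots,\infty\}$ (not required to be faithful). For $K=K_1\times\dots\times K_q$, a straight homomorphism $L\to K$ is a product of straight homomorphisms $L\to K_i$. A $(G,L)$-pair consists of a classical group $G$ with maximal heavy subgroup $K$ and a heavy group $L$ straightly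 embedded in $K$. The pair is pure if the centralizer of $L$ in $G$ is trivial; equivalently, no unit block $1_a$ with $a>0$ occurs in the straight embedding, and no groups $\mathrm U(p,\infty)$, $\mathrm O(p,\infty)$, $\mathrm{Sp}(p,\infty)$ with $p>0$ occur among the factors of $G$. For $L=L_1\times\dots\times L_p$ and a multi-index $\alpha=(\alpha_1,\dots,\alpha_p)\in\mathbb Z_{\ge0}^p$, $L^\alpha=L_1^{\alpha_1}\times\dots\times L_p^{\alpha_p}$, where $L_j^{\alpha_j}$ is the stabilizer in $L_j$ of the first $\alpha_j$ basis vectors of its $\ell_2$. The group $G$ acts in a direct sum of spaces $\ell_2$, which is a sum of copies of the $\ell_2$'s of the $L_j$ (according to the straight embedding). $G^\alpha\subset G$ is the stabilizer in $G$ of the basis vectors fixed by $L^\alpha$, understood as the subgroup of elements of the block form $\begin{pmatrix}1&0\\0&g\end{pmatrix}$ (the unit block corresponding to the basis vectors fixed by $L^\alpha$). The shift of basis indices ($k$-th basis vector of the $\ell_2$ of $L_j$ to the $(k+\alpha_j)$-th) gives an isomorphism of pairs $(G,L)\simeq(G^\alpha,L^\alpha)$. A unitary representation of the pair $(G,L)$ is a unitary representation $\rho$ of $G$ in a Hilbert space $H$ whose restriction to $L$ is continuous (with respect to the weak operator topology on $L$); equivalently, $\bigcup_\alpha H^{[\alpha]}$ is dense in $H$, where $H^{[\alpha]}$ is the space of $L^\alpha$-fixed vectors. A spherical representation of $(G,L)$ is an irreducible unitary representation of $G$ that has a unique up to proportionality nonzero $L$-fixed vector.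
   Formalization: The unitary representation ρ of the pair is assumed irreducible; for reducible ρ the claim fails, e.g. diag(1, |det g|^i) for GL(∞,R) ⊃ O(∞) contains two inequivalent spherical subrepresentations. *)

theory Defs
  imports
    "HOL-Analysis.Analysis"
    "HOL-Algebra.Product_Groups"
    "HOL-Library.Groups_Big_Fun"
    "HOL-Library.Extended_Nat"
begin

section \<open>Quaternions\<close>

datatype quat = Quat (qre: real) (qi: real) (qj: real) (qk: real)

lemma quat_eq_iff:
  "x = y \<longleftrightarrow> qre x = qre y \<and> qi x = qi y \<and> qj x = qj y \<and> qk x = qk y"
  by (cases x; cases y) simp

instantiation quat :: ring_1
begin

definition zero_quat :: quat where "0 = Quat 0 0 0 0"
definition one_quat :: quat where "1 = Quat 1 0 0 0"
definition plus_quat :: "quat \<Rightarrow> quat \<Rightarrow> quat" where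
  "x + y = Quat (qre x + qre y) (qi x + qi y) (qj x + qj y) (qk x + qk y)"
definition minus_quat :: "quat \<Rightarrow> quat \<Rightarrow> quat" where
  "x - y = Quat (qre x - qre y) (qi x - qi y) (qj x - qj y) (qk x - qk y)"
definition uminus_quat :: "quat \<Rightarrow> quat" where
  "- x = Quat (- qre x) (- qi x) (- qj x) (- qk x)"
definition times_quat :: "quat \<Rightarrow> quat \<Rightarrow> quat" where
  "x * y = Quat
     (qre x * qre y - qi x * qi y - qj x * qj y - qk x * qk y)
     (qre x * qi y + qi x * qre y + qj x * qk y - qk x * qj y)
     (qre x * qj y - qi x * qk y + qj x * qre y + qk x * qi y)
     (qre x * qk y + qi x * qj y - qj x * qi y + qk x * qre y)"

instance
  by standard
    (simp_all add: quat_eq_iff zero_quat_def one_quat_def plus_quat_def minus_quat_def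
       uminus_quat_def times_quat_def algebra_simps)

end

instantiation quat :: real_inner
begin

definition scaleR_quat :: "real \<Rightarrow> quat \<Rightarrow> quat" where
  "r *\<^sub>R x = Quat (r * qre x) (r * qi x) (r * qj x) (r * qk x)"
definition inner_quat :: "quat \<Rightarrow> quat \<Rightarrow> real" where
  "inner x y = qre x * qre y + qi x * qi y + qj x * qj y + qk x * qk y"
definition norm_quat :: "quat \<Rightarrow> real" where
  "norm x = sqrt (inner x x)" for x :: quat
definition sgn_quat :: "quat \<Rightarrow> quat" where
  "sgn x = inverse (norm x) *\<^sub>R x" for x :: quat
definition dist_quat :: "quat \<Rightarrow> quat \<Rightarrow> real" where
  "dist x y = norm (x - y)" for x y :: quat
definition uniformity_quat :: "(quat \<times> quat) filter" where
  "uniformity_quat = (INF e\<in>{0<..}. principal {(x, y). dist x y < e})"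
definition open_quat :: "quat set \<Rightarrow> bool" where
  "open_quat S \<longleftrightarrow> (\<forall>x\<in>S. eventually (\<lambda>(x', y). x' = x \<longrightarrow> y \<in> S) uniformity)"

instance
proof
  fix x y z :: quat and r s :: real and S :: "quat set"
  show "sgn x = inverse (norm x) *\<^sub>R x" by (rule sgn_quat_def)
  show "dist x y = norm (x - y)" by (rule dist_quat_def)
  show "uniformity = (INF e\<in>{0<..}. principal {(x::quat, y). dist x y < e})"
    by (rule uniformity_quat_def)
  show "open S \<longleftrightarrow> (\<forall>x\<in>S. eventually (\<lambda>(x', y). x' = x \<longrightarrow> y \<in> S) uniformity)"
    by (rule open_quat_def)
  show "norm x = sqrt (inner x x)" by (rule norm_quat_def)
  show "inner x x = 0 \<longleftrightarrow> x = 0"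
  proof -
    have "qre x * qre x + qi x * qi x + qj x * qj x + qk x * qk x = 0 \<longleftrightarrow>
        qre x = 0 \<and> qi x = 0 \<and> qj x = 0 \<and> qk x = 0"
      by (simp add: add_nonneg_eq_0_iff)
    then show ?thesis by (simp add: inner_quat_def quat_eq_iff zero_quat_def)
  qed
qed (simp_all add: quat_eq_iff scaleR_quat_def inner_quat_def plus_quat_def algebra_simps)

end

definition qcnj :: "quat \<Rightarrow> quat" where
  "qcnj x = Quat (qre x) (- qi x) (- qj x) (- qk x)"

section \<open>Finite matrices over the reals, the complex numbers and the quaternions\<close>

datatype division_alg = RR | CC | HH

text \<open>All three algebras are realised inside the quaternions, \<open>\<complex>\<close> being spanned by \<open>1\<close> and
  \<open>i\<close>; quaternionic conjugation restricts to complex conjugation on \<open>CC\<close> and to the identity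
  on \<open>RR\<close>.\<close>

fun scalars :: "division_alg \<Rightarrow> quat set" where
  "scalars RR = {x. qi x = 0 \<and> qj x = 0 \<and> qk x = 0}"
| "scalars CC = {x. qj x = 0 \<and> qk x = 0}"
| "scalars HH = UNIV"

text \<open>Orthogonal projection of the quaternions onto a subalgebra.\<close>

fun proj :: "division_alg \<Rightarrow> quat \<Rightarrow> quat" where
  "proj RR x = Quat (qre x) 0 0 0"
| "proj CC x = Quat (qre x) (qi x) 0 0"
| "proj HH x = x"

type_synonym 'a qmat = "'a \<Rightarrow> 'a \<Rightarrow> quat"

definition mat_one :: "'a qmat" where
  "mat_one a b = (if a = b then 1 else 0)"

text \<open>\<^const>\<open>Sum_any\<close> is the sum of the finitely many nonzero terms. It is used only when one of
  the rows or columns involved is finitely supported.\<close>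

definition mat_mult :: "'a qmat \<Rightarrow> 'a qmat \<Rightarrow> 'a qmat" where
  "mat_mult g h a c = Sum_any (\<lambda>b. g a b * h b c)"

definition mat_adjoint :: "'a qmat \<Rightarrow> 'a qmat" where
  "mat_adjoint g a b = qcnj (g b a)"

definition mat_transpose :: "'a qmat \<Rightarrow> 'a qmat" where
  "mat_transpose g a b = g b a"

text \<open>Finite matrices with rows and columns indexed by the set \<open>B\<close>. A matrix is a total function
  on the surrounding index type, extended by the identity matrix outside \<open>B\<close>.\<close>

definition finite_mats :: "division_alg \<Rightarrow> 'a set \<Rightarrow> 'a qmat set" where
  "finite_mats F B =
     {g. (\<forall>a b. g a b \<in> scalars F) \<and>
         finite {(a, b). g a b \<noteq> mat_one a b} \<and>
         (\<forall>a b. a \<notin> B \<or> b \<notin> B \<longrightarrow> g a b = mat_one a b)}"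

definition invertible_mats :: "division_alg \<Rightarrow> 'a set \<Rightarrow> 'a qmat set" where
  "invertible_mats F B =
     {g \<in> finite_mats F B. \<exists>h\<in>finite_mats F B. mat_mult g h = mat_one \<and> mat_mult h g = mat_one}"

definition unitary_mats :: "division_alg \<Rightarrow> 'a set \<Rightarrow> 'a qmat set" where
  "unitary_mats F B = {g \<in> invertible_mats F B. mat_mult (mat_adjoint g) g = mat_one}"

definition mat_group :: "'a qmat set \<Rightarrow> 'a qmat monoid" where
  "mat_group S = \<lparr>carrier = S, monoid.mult = mat_mult, one = mat_one\<rparr>"

section \<open>Heavy groups\<close>

text \<open>\<open>RR\<close>, \<open>CC\<close>, \<open>HH\<close> stand for the irreducible heavy groups \<open>O(\<infinity>)\<close>, \<open>U(\<infinity>)\<close>, \<open>Sp(\<infinity>)\<close>; a list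
  stands for a product of such groups.\<close>

definition irreducible_heavy_group :: "division_alg \<Rightarrow> nat qmat monoid" where
  "irreducible_heavy_group F = mat_group (unitary_mats F UNIV)"

definition heavy_group :: "division_alg list \<Rightarrow> (nat \<Rightarrow> nat qmat) monoid" where
  "heavy_group Fs = product_group {..<length Fs} (\<lambda>j. irreducible_heavy_group (Fs ! j))"

definition ell2 :: "division_alg \<Rightarrow> (nat \<Rightarrow> quat) set" where
  "ell2 F = {x. (\<forall>k. x k \<in> scalars F) \<and> summable (\<lambda>k. (norm (x k))\<^sup>2)}"

definition matrix_element :: "nat qmat \<Rightarrow> (nat \<Rightarrow> quat) \<Rightarrow> (nat \<Rightarrow> quat) \<Rightarrow> quat" where
  "matrix_element g x y = infsum (\<lambda>a. qcnj (y a) * Sum_any (\<lambda>b. g a b * x b)) UNIV"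

text \<open>Weak operator topology: the coarsest one for which all the functions
  \<open>g \<mapsto> \<langle>g x, y\<rangle>\<close> with \<open>x, y\<close> in \<open>\<ell>\<^sub>2\<close> are continuous.\<close>

definition weak_operator_topology :: "division_alg \<Rightarrow> nat qmat topology" where
  "weak_operator_topology F =
     pullback_topology (carrier (irreducible_heavy_group F))
       (\<lambda>g. \<lambda>(x, y)\<in>ell2 F \<times> ell2 F. matrix_element g x y)
       (product_topology (\<lambda>_. euclidean) (ell2 F \<times> ell2 F))"

definition heavy_topology :: "division_alg list \<Rightarrow> (nat \<Rightarrow> nat qmat) topology" where
  "heavy_topology Fs = product_topology (\<lambda>j. weak_operator_topology (Fs ! j)) {..<length Fs}"

text \<open>The subgroup \<open>L\<^sup>\<alpha>\<close>.\<close>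

definition heavy_stabilizer ::
    "division_alg list \<Rightarrow> (nat \<Rightarrow> nat) \<Rightarrow> (nat \<Rightarrow> nat qmat) set" where
  "heavy_stabilizer Fs \<alpha> =
     {l \<in> carrier (heavy_group Fs).
        \<forall>j<length Fs. \<forall>k<\<alpha> j. \<forall>a. l j a k = mat_one a k}"

section \<open>Straight homomorphisms\<close>

text \<open>For algebras \<open>A \<supseteq> B\<close>, the standard basis of \<open>A\<close> as a right \<open>B\<close>-module; for \<open>A \<subseteq> B\<close>, the
  one-element list \<open>[1]\<close>.\<close>

fun scalar_basis :: "division_alg \<Rightarrow> division_alg \<Rightarrow> quat list" where
  "scalar_basis CC RR = [1, Quat 0 1 0 0]"
| "scalar_basis HH RR = [1, Quat 0 1 0 0, Quat 0 0 1 0, Quat 0 0 0 1]"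
| "scalar_basis HH CC = [1, Quat 0 0 1 0]"
| "scalar_basis A B = [1]"

text \<open>Change of scalars. For \<open>A \<subseteq> B\<close> this is the inclusion. For \<open>A \<supseteq> B\<close> every entry \<open>q\<close> is
  replaced by the matrix over \<open>B\<close>, in the basis \<open>e\<close> above, of left multiplication by \<open>q\<close>;
  as \<open>e\<close> is orthonormal, the coordinate of \<open>v\<close> along \<open>e ! r\<close> is \<open>proj B (qcnj (e ! r) * v)\<close>.
  E.g. for \<open>A = CC\<close>, \<open>B = RR\<close>, the number \<open>x + i y\<close> becomes \<open>(x, - y; y, x)\<close>.\<close>

definition change_scalars :: "division_alg \<Rightarrow> division_alg \<Rightarrow> 'a qmat \<Rightarrow> ('a \<times> nat) qmat" where
  "change_scalars A B g = (\<lambda>(a, r) (b, s).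
     let e = scalar_basis A B in
     if r < length e \<and> s < length e then proj B (qcnj (e ! r) * g a b * e ! s)
     else mat_one (a, r) (b, s))"

text \<open>Between two irreducible heavy groups there is exactly one standard trivial homomorphism
  (identity, inclusion or restriction of scalars); for \<open>U(\<infinity>) \<rightarrow> U(\<infinity>)\<close> there is in addition the
  complex conjugation.\<close>

datatype trivial_kind = Standard | Conjugation

fun trivial_hom ::
    "trivial_kind \<Rightarrow> division_alg \<Rightarrow> division_alg \<Rightarrow> nat qmat \<Rightarrow> (nat \<times> nat) qmat" where
  "trivial_hom Standard A B g = change_scalars A B g"
| "trivial_hom Conjugation A B g = change_scalars A B (\<lambda>a b. qcnj (g a b))"

text \<open>The data of \<open>diag(1\<^sub>a, \<tau>\<^sub>1(g\<^bsub>m\<^sub>1\<^esub>), \<dots>, \<tau>\<^sub>N(g\<^bsub>m\<^sub>N\<^esub>))\<close>: the size \<open>a\<close> and the list of the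
  \<open>(m\<^sub>j, \<tau>\<^sub>j)\<close>.\<close>

record straight =
  unit_size :: enat
  blocks :: "(nat \<times> trivial_kind) list"

definition straight_data :: "division_alg list \<Rightarrow> division_alg \<Rightarrow> straight \<Rightarrow> bool" where
  "straight_data Fs F s \<longleftrightarrow>
     blocks s \<noteq> [] \<and>
     (\<forall>(m, c)\<in>set (blocks s). m < length Fs \<and> (c = Conjugation \<longrightarrow> Fs ! m = CC \<and> F = CC))"

text \<open>Basis vectors of the target \<open>\<ell>\<^sub>2\<close>, labelled according to the block decomposition: \<open>Unit u\<close>
  belongs to \<open>1\<^sub>a\<close>, and \<open>Copy j k r\<close> belongs to \<open>\<tau>\<^sub>j(g\<^bsub>m\<^sub>j\<^esub>)\<close>, where it comes from the
  \<open>k\<close>-th basis vector of \<open>L\<^bsub>m\<^sub>j\<^esub>\<close> (\<open>r\<close> counts the coordinates introduced by a restriction of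
  scalars).\<close>

datatype label = Unit nat | Copy nat nat nat

definition label_set :: "division_alg list \<Rightarrow> division_alg \<Rightarrow> straight \<Rightarrow> label set" where
  "label_set Fs F s =
     {Unit u | u. enat u < unit_size s} \<union>
     {Copy j k r | j k r. j < length (blocks s) \<and>
        r < length (scalar_basis (Fs ! fst (blocks s ! j)) F)}"

fun straight_hom ::
    "division_alg list \<Rightarrow> division_alg \<Rightarrow> straight \<Rightarrow> (nat \<Rightarrow> nat qmat) \<Rightarrow> label qmat" where
  "straight_hom Fs F s l (Copy j k r) (Copy j' k' r') =
     (if j = j' \<and> j < length (blocks s)
      then let (m, c) = blocks s ! j in trivial_hom c (Fs ! m) F (l m) (k, r) (k', r')
      else mat_one (Copy j k r) (Copy j' k' r'))"
| "straight_hom Fs F s l a b = mat_one a b"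

section \<open>Classical groups\<close>

text \<open>\<open>GL F\<close> stands for \<open>GL(\<infinity>, F)\<close>; \<open>U_inf_inf F\<close> for \<open>O(\<infinity>,\<infinity>)\<close>, \<open>U(\<infinity>,\<infinity>)\<close>, \<open>Sp(\<infinity>,\<infinity>)\<close>;
  \<open>U_fin_inf p F\<close> for \<open>O(p,\<infinity>)\<close>, \<open>U(p,\<infinity>)\<close>, \<open>Sp(p,\<infinity>)\<close>; the others for \<open>Sp(2\<infinity>,\<real>)\<close>, \<open>Sp(2\<infinity>,\<complex>)\<close>,
  \<open>O(\<infinity>,\<complex>)\<close>, \<open>SO\<^sup>*(2\<infinity>)\<close>.\<close>

datatype classical_type =
    GL division_alg
  | U_inf_inf division_alg
  | U_fin_inf nat division_alg
  | Sp_R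
  | Sp_C
  | O_C
  | SO_star

text \<open>The maximal heavy subgroup is the product of \<open>heavy_count X\<close> copies of the irreducible heavy
  group \<open>heavy_kind X\<close>.\<close>

fun heavy_kind :: "classical_type \<Rightarrow> division_alg" where
  "heavy_kind (GL F) = F"
| "heavy_kind (U_inf_inf F) = F"
| "heavy_kind (U_fin_inf p F) = F"
| "heavy_kind Sp_R = CC"
| "heavy_kind Sp_C = HH"
| "heavy_kind O_C = RR"
| "heavy_kind SO_star = CC"

fun heavy_count :: "classical_type \<Rightarrow> nat" where
  "heavy_count (U_inf_inf F) = 2"
| "heavy_count _ = 1"

text \<open>Basis vectors of the space of an irreducible classical group: \<open>Neg n\<close> for the first \<open>p\<close>
  coordinates of \<open>U(p,\<infinity>)\<close> etc., \<open>Vec t b\<close> with \<open>t < 2\<close> for the two halves of a space of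
  dimension \<open>\<infinity> + \<infinity>\<close> or \<open>2\<infinity>\<close>, and \<open>Vec 0 b\<close> in the remaining cases. Here \<open>b\<close> runs over a basis
  of the space of the corresponding factor of the maximal heavy subgroup.\<close>

datatype 'b coord = Neg nat | Vec nat 'b

fun heavy_slot :: "classical_type \<Rightarrow> nat \<Rightarrow> nat" where
  "heavy_slot (U_inf_inf F) t = t"
| "heavy_slot _ t = 0"

fun coord_set :: "classical_type \<Rightarrow> (nat \<Rightarrow> 'b set) \<Rightarrow> 'b coord set" where
  "coord_set (U_inf_inf F) B = {Vec t b | t b. t < 2 \<and> b \<in> B t}"
| "coord_set (U_fin_inf p F) B = {Neg n | n. n < p} \<union> {Vec 0 b | b. b \<in> B 0}"
| "coord_set Sp_R B = {Vec t b | t b. t < 2 \<and> b \<in> B 0}"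
| "coord_set Sp_C B = {Vec t b | t b. t < 2 \<and> b \<in> B 0}"
| "coord_set X B = {Vec 0 b | b. b \<in> B 0}"

text \<open>Gram matrices: of signature \<open>(\<infinity>,\<infinity>)\<close> or \<open>(p,\<infinity>)\<close>, symplectic, and quaternionic
  skew-Hermitian.\<close>

fun signature_form :: "'b coord qmat" where
  "signature_form (Vec t b) c = (if t = 0 then 1 else -1) * mat_one (Vec t b) c"
| "signature_form (Neg n) c = - mat_one (Neg n) c"

fun symplectic_form :: "'b coord qmat" where
  "symplectic_form (Vec t b) (Vec u c) =
     (if b = c \<and> t = 0 \<and> u = 1 then 1 else if b = c \<and> t = 1 \<and> u = 0 then -1 else 0)"
| "symplectic_form _ _ = 0"

definition skew_form :: "'a qmat" where
  "skew_form a b = (if a = b then Quat 0 1 0 0 else 0)"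

definition preserves_hermitian :: "'a qmat \<Rightarrow> 'a qmat \<Rightarrow> bool" where
  "preserves_hermitian S g \<longleftrightarrow> mat_mult (mat_mult (mat_adjoint g) S) g = S"

definition preserves_bilinear :: "'a qmat \<Rightarrow> 'a qmat \<Rightarrow> bool" where
  "preserves_bilinear S g \<longleftrightarrow> mat_mult (mat_mult (mat_transpose g) S) g = S"

fun classical_mats :: "classical_type \<Rightarrow> 'b coord set \<Rightarrow> 'b coord qmat set" where
  "classical_mats (GL F) I = invertible_mats F I"
| "classical_mats (U_inf_inf F) I =
     {g \<in> invertible_mats F I. preserves_hermitian signature_form g}"
| "classical_mats (U_fin_inf p F) I =
     {g \<in> invertible_mats F I. preserves_hermitian signature_form g}"
| "classical_mats Sp_R I = {g \<in> invertible_mats RR I. preserves_bilinear symplectic_form g}"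
| "classical_mats Sp_C I = {g \<in> invertible_mats CC I. preserves_bilinear symplectic_form g}"
| "classical_mats O_C I = {g \<in> invertible_mats CC I. preserves_bilinear mat_one g}"
| "classical_mats SO_star I = {g \<in> invertible_mats HH I. preserves_hermitian skew_form g}"

definition irreducible_classical_group ::
    "classical_type \<Rightarrow> (nat \<Rightarrow> 'b set) \<Rightarrow> 'b coord qmat monoid" where
  "irreducible_classical_group X B = mat_group (classical_mats X (coord_set X B))"

text \<open>Embedding of the maximal heavy subgroup, given by one matrix for each of its factors. For
  \<open>Sp(2\<infinity>,\<real>)\<close> and \<open>Sp(2\<infinity>,\<complex>)\<close> it is the restriction of scalars \<open>U(\<infinity>) \<rightarrow> O(2\<infinity>)\<close>, resp.
  \<open>Sp(\<infinity>) \<rightarrow> U(2\<infinity>)\<close>.\<close>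

fun heavy_embedding :: "classical_type \<Rightarrow> (nat \<Rightarrow> 'b qmat) \<Rightarrow> 'b coord qmat" where
  "heavy_embedding X k (Vec t b) (Vec u c) =
     (case X of
        Sp_R \<Rightarrow> change_scalars CC RR (k 0) (b, t) (c, u)
      | Sp_C \<Rightarrow> change_scalars HH CC (k 0) (b, t) (c, u)
      | _ \<Rightarrow> if t = u \<and> t < heavy_count X then k t b c else mat_one (Vec t b) (Vec u c))"
| "heavy_embedding X k a b = mat_one a b"

section \<open>Pairs\<close>

text \<open>\<open>emb P i t\<close> is the straight homomorphism into the \<open>t\<close>-th factor of the maximal heavy subgroup
  of the \<open>i\<close>-th irreducible factor of \<open>G\<close>. The bases in which the matrices of \<open>G\<close> are written are
  labelled by the blocks of these homomorphisms.\<close>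

record gl_pair =
  factors :: "classical_type list"
  heavy :: "division_alg list"
  emb :: "nat \<Rightarrow> nat \<Rightarrow> straight"

type_synonym gelem = "nat \<Rightarrow> label coord qmat"

definition pair_G :: "gl_pair \<Rightarrow> gelem monoid" where
  "pair_G P = product_group {..<length (factors P)}
     (\<lambda>i. irreducible_classical_group (factors P ! i)
            (\<lambda>t. label_set (heavy P) (heavy_kind (factors P ! i)) (emb P i t)))"

abbreviation pair_L :: "gl_pair \<Rightarrow> (nat \<Rightarrow> nat qmat) monoid" where
  "pair_L P \<equiv> heavy_group (heavy P)"

definition pair_embedding :: "gl_pair \<Rightarrow> (nat \<Rightarrow> nat qmat) \<Rightarrow> gelem" where
  "pair_embedding P l =
     (\<lambda>i\<in>{..<length (factors P)}.
        heavy_embedding (factors P ! i)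
          (\<lambda>t. straight_hom (heavy P) (heavy_kind (factors P ! i)) (emb P i t) l))"

definition is_gl_pair :: "gl_pair \<Rightarrow> bool" where
  "is_gl_pair P \<longleftrightarrow>
     (\<forall>i<length (factors P). \<forall>t<heavy_count (factors P ! i).
        straight_data (heavy P) (heavy_kind (factors P ! i)) (emb P i t)) \<and>
     inj_on (pair_embedding P) (carrier (pair_L P))"

definition is_pure :: "gl_pair \<Rightarrow> bool" where
  "is_pure P \<longleftrightarrow>
     {g \<in> carrier (pair_G P). \<forall>l\<in>carrier (pair_L P).
        g \<otimes>\<^bsub>pair_G P\<^esub> pair_embedding P l = pair_embedding P l \<otimes>\<^bsub>pair_G P\<^esub> g}
     = {\<one>\<^bsub>pair_G P\<^esub>}"

text \<open>The subgroups \<open>L\<^sup>\<alpha>\<close> (as a subgroup of \<open>G\<close>) and \<open>G\<^sup>\<alpha>\<close>, and the isomorphism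
  \<open>G \<rightarrow> G\<^sup>\<alpha>\<close> given by the shift of the indices.\<close>

definition L_alpha :: "gl_pair \<Rightarrow> (nat \<Rightarrow> nat) \<Rightarrow> gelem set" where
  "L_alpha P \<alpha> = pair_embedding P ` heavy_stabilizer (heavy P) \<alpha>"

definition fixed_coords :: "gl_pair \<Rightarrow> (nat \<Rightarrow> nat) \<Rightarrow> nat \<Rightarrow> label coord set" where
  "fixed_coords P \<alpha> i = {b. \<forall>l\<in>L_alpha P \<alpha>. \<forall>a. l i a b = mat_one a b}"

definition G_alpha :: "gl_pair \<Rightarrow> (nat \<Rightarrow> nat) \<Rightarrow> gelem monoid" where
  "G_alpha P \<alpha> = (pair_G P)\<lparr>carrier :=
     {g \<in> carrier (pair_G P). \<forall>i<length (factors P). \<forall>b\<in>fixed_coords P \<alpha> i. \<forall>a.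
        g i a b = mat_one a b \<and> g i b a = mat_one b a}\<rparr>"

fun shift_label :: "straight \<Rightarrow> (nat \<Rightarrow> nat) \<Rightarrow> label \<Rightarrow> label" where
  "shift_label s \<alpha> (Copy j k r) = Copy j (k + \<alpha> (fst (blocks s ! j))) r"
| "shift_label s \<alpha> (Unit u) = Unit u"

fun shift_coord :: "gl_pair \<Rightarrow> (nat \<Rightarrow> nat) \<Rightarrow> nat \<Rightarrow> label coord \<Rightarrow> label coord" where
  "shift_coord P \<alpha> i (Vec t b) =
     Vec t (shift_label (emb P i (heavy_slot (factors P ! i) t)) \<alpha> b)"
| "shift_coord P \<alpha> i (Neg n) = Neg n"

definition shift_iso :: "gl_pair \<Rightarrow> (nat \<Rightarrow> nat) \<Rightarrow> gelem \<Rightarrow> gelem" where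
  "shift_iso P \<alpha> g =
     (\<lambda>i\<in>{..<length (factors P)}. \<lambda>a b.
        let \<sigma> = shift_coord P \<alpha> i in
        if a \<in> range \<sigma> \<and> b \<in> range \<sigma>
        then g i (inv_into UNIV \<sigma> a) (inv_into UNIV \<sigma> b) else mat_one a b)"

section \<open>Unitary representations\<close>

text \<open>Complex Hilbert spaces; the inner product is linear in the first argument.\<close>

class chilbert_space = real_inner + complete_space +
  fixes scaleC :: "complex \<Rightarrow> 'a \<Rightarrow> 'a"
    and cinner :: "'a \<Rightarrow> 'a \<Rightarrow> complex"
  assumes scaleC_add_right: "scaleC c (x + y) = scaleC c x + scaleC c y"
    and scaleC_add_left: "scaleC (c + d) x = scaleC c x + scaleC d x"
    and scaleC_scaleC: "scaleC c (scaleC d x) = scaleC (c * d) x"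
    and scaleC_of_real: "scaleC (of_real r) x = scaleR r x"
    and cinner_commute: "cinner x y = cnj (cinner y x)"
    and cinner_add_left: "cinner (x + y) z = cinner x z + cinner y z"
    and cinner_scaleC_left: "cinner (scaleC c x) y = c * cinner x y"
    and inner_eq_Re_cinner: "inner x y = Re (cinner x y)"

instantiation complex :: chilbert_space
begin

definition scaleC_complex :: "complex \<Rightarrow> complex \<Rightarrow> complex" where
  "scaleC c x = c * x"
definition cinner_complex :: "complex \<Rightarrow> complex \<Rightarrow> complex" where
  "cinner x y = x * cnj y"

instance
  by standard
    (simp_all add: scaleC_complex_def cinner_complex_def algebra_simps scaleR_conv_of_real
       inner_complex_def)

end

definition closed_csubspace :: "'h::chilbert_space set \<Rightarrow> bool" where
  "closed_csubspace V \<longleftrightarrow>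
     closed V \<and> 0 \<in> V \<and> (\<forall>x\<in>V. \<forall>y\<in>V. x + y \<in> V) \<and> (\<forall>c. \<forall>x\<in>V. scaleC c x \<in> V)"

definition unitary_between ::
    "'h::chilbert_space set \<Rightarrow> 'h set \<Rightarrow> ('h \<Rightarrow> 'h) \<Rightarrow> bool" where
  "unitary_between V W T \<longleftrightarrow>
     bij_betw T V W \<and>
     (\<forall>x\<in>V. \<forall>y\<in>V. T (x + y) = T x + T y) \<and>
     (\<forall>c. \<forall>x\<in>V. T (scaleC c x) = scaleC c (T x)) \<and>
     (\<forall>x\<in>V. \<forall>y\<in>V. cinner (T x) (T y) = cinner x y)"

text \<open>A unitary representation of \<open>G\<close> in the Hilbert space \<open>V\<close>; only the values \<open>\<pi> g v\<close> with \<open>g\<close> in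
  \<open>G\<close> and \<open>v\<close> in \<open>V\<close> matter. In particular, a subrepresentation of \<open>\<pi>\<close> is given by the same \<open>\<pi>\<close> and
  a smaller \<open>V\<close>.\<close>

definition unitary_rep ::
    "'g monoid \<Rightarrow> 'h::chilbert_space set \<Rightarrow> ('g \<Rightarrow> 'h \<Rightarrow> 'h) \<Rightarrow> bool" where
  "unitary_rep G V \<pi> \<longleftrightarrow>
     closed_csubspace V \<and>
     (\<forall>g\<in>carrier G. unitary_between V V (\<pi> g)) \<and>
     (\<forall>g\<in>carrier G. \<forall>h\<in>carrier G. \<forall>v\<in>V. \<pi> (g \<otimes>\<^bsub>G\<^esub> h) v = \<pi> g (\<pi> h v))"

definition irreducible_rep ::
    "'g monoid \<Rightarrow> 'h::chilbert_space set \<Rightarrow> ('g \<Rightarrow> 'h \<Rightarrow> 'h) \<Rightarrow> bool" where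
  "irreducible_rep G V \<pi> \<longleftrightarrow>
     unitary_rep G V \<pi> \<and> V \<noteq> {0} \<and>
     (\<forall>W. W \<subseteq> V \<and> closed_csubspace W \<and> (\<forall>g\<in>carrier G. \<forall>w\<in>W. \<pi> g w \<in> W)
        \<longrightarrow> W = {0} \<or> W = V)"

definition spherical_rep ::
    "'g monoid \<Rightarrow> 'g set \<Rightarrow> 'h::chilbert_space set \<Rightarrow> ('g \<Rightarrow> 'h \<Rightarrow> 'h) \<Rightarrow> bool" where
  "spherical_rep G L V \<pi> \<longleftrightarrow>
     irreducible_rep G V \<pi> \<and>
     (\<exists>v\<in>V. v \<noteq> 0 \<and> {w \<in> V. \<forall>l\<in>L. \<pi> l w = w} = range (\<lambda>c. scaleC c v))"

definition equivalent_reps ::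
    "'g monoid \<Rightarrow> 'h::chilbert_space set \<Rightarrow> ('g \<Rightarrow> 'h \<Rightarrow> 'h) \<Rightarrow>
     'h set \<Rightarrow> ('g \<Rightarrow> 'h \<Rightarrow> 'h) \<Rightarrow> bool" where
  "equivalent_reps G V \<pi> W \<pi>' \<longleftrightarrow>
     (\<exists>T. unitary_between V W T \<and> (\<forall>g\<in>carrier G. \<forall>v\<in>V. T (\<pi> g v) = \<pi>' g (T v)))"

definition rep_of_pair :: "gl_pair \<Rightarrow> (gelem \<Rightarrow> 'h::chilbert_space \<Rightarrow> 'h) \<Rightarrow> bool" where
  "rep_of_pair P \<rho> \<longleftrightarrow>
     unitary_rep (pair_G P) UNIV \<rho> \<and>
     (\<forall>u v. continuous_map (heavy_topology (heavy P)) euclidean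
              (\<lambda>l. cinner (\<rho> (pair_embedding P l) u) v))"

end

theory Submission
  imports Defs
begin

text \<open>
  Let \<open>M\<close> be the space of \<open>L\<^sup>\<alpha>\<close>-fixed vectors and \<open>P\<close> the orthogonal projection onto it. Purity says that
  every basis vector on which an element \<open>h\<close> of \<open>G\<^sup>\<alpha>\<close> acts can be moved by permutation matrices from
  \<open>L\<^sup>\<alpha>\<close>. Hence there are \<open>\<theta>\<^sub>n\<close> in \<open>L\<^sup>\<alpha>\<close> such that \<open>h\<^sub>n = \<theta>\<^sub>n h \<theta>\<^sub>n\<inverse>\<close> is supported
  farther and farther out, and commutes with any given element of \<open>G\<close> as soon as \<open>n\<close> is large
  (\<open>eventually_far\<close>).

  For \<open>u\<close> in \<open>M\<close> the vectors \<open>\<rho>(h\<^sub>n) u\<close> converge weakly to \<open>P \<rho>(h) u\<close>: they all have this projection to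
  \<open>M\<close>, and every weak limit point is fixed by \<open>L\<^sup>\<alpha>\<close> (\<open>weak_limit_far\<close>). Passing to the limit in
  \<open>\<rho>(g) \<rho>(h\<^sub>n) = \<rho>(h\<^sub>n) \<rho>(g)\<close> shows that \<open>P \<rho>(h) P\<close> commutes on \<open>M\<close> with \<open>P \<rho>(g) P\<close> for all \<open>g\<close> in \<open>G\<close>
  (\<open>compressions_commute\<close>). As \<open>\<rho>\<close> is irreducible, Schur's lemma makes it a scalar \<open>c\<^sub>\<alpha>(h)\<close> on \<open>M\<close>
  (\<open>compression_scalar\<close>). Schur's lemma is proved without the spectral theorem, from the absolute value
  of a symmetric operator: \<open>A\<close> and \<open>\<bar>A\<bar>\<close> satisfy \<open>(\<bar>A\<bar> + A) (\<bar>A\<bar> - A) = 0\<close>, so irreducibility forces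
  \<open>A = \<bar>A\<bar>\<close> or \<open>A = - \<bar>A\<bar>\<close>, and this can be applied to all \<open>A - t\<close> with \<open>t\<close> real.

  Consequently every unit vector \<open>v\<close> of \<open>M\<close> has the same matrix element \<open>\<langle>\<rho>(h) v, v\<rangle> = c\<^sub>\<alpha>(h)\<close> on \<open>G\<^sup>\<alpha>\<close>,
  and the closed span of its \<open>G\<^sup>\<alpha>\<close>-orbit is a spherical representation (\<open>spherical_orbit_span\<close>). That \<open>M\<close>
  is nonzero for large \<open>\<alpha>\<close> follows from continuity: a vector is hardly moved by \<open>L\<^sup>\<alpha>\<close>, and the element
  of least norm in the closed convex hull of its orbit is fixed and nonzero (\<open>ex_fixed_by_L_alpha\<close>).

  For the equivalence, let \<open>\<gamma>\<close> be the maximum of \<open>\<alpha>\<close> and \<open>\<beta>\<close>. The shifts of \<open>g\<close> into \<open>G\<^sup>\<alpha>\<close> and into \<open>G\<^sup>\<gamma>\<close>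
  are conjugate by an element of \<open>L\<^sup>\<alpha>\<close> (\<open>shift_shift\<close>), so the spherical function at level \<open>\<alpha>\<close>, pulled back
  to \<open>G\<close>, equals that of a vector of level \<open>\<gamma>\<close>; and at level \<open>\<gamma>\<close> the function does not depend on the
  vector. Cyclic representations with equal matrix elements are equivalent (\<open>equivalent_cyclic_reps\<close>).
\<close>

section \<open>Complex Hilbert spaces\<close>

lemma scaleC_one [simp]: "scaleC 1 x = x"
  using scaleC_of_real[of 1 x] by simp

lemma cinner_add_right: "cinner x (y + z) = cinner x y + cinner x z"
  by (metis cinner_add_left cinner_commute complex_cnj_add)

lemma cinner_scaleC_right: "cinner x (scaleC c y) = cnj c * cinner x y"
  by (metis cinner_commute cinner_scaleC_left complex_cnj_mult)

lemma cinner_self: "cinner x x = of_real ((norm x)\<^sup>2)"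
proof -
  have "Im (cinner x x) = 0"
    by (metis Reals_cnj_iff cinner_commute complex_is_Real_iff)
  then show ?thesis
    by (simp add: complex_eq_iff inner_eq_Re_cinner[symmetric] power2_norm_eq_inner)
qed

lemma norm_scaleC: "norm (scaleC c x) = cmod c * norm x"
proof -
  have "complex_of_real ((norm (scaleC c x))\<^sup>2) = (c * cnj c) * of_real ((norm x)\<^sup>2)"
    by (metis cinner_self cinner_scaleC_left cinner_scaleC_right mult.assoc)
  also have "\<dots> = of_real ((cmod c * norm x)\<^sup>2)"
    unfolding complex_norm_square[symmetric] by (simp add: power_mult_distrib)
  finally have "(norm (scaleC c x))\<^sup>2 = (cmod c * norm x)\<^sup>2"
    using of_real_eq_iff by blast
  then show ?thesis
    by (meson mult_nonneg_nonneg norm_ge_zero power2_eq_imp_eq)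
qed

lemma norm_cinner_le: "cmod (cinner x y) \<le> norm x * norm y"
proof (cases "cinner x y = 0")
  case False
  define c where "c = cnj (cinner x y) / cmod (cinner x y)"
  have "cmod c = 1"
    using False by (simp add: c_def norm_divide)
  have "cinner (scaleC c x) y = (cinner x y * cnj (cinner x y)) / cmod (cinner x y)"
    by (simp add: cinner_scaleC_left c_def mult.commute)
  also have "\<dots> = of_real (cmod (cinner x y))"
    unfolding complex_norm_square[symmetric] using False by (simp add: power2_eq_square)
  finally have "cmod (cinner x y) = inner (scaleC c x) y"
    by (simp add: inner_eq_Re_cinner)
  also have "\<dots> \<le> norm (scaleC c x) * norm y"
    by (rule norm_cauchy_schwarz)
  finally show ?thesis
    using \<open>cmod c = 1\<close> by (simp add: norm_scaleC)
qed simp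

interpretation cinner: bounded_bilinear "cinner :: 'h::chilbert_space \<Rightarrow> 'h \<Rightarrow> complex"
proof
  show "cinner (r *\<^sub>R x) y = r *\<^sub>R cinner x y" for r and x y :: 'h
    by (metis cinner_scaleC_left scaleC_of_real scaleR_conv_of_real)
  show "cinner x (r *\<^sub>R y) = r *\<^sub>R cinner x y" for r and x y :: 'h
    by (metis cinner_scaleC_right complex_cnj_complex_of_real scaleC_of_real scaleR_conv_of_real)
  show "\<exists>K. \<forall>x y :: 'h. norm (cinner x y) \<le> norm x * norm y * K"
    by (rule exI[of _ 1]) (simp add: norm_cinner_le)
qed (simp_all add: cinner_add_left cinner_add_right)

interpretation scaleC: bounded_bilinear "scaleC :: complex \<Rightarrow> 'h \<Rightarrow> 'h::chilbert_space"
proof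
  show "scaleC (r *\<^sub>R c) x = r *\<^sub>R scaleC c x" for r c and x :: 'h
    by (metis scaleC_of_real scaleC_scaleC scaleR_conv_of_real)
  show "scaleC c (r *\<^sub>R x) = r *\<^sub>R scaleC c x" for r c and x :: 'h
    by (metis mult.commute scaleC_of_real scaleC_scaleC)
  show "\<exists>K. \<forall>c (x :: 'h). norm (scaleC c x) \<le> norm c * norm x * K"
    by (rule exI[of _ 1]) (simp add: norm_scaleC)
qed (simp_all add: scaleC_add_left scaleC_add_right)

lemma scaleC_minus_one: "scaleC (-1) x = - x"
  using scaleC.minus_left[of 1 x] by simp

lemma cinner_eq_0_if_inner_eq_0:
  assumes "inner x m = 0" "inner x (scaleC \<i> m) = 0"
  shows "cinner x m = 0"
  using assms by (simp add: complex_eq_iff inner_eq_Re_cinner cinner_scaleC_right)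

lemma closed_csubspace_diff:
  assumes "closed_csubspace V" "x \<in> V" "y \<in> V"
  shows "x - y \<in> V"
proof -
  have "x + scaleC (-1) y \<in> V"
    using assms unfolding closed_csubspace_def by blast
  then show ?thesis
    by (simp add: scaleC_minus_one)
qed

lemma closed_csubspaceD:
  assumes "closed_csubspace V"
  shows "closed V" "0 \<in> V" "x \<in> V \<Longrightarrow> y \<in> V \<Longrightarrow> x + y \<in> V" "x \<in> V \<Longrightarrow> scaleC c x \<in> V"
    "x \<in> V \<Longrightarrow> r *\<^sub>R x \<in> V"
  using assms unfolding closed_csubspace_def by (auto simp flip: scaleC_of_real)

lemma closed_csubspace_orthogonal:
  "closed_csubspace {y. \<forall>x\<in>S. cinner x y = 0}"
proof -
  have "closed {y. cinner x y = 0}" for x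
    by (intro closed_Collect_eq cinner.continuous_on continuous_intros)
  then have "closed (\<Inter>x\<in>S. {y. cinner x y = 0})"
    by blast
  moreover have "(\<Inter>x\<in>S. {y. cinner x y = 0}) = {y. \<forall>x\<in>S. cinner x y = 0}"
    by auto
  ultimately show ?thesis
    by (simp add: closed_csubspace_def cinner_add_right cinner_scaleC_right cinner.zero_right)
qed

text \<open>By the parallelogram law and convexity, two points of \<open>C\<close> whose norms are close to the infimum are
  close to each other. With completeness this gives existence, and also uniqueness.\<close>

lemma ex1_norm_min:
  fixes C :: "'a::{real_inner, complete_space} set"
  assumes "closed C" "convex C" "C \<noteq> {}"
  shows "\<exists>!x. x \<in> C \<and> (\<forall>y\<in>C. norm x \<le> norm y)"
proof -
  define d where "d = Inf (norm ` C)"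
  have bdd: "bdd_below (norm ` C)"
    by (rule bdd_belowI[of _ 0]) auto
  have d_le: "d \<le> norm y" if "y \<in> C" for y
    unfolding d_def using bdd that by (simp add: cINF_lower)
  have d0: "0 \<le> d"
    unfolding d_def using assms(3) by (simp add: cINF_greatest)
  have close: "(norm (x - y))\<^sup>2 \<le> 2 * (norm x)\<^sup>2 + 2 * (norm y)\<^sup>2 - 4 * d\<^sup>2"
    if "x \<in> C" "y \<in> C" for x y
  proof -
    have "(1/2) *\<^sub>R x + (1/2) *\<^sub>R y \<in> C"
      using assms(2) that by (simp add: convexD)
    then have "d \<le> norm ((1/2) *\<^sub>R (x + y))"
      using d_le by (simp add: scaleR_add_right)
    then have "(2 * d)\<^sup>2 \<le> (norm (x + y))\<^sup>2"
      using d0 by (intro power_mono) auto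
    moreover have "(norm (x - y))\<^sup>2 + (norm (x + y))\<^sup>2 = 2 * (norm x)\<^sup>2 + 2 * (norm y)\<^sup>2"
      by (simp add: power2_norm_eq_inner inner_simps inner_commute)
    ultimately show ?thesis by (simp add: power_mult_distrib)
  qed
  have "\<exists>x\<in>C. norm x < d + 1 / real (Suc n)" for n
    using cInf_lessD[of "norm ` C" "d + 1 / real (Suc n)"] assms(3) by (auto simp: d_def)
  then obtain x where x: "\<And>n. x n \<in> C" "\<And>n. norm (x n) < d + 1 / real (Suc n)"
    by metis
  have "(\<lambda>n. d + 1 / real (Suc n)) \<longlonglongrightarrow> d + 0"
    by (intro tendsto_intros LIMSEQ_inverse_real_of_nat[unfolded inverse_eq_divide])
  then have nlim: "(\<lambda>n. norm (x n)) \<longlonglongrightarrow> d"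
    using tendsto_sandwich[OF _ _ tendsto_const, of d "\<lambda>n. norm (x n)" sequentially
        "\<lambda>n. d + 1 / real (Suc n)"] x d_le by (auto intro!: always_eventually less_imp_le)
  have "Cauchy x"
  proof (rule metric_CauchyI)
    fix e :: real assume "0 < e"
    have "(\<lambda>n. (norm (x n))\<^sup>2) \<longlonglongrightarrow> d\<^sup>2"
      by (intro tendsto_intros nlim)
    moreover have "d\<^sup>2 < d\<^sup>2 + e\<^sup>2 / 4"
      using \<open>0 < e\<close> by simp
    ultimately obtain N where N: "\<And>n. n \<ge> N \<Longrightarrow> (norm (x n))\<^sup>2 < d\<^sup>2 + e\<^sup>2 / 4"
      by (metis (no_types, lifting) eventually_sequentially order_tendstoD(2))
    have "dist (x m) (x n) < e" if "m \<ge> N" "n \<ge> N" for m n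
    proof -
      have "(norm (x m - x n))\<^sup>2 < e\<^sup>2"
        using close[OF x(1)[of m] x(1)[of n]] N[OF that(1)] N[OF that(2)] by simp
      then show ?thesis
        using \<open>0 < e\<close> by (simp add: dist_norm power_less_imp_less_base)
    qed
    then show "\<exists>N. \<forall>m\<ge>N. \<forall>n\<ge>N. dist (x m) (x n) < e" by blast
  qed
  then obtain z where z: "x \<longlonglongrightarrow> z"
    using Cauchy_convergent_iff convergent_def by blast
  have "z \<in> C"
    using assms(1) x(1) z by (meson closed_sequentially)
  have "norm z = d"
    using LIMSEQ_unique[OF tendsto_norm[OF z] nlim] .
  show ?thesis
  proof (rule ex1I[of _ z])
    show "z \<in> C \<and> (\<forall>y\<in>C. norm z \<le> norm y)"
      using \<open>z \<in> C\<close> \<open>norm z = d\<close> d_le by simp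
    fix y assume y: "y \<in> C \<and> (\<forall>w\<in>C. norm y \<le> norm w)"
    then have "norm y = d"
      using \<open>z \<in> C\<close> \<open>norm z = d\<close> d_le by (metis antisym)
    then have "(norm (y - z))\<^sup>2 \<le> 0"
      using close[of y z] y \<open>z \<in> C\<close> \<open>norm z = d\<close> by simp
    then show "y = z" by simp
  qed
qed

text \<open>The element of least norm of the affine subspace \<open>x - M\<close> is orthogonal to \<open>M\<close>, since otherwise
  subtracting a multiple of some \<open>m \<in> M\<close> would make it shorter.\<close>

lemma orthogonal_decomposition:
  assumes M: "closed_csubspace M"
  shows "\<exists>p\<in>M. \<forall>m\<in>M. cinner (x - p) m = 0"
proof -
  note MD = closed_csubspaceD[OF M]
  let ?C = "(\<lambda>m. x - m) ` M"
  have "convex M"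
    using MD by (simp add: convexI)
  then have "convex ?C"
  proof -
    have "?C = (\<lambda>y. x + y) ` ((\<lambda>m. - m) ` M)"
      by (auto simp: image_image)
    then show ?thesis
      using \<open>convex M\<close> by (simp add: convex_translation convex_negations)
  qed
  moreover have "closed ?C"
  proof -
    have "?C = (\<lambda>y. x + y) ` ((\<lambda>m. - m) ` M)"
      by (auto simp: image_image)
    then show ?thesis
      using MD(1) by (simp add: closed_translation closed_negations)
  qed
  moreover have "?C \<noteq> {}"
    using MD(2) by blast
  ultimately obtain q where q: "q \<in> ?C" "\<And>y. y \<in> ?C \<Longrightarrow> norm q \<le> norm y"
    using ex1_norm_min by metis
  then obtain p where p: "p \<in> M" "q = x - p" by blast
  have re: "inner q m = 0" if "m \<in> M" for m
  proof (cases "m = 0")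
    case False
    define t where "t = inner q m / (norm m)\<^sup>2"
    have "q - t *\<^sub>R m \<in> ?C"
      using p that MD by (intro image_eqI[of _ _ "p + t *\<^sub>R m"]) auto
    then have "(norm q)\<^sup>2 \<le> (norm (q - t *\<^sub>R m))\<^sup>2"
      using q(2) by (simp add: power_mono)
    also have "\<dots> = (norm q)\<^sup>2 - 2 * t * inner q m + t\<^sup>2 * (norm m)\<^sup>2"
      unfolding power2_norm_eq_inner
      by (simp add: inner_simps inner_commute[of m q] power2_eq_square algebra_simps)
    also have "\<dots> = (norm q)\<^sup>2 - (inner q m)\<^sup>2 / (norm m)\<^sup>2"
      using False by (simp add: t_def power2_eq_square field_simps)
    finally have "(inner q m)\<^sup>2 / (norm m)\<^sup>2 \<le> 0" by simp
    then show ?thesis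
      using False by (simp add: divide_le_0_iff)
  qed simp
  have "\<forall>m\<in>M. cinner (x - p) m = 0"
    using re MD(4) by (auto simp: p(2)[symmetric] intro!: cinner_eq_0_if_inner_eq_0)
  then show ?thesis using p(1) by blast
qed

definition orth_proj :: "'h::chilbert_space set \<Rightarrow> 'h \<Rightarrow> 'h" where
  "orth_proj M x = (SOME p. p \<in> M \<and> (\<forall>m\<in>M. cinner (x - p) m = 0))"

context
  fixes M :: "'h::chilbert_space set"
  assumes M: "closed_csubspace M"
begin

lemma orth_proj_in: "orth_proj M x \<in> M"
  and orth_proj_orth: "m \<in> M \<Longrightarrow> cinner (x - orth_proj M x) m = 0"
  using someI_ex[of "\<lambda>p. p \<in> M \<and> (\<forall>m\<in>M. cinner (x - p) m = 0)"] orthogonal_decomposition[OF M, of x]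
  by (auto simp: orth_proj_def)

lemma cinner_orth_proj: "m \<in> M \<Longrightarrow> cinner (orth_proj M x) m = cinner x m"
  using orth_proj_orth[of m x] by (simp add: cinner.diff_left)

lemma orth_proj_unique:
  assumes "p \<in> M" "\<And>m. m \<in> M \<Longrightarrow> cinner x m = cinner p m"
  shows "orth_proj M x = p"
proof -
  have "orth_proj M x - p \<in> M"
    using orth_proj_in assms(1) closed_csubspace_diff[OF M] by blast
  then have "cinner (orth_proj M x - p) (orth_proj M x - p) = 0"
    using assms(2) by (simp add: cinner.diff_left cinner_orth_proj)
  then show ?thesis
    by (simp add: cinner_self)
qed

lemma orth_proj_id: "x \<in> M \<Longrightarrow> orth_proj M x = x"
  by (rule orth_proj_unique) auto

lemma cinner_orth_proj_commute: "cinner (orth_proj M x) y = cinner x (orth_proj M y)"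
  by (metis cinner_commute cinner_orth_proj orth_proj_in)

lemma orth_proj_add: "orth_proj M (x + y) = orth_proj M x + orth_proj M y"
  by (rule orth_proj_unique)
    (simp_all add: orth_proj_in closed_csubspaceD[OF M] cinner_add_left cinner_orth_proj)

lemma orth_proj_scaleC: "orth_proj M (scaleC c x) = scaleC c (orth_proj M x)"
  by (rule orth_proj_unique)
    (simp_all add: orth_proj_in closed_csubspaceD[OF M] cinner_scaleC_left cinner_orth_proj)

lemma norm_orth_proj_le: "norm (orth_proj M x) \<le> norm x"
proof (cases "orth_proj M x = 0")
  case False
  have "of_real ((norm (orth_proj M x))\<^sup>2) = cinner x (orth_proj M x)"
    by (metis cinner_orth_proj cinner_self orth_proj_in)
  then have "(norm (orth_proj M x))\<^sup>2 \<le> norm x * norm (orth_proj M x)"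
    using norm_cinner_le[of x "orth_proj M x"] by (simp flip: \<open>_ = cinner x _\<close> add: norm_power)
  then show ?thesis
    using False by (simp add: power2_eq_square)
qed simp

lemma bounded_linear_orth_proj: "bounded_linear (orth_proj M)"
proof (rule bounded_linear_intro[where K = 1])
  show "orth_proj M (r *\<^sub>R x) = r *\<^sub>R orth_proj M x" for r x
    by (metis orth_proj_scaleC scaleC_of_real)
qed (simp_all add: orth_proj_add norm_orth_proj_le)

lemma eq_UNIV_if_orth_trivial:
  assumes "\<And>x. (\<And>m. m \<in> M \<Longrightarrow> cinner x m = 0) \<Longrightarrow> x = 0"
  shows "M = UNIV"
proof -
  have "x \<in> M" for x
  proof -
    have "x - orth_proj M x = 0"
      by (rule assms) (rule orth_proj_orth)
    then show ?thesis
      using orth_proj_in[of x] by simp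
  qed
  then show ?thesis by blast
qed

end

section \<open>The absolute value of a symmetric operator\<close>

text \<open>The real polynomials in \<open>A\<close>. The absolute value of \<open>A\<close> is constructed below as a strong limit of such
  operators, so that it inherits every closed linear and multiplicative property of \<open>A\<close>.\<close>

inductive op_algebra :: "('a::real_vector \<Rightarrow> 'a) \<Rightarrow> ('a \<Rightarrow> 'a) \<Rightarrow> bool" for A where
  ident: "op_algebra A (\<lambda>x. x)"
| generator: "op_algebra A A"
| add: "op_algebra A S \<Longrightarrow> op_algebra A T \<Longrightarrow> op_algebra A (\<lambda>x. S x + T x)"
| scale: "op_algebra A S \<Longrightarrow> op_algebra A (\<lambda>x. r *\<^sub>R S x)"
| comp: "op_algebra A S \<Longrightarrow> op_algebra A T \<Longrightarrow> op_algebra A (\<lambda>x. S (T x))"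

lemma op_algebra_diff:
  assumes "op_algebra A S" "op_algebra A T"
  shows "op_algebra A (\<lambda>x. S x - T x)"
proof -
  have "op_algebra A (\<lambda>x. S x + (-1) *\<^sub>R T x)"
    by (rule op_algebra.add[OF assms(1) op_algebra.scale[OF assms(2)]])
  then show ?thesis by simp
qed

locale symmetric_contraction =
  fixes A :: "'a::{real_inner, complete_space} \<Rightarrow> 'a"
  assumes linear_A: "linear A"
    and symmetric_A: "inner (A x) y = inner x (A y)"
    and norm_A: "norm (A x) \<le> norm x"
begin

lemma op_linear: "op_algebra A S \<Longrightarrow> linear S"
proof (induction rule: op_algebra.induct)
  case (add S T)
  then show ?case by (simp add: linear_compose_add)
next
  case (scale S r)
  then show ?case by (auto intro: linear_compose_scale_right)
next
  case (comp S T)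
  then show ?case using linear_compose[of T S] by (simp add: o_def)
qed (simp_all add: linear_A linear_ident)

lemma op_commute:
  assumes "op_algebra A S" "op_algebra A T"
  shows "S (T x) = T (S x)"
proof -
  have *: "S (A x) = A (S x)" if "op_algebra A S" for S x
    using that by (induction arbitrary: x) (simp_all add: linear_add[OF linear_A] linear_scale[OF linear_A])
  show ?thesis
    using assms(2)
  proof (induction arbitrary: x)
    case (add U V)
    then show ?case by (simp add: linear_add[OF op_linear[OF assms(1)]])
  next
    case (scale U r)
    then show ?case by (simp add: linear_scale[OF op_linear[OF assms(1)]])
  qed (simp_all add: *[OF assms(1)])
qed

lemma op_symmetric: "op_algebra A S \<Longrightarrow> inner (S x) y = inner x (S y)"
proof (induction arbitrary: x y rule: op_algebra.induct)
  case (comp S T)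
  have "inner (S (T x)) y = inner x (T (S y))"
    using comp.IH by simp
  then show ?case
    using op_commute[OF comp.hyps] by simp
qed (simp_all add: symmetric_A inner_add_left inner_add_right)

definition defect :: "'a \<Rightarrow> 'a" where
  "defect x = x - A (A x)"

lemma defect_in: "op_algebra A defect"
proof -
  have "op_algebra A (\<lambda>x. x - A (A x))"
    by (rule op_algebra_diff[OF op_algebra.ident op_algebra.comp[OF op_algebra.generator op_algebra.generator]])
  then show ?thesis by (simp add: defect_def[abs_def])
qed

lemma defect_nonneg: "0 \<le> inner (defect x) x"
proof -
  have "inner (defect x) x = (norm x)\<^sup>2 - (norm (A x))\<^sup>2"
    by (simp add: defect_def inner_simps power2_norm_eq_inner symmetric_A)
  then show ?thesis
    using norm_A[of x] by (simp add: power_mono)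
qed

lemma norm_defect: "norm (defect x) \<le> norm x"
proof -
  have "(norm (defect x))\<^sup>2 = (norm x)\<^sup>2 - 2 * (norm (A x))\<^sup>2 + (norm (A (A x)))\<^sup>2"
    unfolding power2_norm_eq_inner
    by (simp add: defect_def inner_simps symmetric_A inner_commute algebra_simps)
  also have "\<dots> \<le> (norm x)\<^sup>2"
    using power_mono[OF norm_A[of "A x"] norm_ge_zero, of 2] zero_le_power2[of "norm (A x)"] by linarith
  finally show ?thesis
    by (rule power2_le_imp_le) simp
qed

text \<open>The polynomials in \<open>1 - A\<^sup>2\<close> with nonnegative coefficients: a multiplicatively closed supply of positive
  operators whose positivity is visible from the monomials.\<close>

inductive pos_cone :: "('a \<Rightarrow> 'a) \<Rightarrow> bool" where
  power: "pos_cone (defect ^^ k)"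
| add: "pos_cone S \<Longrightarrow> pos_cone T \<Longrightarrow> pos_cone (\<lambda>x. S x + T x)"
| scale: "0 \<le> r \<Longrightarrow> pos_cone S \<Longrightarrow> pos_cone (\<lambda>x. r *\<^sub>R S x)"

lemma defect_power_in: "op_algebra A (defect ^^ k)"
proof (induction k)
  case 0
  then show ?case using op_algebra.ident by (simp add: id_def)
next
  case (Suc k)
  then show ?case using op_algebra.comp[OF defect_in Suc] by (simp add: o_def)
qed

lemma pos_cone_in: "pos_cone S \<Longrightarrow> op_algebra A S"
  by (induction rule: pos_cone.induct) (simp_all add: op_algebra.add op_algebra.scale defect_power_in)

lemma pos_cone_nonneg: "pos_cone S \<Longrightarrow> 0 \<le> inner (S x) x"
proof (induction rule: pos_cone.induct)
  case (power k)
  let ?y = "(defect ^^ (k div 2)) x"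
  have sym: "inner ((defect ^^ m) u) v = inner u ((defect ^^ m) v)" for m u v
    by (rule op_symmetric[OF defect_power_in])
  show ?case
  proof (cases "even k")
    case True
    then have "k = k div 2 + k div 2" by presburger
    then have "inner ((defect ^^ k) x) x = inner ?y ?y"
      using sym by (metis comp_apply funpow_add)
    then show ?thesis by simp
  next
    case False
    then have "k = k div 2 + Suc (k div 2)" by presburger
    then have "(defect ^^ k) x = (defect ^^ (k div 2)) (defect ?y)"
      by (metis comp_apply funpow.simps(2) funpow_add)
    then show ?thesis
      using sym defect_nonneg[of ?y] by simp
  qed
qed (simp_all add: inner_simps)

lemma pos_cone_comp:
  assumes "pos_cone S" "pos_cone T"
  shows "pos_cone (\<lambda>x. S (T x))"
proof -
  have *: "pos_cone (\<lambda>x. (defect ^^ k) (T x))" for k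
    using assms(2)
  proof induction
    case (power l)
    then show ?case using pos_cone.power[of "k + l"] by (simp add: funpow_add o_def)
  next
    case (add U V)
    then show ?case
      using pos_cone.add[OF add.IH] by (simp add: linear_add[OF op_linear[OF defect_power_in]])
  next
    case (scale r U)
    then show ?case
      using pos_cone.scale[OF scale.hyps(1) scale.IH]
      by (simp add: linear_scale[OF op_linear[OF defect_power_in]])
  qed
  show ?thesis
    using assms(1) by induction (simp_all add: * pos_cone.add pos_cone.scale)
qed

text \<open>The iteration is started at \<open>0\<close> so that it increases with respect to \<open>pos_cone\<close>. Its limit \<open>S\<close> satisfies \<open>S = (1 - A\<^sup>2 + S\<^sup>2) / 2\<close>, so that
  \<open>(1 - S)\<^sup>2 = A\<^sup>2\<close>.\<close>

primrec sqrt_iter :: "nat \<Rightarrow> 'a \<Rightarrow> 'a" where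
  "sqrt_iter 0 = (\<lambda>x. 0)"
| "sqrt_iter (Suc n) = (\<lambda>x. (1/2) *\<^sub>R (defect x + sqrt_iter n (sqrt_iter n x)))"

lemma defect_pos: "pos_cone defect"
  using pos_cone.power[of 1] by simp

lemma zero_pos: "pos_cone (\<lambda>x. 0)"
  using pos_cone.scale[OF order_refl defect_pos] by simp

lemma sqrt_iter_pos: "pos_cone (sqrt_iter n)"
proof (induction n)
  case (Suc n)
  have "pos_cone (\<lambda>x. (1/2) *\<^sub>R (defect x + sqrt_iter n (sqrt_iter n x)))"
    by (rule pos_cone.scale[OF _ pos_cone.add[OF defect_pos pos_cone_comp[OF Suc Suc]]]) simp
  then show ?case by simp
qed (simp add: zero_pos)

lemmas sqrt_iter_linear = op_linear[OF pos_cone_in[OF sqrt_iter_pos]]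
  and sqrt_iter_symmetric = op_symmetric[OF pos_cone_in[OF sqrt_iter_pos]]
  and sqrt_iter_commute = op_commute[OF pos_cone_in[OF sqrt_iter_pos] pos_cone_in[OF sqrt_iter_pos]]

text \<open>As the operators commute, a difference of squares of two consecutive ones is their sum times their
  difference.\<close>

lemma sqrt_iter_step_pos: "pos_cone (\<lambda>x. sqrt_iter (Suc n) x - sqrt_iter n x)"
proof (induction n)
  case 0
  then show ?case using sqrt_iter_pos[of 1] by simp
next
  case (Suc n)
  let ?Y = "sqrt_iter n" and ?Z = "sqrt_iter (Suc n)"
  have "sqrt_iter (Suc (Suc n)) x - ?Z x = (1/2) *\<^sub>R (?Z (?Z x - ?Y x) + ?Y (?Z x - ?Y x))" for x
  proof -
    have "sqrt_iter (Suc (Suc n)) x - ?Z x = (1/2) *\<^sub>R (?Z (?Z x) - ?Y (?Y x))"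
      by (simp only: sqrt_iter.simps(2)[of "Suc n"] sqrt_iter.simps(2)[of n]) (simp add: algebra_simps)
    also have "\<dots> = (1/2) *\<^sub>R (?Z (?Z x - ?Y x) + ?Y (?Z x - ?Y x))"
      using sqrt_iter_commute[of n "Suc n" x]
      by (simp only: linear_diff[OF sqrt_iter_linear]) (simp add: algebra_simps)
    finally show ?thesis .
  qed
  moreover have "pos_cone (\<lambda>x. (1/2) *\<^sub>R (?Z (?Z x - ?Y x) + ?Y (?Z x - ?Y x)))"
    by (intro pos_cone.scale pos_cone.add pos_cone_comp[OF sqrt_iter_pos Suc]) simp
  ultimately show ?case by simp
qed

lemma sqrt_iter_mono_pos:
  assumes "n \<le> m"
  shows "pos_cone (\<lambda>x. sqrt_iter m x - sqrt_iter n x)"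
  using assms
proof (induction m rule: dec_induct)
  case base
  then show ?case using zero_pos by simp
next
  case (step m)
  have "sqrt_iter (Suc m) x - sqrt_iter n x =
      (sqrt_iter (Suc m) x - sqrt_iter m x) + (sqrt_iter m x - sqrt_iter n x)" for x
    by simp
  then show ?case
    using pos_cone.add[OF sqrt_iter_step_pos step.IH] by presburger
qed

lemma norm_sqrt_iter: "norm (sqrt_iter n x) \<le> norm x"
proof (induction n arbitrary: x)
  case (Suc n)
  have "norm (defect x + sqrt_iter n (sqrt_iter n x)) \<le> norm x + norm x"
    by (intro norm_triangle_mono norm_defect order_trans[OF Suc Suc])
  then show ?case by simp
qed simp

text \<open>The operator \<open>Y\<^sub>n (Y\<^sub>m - Y\<^sub>n)\<close> is positive. Therefore the norms \<open>\<parallel>Y\<^sub>n x\<parallel>\<close> increase, and their convergence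
  controls that of the vectors \<open>Y\<^sub>n x\<close>.\<close>

lemma sqrt_iter_dist:
  assumes "n \<le> m"
  shows "(norm (sqrt_iter m x - sqrt_iter n x))\<^sup>2 \<le> (norm (sqrt_iter m x))\<^sup>2 - (norm (sqrt_iter n x))\<^sup>2"
proof -
  let ?D = "\<lambda>x. sqrt_iter m x - sqrt_iter n x"
  have "0 \<le> inner (sqrt_iter n (?D x)) x"
    using pos_cone_nonneg[OF pos_cone_comp[OF sqrt_iter_pos sqrt_iter_mono_pos[OF assms]]] .
  then have "0 \<le> inner (?D x) (sqrt_iter n x)"
    using sqrt_iter_symmetric by simp
  then show ?thesis
    unfolding power2_norm_eq_inner by (simp add: inner_simps inner_commute)
qed

lemma sqrt_iter_convergent: "convergent (\<lambda>n. sqrt_iter n x)"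
proof -
  define a where "a n = (norm (sqrt_iter n x))\<^sup>2" for n
  have "incseq a"
    unfolding incseq_def a_def using sqrt_iter_dist by (smt (verit) zero_le_power2)
  moreover have "\<And>n. a n \<le> (norm x)\<^sup>2"
    unfolding a_def by (intro power_mono norm_sqrt_iter) simp
  ultimately have "convergent a"
    using incseq_convergent by (metis convergent_def)
  then have "Cauchy a"
    by (simp add: Cauchy_convergent_iff)
  have "Cauchy (\<lambda>n. sqrt_iter n x)"
  proof (rule metric_CauchyI)
    fix e :: real assume "0 < e"
    then obtain N where N: "\<And>m n. N \<le> m \<Longrightarrow> N \<le> n \<Longrightarrow> dist (a m) (a n) < e\<^sup>2"
      using \<open>Cauchy a\<close> unfolding Cauchy_def by (meson zero_less_power)
    have *: "dist (sqrt_iter m x) (sqrt_iter n x) < e" if "N \<le> n" "n \<le> m" for m n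
    proof -
      have "(norm (sqrt_iter m x - sqrt_iter n x))\<^sup>2 < e\<^sup>2"
        using sqrt_iter_dist[OF that(2), of x] N[of m n] that by (simp add: a_def dist_real_def)
      then show ?thesis
        using \<open>0 < e\<close> by (simp add: dist_norm power_less_imp_less_base)
    qed
    have "dist (sqrt_iter m x) (sqrt_iter n x) < e" if "N \<le> n" "N \<le> m" for m n
      using *[of n m] *[of m n] that by (cases "n \<le> m") (simp_all add: dist_commute)
    then show "\<exists>N. \<forall>m\<ge>N. \<forall>n\<ge>N. dist (sqrt_iter m x) (sqrt_iter n x) < e"
      by blast
  qed
  then show ?thesis by (simp add: Cauchy_convergent_iff)
qed

lemma ex_abs_operator:
  "\<exists>R Z. (\<forall>n. op_algebra A (Z n)) \<and> (\<forall>x. (\<lambda>n. Z n x) \<longlonglongrightarrow> R x) \<and>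
     (\<forall>x. R (R x) = A (A x)) \<and> (\<forall>x. R (A x) = A (R x)) \<and> (\<forall>x. 0 \<le> inner (R x) x)"
proof -
  define S where "S x = lim (\<lambda>n. sqrt_iter n x)" for x
  have S: "(\<lambda>n. sqrt_iter n x) \<longlonglongrightarrow> S x" for x
    using sqrt_iter_convergent by (simp add: S_def convergent_LIMSEQ_iff)
  have SS: "(\<lambda>n. sqrt_iter n (sqrt_iter n x)) \<longlonglongrightarrow> S (S x)" for x
  proof -
    have "(\<lambda>n. sqrt_iter n (sqrt_iter n x - S x)) \<longlonglongrightarrow> 0"
    proof (rule Lim_null_comparison)
      show "\<forall>\<^sub>F n in sequentially. norm (sqrt_iter n (sqrt_iter n x - S x)) \<le> norm (sqrt_iter n x - S x)"
        by (simp add: norm_sqrt_iter)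
      show "(\<lambda>n. norm (sqrt_iter n x - S x)) \<longlonglongrightarrow> 0"
        using S LIM_zero tendsto_norm_zero by blast
    qed
    then have "(\<lambda>n. sqrt_iter n (sqrt_iter n x - S x) + sqrt_iter n (S x)) \<longlonglongrightarrow> 0 + S (S x)"
      by (intro tendsto_intros S)
    then show ?thesis
      by (simp add: linear_diff[OF sqrt_iter_linear])
  qed
  have fix_eq: "S x = (1/2) *\<^sub>R (defect x + S (S x))" for x
  proof -
    have "(\<lambda>n. sqrt_iter (Suc n) x) \<longlonglongrightarrow> (1/2) *\<^sub>R (defect x + S (S x))"
      by (simp only: sqrt_iter.simps) (intro tendsto_intros SS)
    then show ?thesis
      using LIMSEQ_unique LIMSEQ_Suc[OF S[of x]] by blast
  qed
  have S_diff: "S (x - y) = S x - S y" for x y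
  proof -
    have "(\<lambda>n. sqrt_iter n (x - y)) \<longlonglongrightarrow> S x - S y"
      by (simp only: linear_diff[OF sqrt_iter_linear]) (intro tendsto_intros S)
    then show ?thesis
      using LIMSEQ_unique S by blast
  qed
  have "bounded_linear A"
    using linear_A norm_A by (intro bounded_linear_intro[where K=1]) (simp_all add: linear_add linear_scale)
  have S_A: "S (A x) = A (S x)" for x
  proof -
    have "(\<lambda>n. A (sqrt_iter n x)) \<longlonglongrightarrow> A (S x)"
      by (rule bounded_linear.tendsto[OF \<open>bounded_linear A\<close> S])
    then have "(\<lambda>n. sqrt_iter n (A x)) \<longlonglongrightarrow> A (S x)"
      by (simp add: op_commute[OF pos_cone_in[OF sqrt_iter_pos] op_algebra.generator])
    then show ?thesis
      using LIMSEQ_unique S by blast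
  qed
  define R where "R x = x - S x" for x
  have "R (R x) = A (A x)" for x
  proof -
    have "2 *\<^sub>R S x = defect x + S (S x)"
      using arg_cong[OF fix_eq[of x], of "\<lambda>y. 2 *\<^sub>R y"] by simp
    then show ?thesis
      by (simp add: R_def S_diff defect_def algebra_simps scaleR_2)
  qed
  moreover have "R (A x) = A (R x)" for x
    by (simp add: R_def S_A linear_diff[OF linear_A])
  moreover have "0 \<le> inner (R x) x" for x
  proof -
    have "norm (S x) \<le> norm x"
      by (rule Lim_norm_ubound[OF _ S]) (simp_all add: norm_sqrt_iter)
    then have "inner (S x) x \<le> norm x * norm x"
      by (meson mult_right_mono norm_cauchy_schwarz norm_ge_zero order_trans)
    then show ?thesis
      by (simp add: R_def inner_simps power2_norm_eq_inner[symmetric] power2_eq_square)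
  qed
  moreover have "(\<lambda>n. x - sqrt_iter n x) \<longlonglongrightarrow> R x" for x
    unfolding R_def by (intro tendsto_intros S)
  moreover have "op_algebra A (\<lambda>x. x - sqrt_iter n x)" for n
    by (intro op_algebra_diff op_algebra.ident pos_cone_in sqrt_iter_pos)
  ultimately show ?thesis
    by (intro exI[of _ R] exI[of _ "\<lambda>n x. x - sqrt_iter n x"]) simp
qed

end

section \<open>Unitary representations of abstract groups\<close>

locale unitary_group_rep = group G for G (structure) +
  fixes \<rho> :: "'a \<Rightarrow> 'h::chilbert_space \<Rightarrow> 'h"
  assumes rep: "unitary_rep G UNIV \<rho>"
begin

lemma rep_mult: "g \<in> carrier G \<Longrightarrow> h \<in> carrier G \<Longrightarrow> \<rho> (g \<otimes> h) v = \<rho> g (\<rho> h v)"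
  using rep by (simp add: unitary_rep_def)

lemma rep_add: "g \<in> carrier G \<Longrightarrow> \<rho> g (x + y) = \<rho> g x + \<rho> g y"
  and rep_scaleC: "g \<in> carrier G \<Longrightarrow> \<rho> g (scaleC c x) = scaleC c (\<rho> g x)"
  and rep_cinner: "g \<in> carrier G \<Longrightarrow> cinner (\<rho> g x) (\<rho> g y) = cinner x y"
  and inj_rep: "g \<in> carrier G \<Longrightarrow> inj (\<rho> g)"
  using rep by (simp_all add: unitary_rep_def unitary_between_def bij_betw_def)

lemma rep_one [simp]: "\<rho> \<one> v = v"
  using rep_mult[of \<one> \<one> v] inj_rep[of \<one>] by (simp add: inj_eq)

lemma rep_inv [simp]:
  assumes "g \<in> carrier G"
  shows "\<rho> (inv g) (\<rho> g v) = v" "\<rho> g (\<rho> (inv g) v) = v"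
  using rep_mult[of "inv g" g v] rep_mult[of g "inv g" v] assms by simp_all

lemma rep_adjoint: "g \<in> carrier G \<Longrightarrow> cinner (\<rho> g x) y = cinner x (\<rho> (inv g) y)"
  using rep_cinner[of g x "\<rho> (inv g) y"] by simp

lemma norm_rep: "g \<in> carrier G \<Longrightarrow> norm (\<rho> g x) = norm x"
  using rep_cinner[of g x x] by (simp add: cinner_self flip: of_real_power)

lemma bounded_linear_rep:
  assumes "g \<in> carrier G"
  shows "bounded_linear (\<rho> g)"
proof (rule bounded_linear_intro[where K = 1])
  show "\<rho> g (r *\<^sub>R x) = r *\<^sub>R \<rho> g x" for r x
    by (simp add: rep_scaleC[OF assms] flip: scaleC_of_real)
qed (simp_all add: assms rep_add norm_rep)

lemmas rep_diff = linear_diff[OF bounded_linear.linear[OF bounded_linear_rep]]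
  and rep_scaleR = linear_scale[OF bounded_linear.linear[OF bounded_linear_rep]]
  and rep_tendsto = bounded_linear.tendsto[OF bounded_linear_rep]

definition fixed_vectors :: "'a set \<Rightarrow> 'h set" where
  "fixed_vectors K = {v. \<forall>k\<in>K. \<rho> k v = v}"

lemma closed_csubspace_fixed_vectors:
  assumes "K \<subseteq> carrier G"
  shows "closed_csubspace (fixed_vectors K)"
proof -
  have "closed {v. \<rho> k v = v}" if "k \<in> K" for k
    using assms that
    by (intro closed_Collect_eq linear_continuous_on bounded_linear_rep continuous_on_id) auto
  then have "closed (\<Inter>k\<in>K. {v. \<rho> k v = v})" by blast
  moreover have "(\<Inter>k\<in>K. {v. \<rho> k v = v}) = fixed_vectors K"
    by (auto simp: fixed_vectors_def)
  ultimately show ?thesis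
    using assms linear_0[OF bounded_linear.linear[OF bounded_linear_rep]]
    by (auto simp: closed_csubspace_def fixed_vectors_def rep_add rep_scaleC subset_iff)
qed

text \<open>The element of least norm of the closed convex hull of the orbit of \<open>u\<close> is unique, hence fixed. It is not
  \<open>0\<close> because the hull lies in a half-space that does not contain \<open>0\<close>.\<close>

lemma ex_fixed_vector:
  assumes "subgroup K G" "0 < \<epsilon>"
    and "\<And>k. k \<in> K \<Longrightarrow> \<epsilon> \<le> Re (cinner (\<rho> k u) u)"
  shows "\<exists>v\<in>fixed_vectors K. v \<noteq> 0"
proof -
  interpret K: subgroup K G by fact
  let ?O = "(\<lambda>k. \<rho> k u) ` K"
  let ?C = "closure (convex hull ?O)"
  have "K \<noteq> {}"
    using K.one_closed by blast
  then have "?C \<noteq> {}"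
    by simp
  moreover have "convex ?C"
    by (intro convex_closure convex_convex_hull)
  ultimately have ex1: "\<exists>!v. v \<in> ?C \<and> (\<forall>y\<in>?C. norm v \<le> norm y)"
    by (intro ex1_norm_min closed_closure)
  define v where "v = (THE v. v \<in> ?C \<and> (\<forall>y\<in>?C. norm v \<le> norm y))"
  have "v \<in> ?C \<and> (\<forall>y\<in>?C. norm v \<le> norm y)"
    unfolding v_def by (rule theI'[OF ex1])
  then have v: "v \<in> ?C" "\<And>y. y \<in> ?C \<Longrightarrow> norm v \<le> norm y"
    by simp_all
  have uniq: "w = v" if "w \<in> ?C" "\<And>y. y \<in> ?C \<Longrightarrow> norm w \<le> norm y" for w
    unfolding v_def by (rule the1_equality[OF ex1, symmetric]) (use that in simp)
  have "\<rho> k v = v" if "k \<in> K" for k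
  proof (rule uniq)
    have kG: "k \<in> carrier G"
      using that K.mem_carrier by blast
    have "\<rho> k ` ?C \<subseteq> closure (\<rho> k ` (convex hull ?O))"
      by (rule closure_bounded_linear_image_subset[OF bounded_linear_rep[OF kG]])
    also have "\<rho> k ` (convex hull ?O) = convex hull (\<rho> k ` ?O)"
      by (rule convex_hull_linear_image[OF bounded_linear.linear[OF bounded_linear_rep[OF kG]]])
    also have "\<rho> k ` ?O \<subseteq> ?O"
      using that K.mem_carrier by (auto simp flip: rep_mult)
    finally show "\<rho> k v \<in> ?C"
      using v(1) by (meson closure_mono hull_mono image_eqI subset_iff)
    show "norm (\<rho> k v) \<le> norm y" if "y \<in> ?C" for y
      using v(2)[OF that] by (simp add: norm_rep[OF kG])
  qed
  then have "v \<in> fixed_vectors K"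
    by (simp add: fixed_vectors_def)
  moreover have "\<epsilon> \<le> inner u (\<rho> k u)" if "k \<in> K" for k
    using assms(3)[OF that] by (subst inner_commute) (simp add: inner_eq_Re_cinner)
  then have "?C \<subseteq> {x. \<epsilon> \<le> inner u x}"
    by (intro closure_minimal hull_minimal convex_halfspace_ge closed_halfspace_ge) auto
  then have "v \<noteq> 0"
    using v(1) assms(2) by auto
  ultimately show ?thesis by blast
qed

end

subsection \<open>Schur's lemma for operators on a subspace\<close>

locale irreducible_group_rep = group G for G (structure) +
  fixes \<rho> :: "'a \<Rightarrow> 'h::chilbert_space \<Rightarrow> 'h"
  assumes irreducible: "irreducible_rep G UNIV \<rho>"

sublocale irreducible_group_rep \<subseteq> unitary_group_rep
  using irreducible by unfold_locales (simp add: irreducible_rep_def)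

context irreducible_group_rep
begin

text \<open>The vectors orthogonal to an orbit form a closed invariant subspace.\<close>

lemma orbit_total:
  assumes "x \<noteq> 0" "\<And>g. g \<in> carrier G \<Longrightarrow> cinner (\<rho> g x) y = 0"
  shows "y = 0"
proof -
  let ?W = "{y. \<forall>z\<in>(\<lambda>g. \<rho> g x) ` carrier G. cinner z y = 0}"
  have "\<rho> g w \<in> ?W" if "g \<in> carrier G" "w \<in> ?W" for g w
  proof -
    have "cinner (\<rho> h x) (\<rho> g w) = cinner (\<rho> (inv g \<otimes> h) x) w" if "h \<in> carrier G" for h
      using \<open>g \<in> carrier G\<close> that rep_adjoint[of "inv g" "\<rho> h x" w] by (simp add: rep_mult)
    then show ?thesis
      using that by simp
  qed
  then have inv: "\<forall>g\<in>carrier G. \<forall>w\<in>?W. \<rho> g w \<in> ?W" by blast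
  have dichotomy: "W = {0} \<or> W = UNIV"
    if "closed_csubspace W" "\<forall>g\<in>carrier G. \<forall>w\<in>W. \<rho> g w \<in> W" for W
    using irreducible that by (simp add: irreducible_rep_def)
  have "?W = {0} \<or> ?W = UNIV"
    by (rule dichotomy[OF closed_csubspace_orthogonal inv])
  moreover have "x \<notin> ?W"
  proof
    assume "x \<in> ?W"
    then have "cinner (\<rho> \<one> x) x = 0"
      using one_closed by (simp del: rep_one)
    then show False
      using assms(1) by (simp add: cinner_self)
  qed
  ultimately have "?W = {0}" by blast
  then show ?thesis using assms(2) by blast
qed

context
  fixes M :: "'h set"
  assumes M: "closed_csubspace M"
begin

text \<open>For a map \<open>S\<close> of \<open>M\<close> into itself, the second condition says that \<open>S\<close> is symmetric and commutes with the
  compressions to \<open>M\<close> of all the operators of the representation.\<close>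

definition intertwines :: "('h \<Rightarrow> 'h) \<Rightarrow> bool" where
  "intertwines S \<longleftrightarrow> (\<forall>x\<in>M. S x \<in> M) \<and>
     (\<forall>g\<in>carrier G. \<forall>u\<in>M. \<forall>w\<in>M. cinner (\<rho> g (S u)) w = cinner (\<rho> g u) (S w))"

lemma intertwines_add:
  "intertwines S \<Longrightarrow> intertwines T \<Longrightarrow> intertwines (\<lambda>x. S x + T x)"
  by (simp add: intertwines_def rep_add cinner_add_left cinner_add_right closed_csubspaceD[OF M])

lemma intertwines_scale: "intertwines S \<Longrightarrow> intertwines (\<lambda>x. r *\<^sub>R S x)"
  by (simp add: intertwines_def rep_scaleR cinner.scaleR_left cinner.scaleR_right
      closed_csubspaceD[OF M])

lemma intertwines_ident: "intertwines (\<lambda>x. x)"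
  by (simp add: intertwines_def)

lemma intertwines_op_algebra:
  assumes "symmetric_contraction A" "intertwines A" "op_algebra A S"
  shows "intertwines S"
  using assms(3)
proof induction
  case (comp S T)
  have "cinner (\<rho> g (S (T u))) w = cinner (\<rho> g u) (S (T w))"
    if "g \<in> carrier G" "u \<in> M" "w \<in> M" for g u w
  proof -
    have "cinner (\<rho> g (S (T u))) w = cinner (\<rho> g u) (T (S w))"
      using comp.IH that by (simp add: intertwines_def)
    then show ?thesis
      using symmetric_contraction.op_commute[OF assms(1) comp.hyps] by simp
  qed
  then show ?case
    using comp.IH by (simp add: intertwines_def)
qed (simp_all add: intertwines_ident assms(2) intertwines_add intertwines_scale)

lemma intertwines_lim:
  assumes "\<And>n. intertwines (Z n)" "\<And>x. (\<lambda>n. Z n x) \<longlonglongrightarrow> R x"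
  shows "intertwines R"
  unfolding intertwines_def
proof (intro conjI ballI)
  show "R x \<in> M" if "x \<in> M" for x
    using closed_sequentially[OF closed_csubspaceD(1)[OF M] _ assms(2)[of x]] assms(1) that
    by (simp add: intertwines_def)
  fix g u w assume g: "g \<in> carrier G" and u: "u \<in> M" "w \<in> M"
  have "(\<lambda>n. cinner (\<rho> g (Z n u)) w) \<longlonglongrightarrow> cinner (\<rho> g (R u)) w"
    by (intro cinner.tendsto rep_tendsto[OF g] assms tendsto_const)
  moreover have "(\<lambda>n. cinner (\<rho> g u) (Z n w)) \<longlonglongrightarrow> cinner (\<rho> g u) (R w)"
    by (intro cinner.tendsto assms tendsto_const)
  moreover have "cinner (\<rho> g (Z n u)) w = cinner (\<rho> g u) (Z n w)" for n
    using assms(1) g u by (simp add: intertwines_def)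
  ultimately show "cinner (\<rho> g (R u)) w = cinner (\<rho> g u) (R w)"
    using LIMSEQ_unique by simp
qed

text \<open>The ranges of operators with product \<open>0\<close> generate orthogonal invariant subspaces.\<close>

lemma intertwines_zero_product:
  assumes "intertwines X" "intertwines Y" "\<And>x. x \<in> M \<Longrightarrow> X (Y x) = 0"
  shows "(\<forall>x\<in>M. X x = 0) \<or> (\<forall>x\<in>M. Y x = 0)"
proof (rule disjCI, rule ballI)
  assume "\<not> (\<forall>x\<in>M. Y x = 0)"
  then obtain w where w: "w \<in> M" "Y w \<noteq> 0" by blast
  show "X u = 0" if "u \<in> M" for u
  proof (rule ccontr)
    assume "X u \<noteq> 0"
    moreover have "cinner (\<rho> g (X u)) (Y w) = 0" if "g \<in> carrier G" for g
    proof -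
      have "Y w \<in> M"
        using assms(2) w(1) by (simp add: intertwines_def)
      then show ?thesis
        using assms(1,3) \<open>u \<in> M\<close> w that by (simp add: intertwines_def cinner.zero_right)
    qed
    ultimately show False
      using orbit_total w(2) by blast
  qed
qed

text \<open>With \<open>R\<close> the absolute value of a multiple \<open>A\<close> of \<open>T\<close>, the product \<open>(R + A) (R - A)\<close> vanishes. So \<open>A\<close>
  agrees on \<open>M\<close> with \<open>- R\<close> or with \<open>R\<close>.\<close>

lemma intertwines_definite:
  assumes "bounded_linear T" "intertwines T" "\<And>x y. inner (T x) y = inner x (T y)"
  shows "(\<forall>x\<in>M. 0 \<le> inner (T x) x) \<or> (\<forall>x\<in>M. inner (T x) x \<le> 0)"
proof -
  interpret T: bounded_linear T by fact
  obtain K where K: "0 < K" "\<And>x. norm (T x) \<le> norm x * K"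
    using T.pos_bounded by blast
  define A where "A x = (1 / K) *\<^sub>R T x" for x
  have A: "symmetric_contraction A"
  proof
    show "norm (A x) \<le> norm x" for x
      using K(2)[of x] K(1) by (simp add: A_def field_simps)
  qed (simp_all add: A_def assms(3) T.add T.scaleR scaleR_add_right)
  have iA: "intertwines A"
    using intertwines_scale[OF assms(2), of "1 / K"] by (simp add: A_def[abs_def])
  obtain R Z where Z: "\<And>n. op_algebra A (Z n)" "\<And>x. (\<lambda>n. Z n x) \<longlonglongrightarrow> R x"
    and RR: "\<And>x. R (R x) = A (A x)" and RA: "\<And>x. R (A x) = A (R x)"
    and pos: "\<And>x. 0 \<le> inner (R x) x"
    using symmetric_contraction.ex_abs_operator[OF A] by metis
  have iR: "intertwines R"
    using intertwines_lim[OF intertwines_op_algebra[OF A iA Z(1)] Z(2)] .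
  let ?X = "\<lambda>x. R x + A x" and ?Y = "\<lambda>x. R x + (-1) *\<^sub>R A x"
  have R_lin: "R (x - y) = R x - R y" for x y
  proof -
    have "(\<lambda>n. Z n (x - y)) \<longlonglongrightarrow> R x - R y"
      by (simp only: linear_diff[OF symmetric_contraction.op_linear[OF A Z(1)]])
        (intro tendsto_intros Z(2))
    then show ?thesis
      using LIMSEQ_unique Z(2) by blast
  qed
  have A_lin: "A (x - y) = A x - A y" for x y
    by (simp add: A_def T.diff scaleR_diff_right)
  have "?X (?Y x) = 0" for x
    by (simp add: R_lin A_lin RR RA)
  then have "(\<forall>x\<in>M. ?X x = 0) \<or> (\<forall>x\<in>M. ?Y x = 0)"
    by (intro intertwines_zero_product intertwines_add intertwines_scale iR iA)
  then have "(\<forall>x\<in>M. A x = - R x) \<or> (\<forall>x\<in>M. A x = R x)"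
    by (auto simp: add_eq_0_iff)
  then have "(\<forall>x\<in>M. inner (A x) x \<le> 0) \<or> (\<forall>x\<in>M. 0 \<le> inner (A x) x)"
    using pos by auto
  moreover have "inner (T x) x = K * inner (A x) x" for x
    using K(1) by (simp add: A_def)
  ultimately show ?thesis
    using K(1) by (auto simp: zero_le_mult_iff mult_le_0_iff)
qed

text \<open>All the operators \<open>T - s\<close> are definite on \<open>M\<close>. Therefore the value \<open>t\<close> of the quadratic form of \<open>T\<close> at
  one unit vector of \<open>M\<close> is its value at every other one, and \<open>T - t\<close> vanishes by polarization.\<close>

lemma intertwines_scalar:
  assumes T: "bounded_linear T" and iT: "intertwines T"
    and sym: "\<And>x y. inner (T x) y = inner x (T y)"
  shows "\<exists>t::real. \<forall>x\<in>M. T x = t *\<^sub>R x"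
proof (cases "\<exists>e\<in>M. e \<noteq> 0")
  case True
  then obtain e where e: "e \<in> M" "e \<noteq> 0" by blast
  define t where "t = inner (T e) e / (norm e)\<^sup>2"
  interpret T: bounded_linear T by fact
  have definite: "(\<forall>x\<in>M. s * (norm x)\<^sup>2 \<le> inner (T x) x) \<or> (\<forall>x\<in>M. inner (T x) x \<le> s * (norm x)\<^sup>2)"
    for s
  proof -
    have "bounded_linear (\<lambda>x. T x + (-s) *\<^sub>R x)"
      by (intro bounded_linear_add T bounded_linear_scaleR_right)
    moreover have "intertwines (\<lambda>x. T x + (-s) *\<^sub>R x)"
      by (intro intertwines_add iT intertwines_scale intertwines_ident)
    moreover have "inner (T x + (-s) *\<^sub>R x) y = inner x (T y + (-s) *\<^sub>R y)" for x y
      unfolding inner_add_left inner_add_right sym by simp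
    ultimately have "(\<forall>x\<in>M. 0 \<le> inner (T x + (-s) *\<^sub>R x) x) \<or>
        (\<forall>x\<in>M. inner (T x + (-s) *\<^sub>R x) x \<le> 0)"
      by (rule intertwines_definite)
    moreover have "inner (T x + (-s) *\<^sub>R x) x = inner (T x) x - s * (norm x)\<^sup>2" for x
      unfolding inner_add_left by (simp add: power2_norm_eq_inner)
    ultimately show ?thesis by simp
  qed
  have Te: "inner (T e) e = t * (norm e)\<^sup>2"
    using e by (simp add: t_def)
  have quad: "inner (T x) x = t * (norm x)\<^sup>2" if x: "x \<in> M" for x
  proof (cases "x = 0")
    case False
    have "s \<le> inner (T x) x / (norm x)\<^sup>2" if "s < t" for s
    proof -
      have "s * (norm e)\<^sup>2 < inner (T e) e"
        unfolding Te using that e by simp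
      then have "s * (norm x)\<^sup>2 \<le> inner (T x) x"
        using definite[of s] x e by force
      then show ?thesis
        using False by (simp add: pos_le_divide_eq)
    qed
    then have "t \<le> inner (T x) x / (norm x)\<^sup>2"
      by (rule dense_le)
    moreover have "inner (T x) x / (norm x)\<^sup>2 \<le> s" if "t < s" for s
    proof -
      have "inner (T e) e < s * (norm e)\<^sup>2"
        unfolding Te using that e by simp
      then have "inner (T x) x \<le> s * (norm x)\<^sup>2"
        using definite[of s] x e by force
      then show ?thesis
        using False by (simp add: pos_divide_le_eq)
    qed
    then have "inner (T x) x / (norm x)\<^sup>2 \<le> t"
      by (rule dense_ge)
    ultimately have "inner (T x) x / (norm x)\<^sup>2 = t" by simp
    then show ?thesis
      using False by (simp add: field_simps)
  qed simp
  have "T x = t *\<^sub>R x" if x: "x \<in> M" for x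
  proof -
    have y: "T x - t *\<^sub>R x \<in> M" (is "?y \<in> M")
      using iT x closed_csubspace_diff[OF M] closed_csubspaceD[OF M] by (simp add: intertwines_def)
    have "inner (T (x + ?y)) (x + ?y) = t * (norm (x + ?y))\<^sup>2"
      using x y closed_csubspaceD[OF M] by (intro quad)
    then have "inner (T x) ?y = t * inner x ?y"
      using quad[OF x] quad[OF y] sym[of ?y x]
      unfolding power2_norm_eq_inner T.add inner_add_left inner_add_right
      by (simp only: inner_commute[of ?y "T x"] inner_commute[of ?y x]) (simp add: distrib_left)
    then have "inner ?y ?y = 0"
      by (subst (1) inner_diff_left) simp
    then show ?thesis by simp
  qed
  then show ?thesis by blast
next
  case False
  moreover have "T 0 = 0"
    using T by (simp add: linear_simps)
  ultimately have "T x = 0 *\<^sub>R x" if "x \<in> M" for x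
    using that by fastforce
  then show ?thesis by blast
qed

end

end

section \<open>Compressions to the fixed vectors of a subgroup\<close>

text \<open>Weak convergence of a bounded sequence need only be tested on a total set of vectors. The candidate
  for the limit is the projection of \<open>x\<close> to \<open>N\<close>.\<close>

lemma closed_csubspace_weak_limits:
  fixes y :: "nat \<Rightarrow> 'h::chilbert_space"
  assumes y: "\<And>n. norm (y n) \<le> C" and x: "norm x \<le> C" and N: "closed_csubspace N"
  shows "closed_csubspace {z. (\<lambda>n. cinner (y n) z) \<longlonglongrightarrow> cinner x (orth_proj N z)}"
    (is "closed_csubspace ?Z")
proof -
  have C0: "0 \<le> C"
    using norm_ge_zero order_trans x by blast
  have "closed ?Z"
    unfolding closed_sequential_limits
  proof (intro allI impI)
    fix f z assume f: "(\<forall>k. f k \<in> ?Z) \<and> f \<longlonglongrightarrow> z"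
    have "(\<lambda>n. cinner (y n) z) \<longlonglongrightarrow> cinner x (orth_proj N z)"
    proof (rule LIMSEQ_I)
      fix e :: real assume "0 < e"
      define d where "d = e / (3 * (C + 1))"
      have "0 < d" and d: "d * C < e / 3"
        using \<open>0 < e\<close> C0 by (simp_all add: d_def field_simps)
      obtain k where k: "norm (f k - z) < d"
        using f LIMSEQ_D[of f z, OF _ \<open>0 < d\<close>] by blast
      have "(\<lambda>n. cinner (y n) (f k)) \<longlonglongrightarrow> cinner x (orth_proj N (f k))"
        using f by simp
      then obtain n0 where n0: "\<And>n. n \<ge> n0 \<Longrightarrow>
          norm (cinner (y n) (f k) - cinner x (orth_proj N (f k))) < e / 3"
        using LIMSEQ_D[of _ _ "e / 3"] \<open>0 < e\<close> by (metis divide_pos_pos zero_less_numeral)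
      have "norm (cinner (y n) z - cinner x (orth_proj N z)) < e" if "n \<ge> n0" for n
      proof -
        have small: "norm (cinner a (f k - z)) < e / 3" if "norm a \<le> C" for a
        proof -
          have "norm (cinner a (f k - z)) \<le> norm a * norm (f k - z)"
            by (rule norm_cinner_le)
          also have "\<dots> \<le> C * d"
            using that k C0 by (intro mult_mono) auto
          finally show ?thesis
            using d by (simp add: mult.commute)
        qed
        have eq: "cinner (y n) z - cinner x (orth_proj N z) =
            (cinner (y n) (f k) - cinner x (orth_proj N (f k))) - cinner (y n) (f k - z)
            + cinner (orth_proj N x) (f k - z)"
          by (simp add: cinner.diff_right cinner_orth_proj_commute[OF N])
        have "norm (orth_proj N x) \<le> C"
          using norm_orth_proj_le[OF N] x order_trans by blast
        then have "norm (cinner (orth_proj N x) (f k - z)) < e / 3"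
          by (rule small)
        moreover have "norm (cinner (y n) (f k - z)) < e / 3"
          by (rule small[OF y])
        ultimately show ?thesis
          unfolding eq using n0[OF that] norm_triangle_ineq4[of
            "cinner (y n) (f k) - cinner x (orth_proj N (f k))" "cinner (y n) (f k - z)"]
            norm_triangle_ineq[of "cinner (y n) (f k) - cinner x (orth_proj N (f k)) -
              cinner (y n) (f k - z)" "cinner (orth_proj N x) (f k - z)"]
          by linarith
      qed
      then show "\<exists>no. \<forall>n\<ge>no. norm (cinner (y n) z - cinner x (orth_proj N z)) < e"
        by blast
    qed
    then show "z \<in> ?Z" by simp
  qed
  moreover have "orth_proj N 0 = 0"
    by (rule orth_proj_id[OF N closed_csubspaceD(2)[OF N]])
  ultimately show ?thesis
    unfolding closed_csubspace_def
    by (auto simp: cinner_add_right cinner_scaleC_right orth_proj_add[OF N] orth_proj_scaleC[OF N]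
        cinner.zero_right intro!: tendsto_add tendsto_mult_left)
qed

text \<open>The abstract content of purity: conjugation by suitable elements of \<open>K\<close> moves every element of \<open>D\<close>
  so far away that it commutes with any given element of the group.\<close>

locale asymptotically_commuting = irreducible_group_rep +
  fixes K D :: "'a set" and \<Theta> :: "nat \<Rightarrow> 'a"
  assumes K: "subgroup K G" and D: "subgroup D G" and K_le_D: "K \<subseteq> D"
    and \<Theta>: "\<Theta> n \<in> K"
    and eventually_commute: "h \<in> D \<Longrightarrow> g \<in> carrier G \<Longrightarrow>
      \<forall>\<^sub>F n in sequentially. g \<otimes> (\<Theta> n \<otimes> h \<otimes> inv (\<Theta> n)) = (\<Theta> n \<otimes> h \<otimes> inv (\<Theta> n)) \<otimes> g"
begin

abbreviation M :: "'b set" where "M \<equiv> fixed_vectors K"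
abbreviation P :: "'b \<Rightarrow> 'b" where "P \<equiv> orth_proj M"
abbreviation far :: "nat \<Rightarrow> 'a \<Rightarrow> 'a" where "far n h \<equiv> \<Theta> n \<otimes> h \<otimes> inv (\<Theta> n)"

lemma K_carrier: "k \<in> K \<Longrightarrow> k \<in> carrier G"
  and D_carrier: "h \<in> D \<Longrightarrow> h \<in> carrier G"
  by (rule subgroup.mem_carrier[OF K] subgroup.mem_carrier[OF D], assumption)+

lemma \<Theta>_carrier [simp]: "\<Theta> n \<in> carrier G"
  by (rule K_carrier[OF \<Theta>])

lemma M: "closed_csubspace M"
  by (rule closed_csubspace_fixed_vectors[OF subgroup.subset[OF K]])

lemma rep_fixed: "u \<in> M \<Longrightarrow> k \<in> K \<Longrightarrow> \<rho> k u = u"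
  by (simp add: fixed_vectors_def)

lemma inv_K: "k \<in> K \<Longrightarrow> inv k \<in> K"
  by (rule subgroup.m_inv_closed[OF K])

lemma far_inv:
  assumes "h \<in> D"
  shows "inv (far n h) = far n (inv h)"
  using D_carrier[OF assms] by (simp add: inv_mult_group m_assoc)

lemma rep_far:
  assumes "h \<in> D" "u \<in> M"
  shows "\<rho> (far n h) u = \<rho> (\<Theta> n) (\<rho> h u)"
proof -
  have "\<rho> (far n h) u = \<rho> (\<Theta> n) (\<rho> h (\<rho> (inv (\<Theta> n)) u))"
    using D_carrier[OF assms(1)] by (simp add: rep_mult)
  then show ?thesis
    using rep_fixed[OF assms(2) inv_K[OF \<Theta>]] by simp
qed

text \<open>The vectors \<open>\<rho> (far n h) u\<close> all have the same projection to \<open>M\<close>, and each element of \<open>K\<close> fixes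
  almost all of them, which kills their components along the vectors \<open>\<rho> k v - v\<close>; these span the
  orthogonal complement of \<open>M\<close>.\<close>

lemma weak_limit_far:
  assumes h: "h \<in> D" and u: "u \<in> M"
  shows "(\<lambda>n. cinner (\<rho> (far n h) u) z) \<longlonglongrightarrow> cinner (\<rho> h u) (P z)"
proof -
  let ?y = "\<lambda>n. \<rho> (far n h) u"
  let ?Z = "{z. (\<lambda>n. cinner (?y n) z) \<longlonglongrightarrow> cinner (\<rho> h u) (P z)}"
  have hG: "h \<in> carrier G" using D_carrier[OF h] .
  have Z: "closed_csubspace ?Z"
    by (rule closed_csubspace_weak_limits[OF _ _ M, of _ "norm u"]) (simp_all add: norm_rep hG)
  have M_le: "m \<in> ?Z" if "m \<in> M" for m
  proof -
    have "cinner (?y n) m = cinner (\<rho> h u) m" for n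
      using rep_fixed[OF that inv_K[OF \<Theta>]] by (simp add: rep_far[OF h u] rep_adjoint)
    then show ?thesis
      using orth_proj_id[OF M that] by simp
  qed
  have diff_le: "\<rho> k v - v \<in> ?Z" if k: "k \<in> K" for k v
  proof -
    have kG: "inv k \<in> carrier G" "k \<in> carrier G"
      using K_carrier[OF k] by simp_all
    have "P (\<rho> k v) = P v"
    proof (rule orth_proj_unique[OF M orth_proj_in[OF M]])
      fix m assume "m \<in> M"
      then have "cinner (\<rho> k v) m = cinner v m"
        using rep_fixed[OF _ inv_K[OF k]] by (simp add: rep_adjoint kG)
      then show "cinner (\<rho> k v) m = cinner (P v) m"
        using cinner_orth_proj[OF M \<open>m \<in> M\<close>] by simp
    qed
    then have "P (\<rho> k v - v) = 0"
      by (simp add: linear_diff[OF bounded_linear.linear[OF bounded_linear_orth_proj[OF M]]])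
    moreover have "\<forall>\<^sub>F n in sequentially. cinner (?y n) (\<rho> k v - v) = 0"
      using eventually_commute[OF h kG(1)]
    proof eventually_elim
      case (elim n)
      have "\<rho> (inv k) (?y n) = \<rho> (far n h) (\<rho> (inv k) u)"
        using arg_cong[OF elim, of "\<lambda>g. \<rho> g u"] hG kG by (simp add: rep_mult)
      also have "\<dots> = ?y n"
        using rep_fixed[OF u inv_K[OF k]] by simp
      finally have "\<rho> (inv k) (?y n) = ?y n" .
      then have "cinner (?y n) (\<rho> k v) = cinner (?y n) v"
        using rep_adjoint[OF kG(1), of "?y n" v] kG by simp
      then show ?case by (simp add: cinner.diff_right)
    qed
    ultimately show ?thesis
      by (simp add: cinner.zero_right tendsto_eventually)
  qed
  have "?Z = UNIV"
  proof (rule eq_UNIV_if_orth_trivial[OF Z])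
    fix x assume orth: "\<And>m. m \<in> ?Z \<Longrightarrow> cinner x m = 0"
    have "x \<in> M"
      unfolding fixed_vectors_def
    proof (safe)
      fix k assume k: "k \<in> K"
      define y where "y = \<rho> k x - x"
      have "cinner x (\<rho> (inv k) y - y) = 0"
        by (rule orth[OF diff_le[OF inv_K[OF k]]])
      then have "cinner (\<rho> k x - x) y = 0"
        by (simp add: cinner.diff_right cinner.diff_left rep_adjoint[OF K_carrier[OF k]])
      then show "\<rho> k x = x"
        by (simp add: cinner_self flip: y_def) (simp add: y_def)
    qed
    then have "cinner x x = 0"
      using orth M_le by blast
    then show "x = 0"
      by (simp add: cinner_self)
  qed
  then show ?thesis by blast
qed

text \<open>Both sides are limits of \<open>\<langle>\<rho>(g) \<rho>(far n h) u, w\<rangle>\<close>: one uses the weak convergence of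
  \<open>\<rho>(far n h) u\<close>, the other one moves \<open>\<rho>(far n h)\<close>, which eventually commutes with \<open>\<rho>(g)\<close>, to \<open>w\<close>.\<close>

lemma compressions_commute:
  assumes h: "h \<in> D" and g: "g \<in> carrier G" and u: "u \<in> M" and w: "w \<in> M"
  shows "cinner (\<rho> g (P (\<rho> h u))) w = cinner (\<rho> g u) (P (\<rho> (inv h) w))"
proof (rule LIMSEQ_unique)
  let ?a = "\<lambda>n. cinner (\<rho> g (\<rho> (far n h) u)) w"
  have hG: "h \<in> carrier G" and h': "inv h \<in> D"
    using D_carrier[OF h] subgroup.m_inv_closed[OF D h] by simp_all
  have "(\<lambda>n. cinner (\<rho> (far n h) u) (\<rho> (inv g) w)) \<longlonglongrightarrow> cinner (\<rho> h u) (P (\<rho> (inv g) w))"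
    by (rule weak_limit_far[OF h u])
  then show "?a \<longlonglongrightarrow> cinner (\<rho> g (P (\<rho> h u))) w"
    by (simp add: rep_adjoint[OF g] cinner_orth_proj_commute[OF M])
  have "(\<lambda>n. cnj (cinner (\<rho> (far n (inv h)) w) (\<rho> g u))) \<longlonglongrightarrow>
      cnj (cinner (\<rho> (inv h) w) (P (\<rho> g u)))"
    by (intro tendsto_cnj weak_limit_far[OF h' w])
  then have "(\<lambda>n. cinner (\<rho> g u) (\<rho> (far n (inv h)) w)) \<longlonglongrightarrow> cinner (\<rho> g u) (P (\<rho> (inv h) w))"
    unfolding cinner_commute[symmetric] by (simp add: cinner_orth_proj_commute[OF M])
  moreover have "\<forall>\<^sub>F n in sequentially. cinner (\<rho> g u) (\<rho> (far n (inv h)) w) = ?a n"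
    using eventually_commute[OF h g]
  proof eventually_elim
    case (elim n)
    have "\<rho> g (\<rho> (far n h) u) = \<rho> (far n h) (\<rho> g u)"
      using arg_cong[OF elim, of "\<lambda>g. \<rho> g u"] hG g by (simp add: rep_mult)
    then show ?case
      using rep_adjoint[of "far n h" "\<rho> g u" w] hG far_inv[OF h] by simp
  qed
  ultimately show "?a \<longlonglongrightarrow> cinner (\<rho> g u) (P (\<rho> (inv h) w))"
    by (rule Lim_transform_eventually)
qed

text \<open>Schur's lemma applies to \<open>A + A\<^sup>*\<close> and to \<open>\<i> (A - A\<^sup>*)\<close>, where \<open>A\<close> is the compression of \<open>\<rho> h\<close>.\<close>

lemma compression_scalar:
  assumes h: "h \<in> D"
  shows "\<exists>c. \<forall>u\<in>M. \<forall>z\<in>M. cinner (\<rho> h u) z = c * cinner u z"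
proof -
  have hG: "h \<in> carrier G" and h': "inv h \<in> D"
    using D_carrier[OF h] subgroup.m_inv_closed[OF D h] by simp_all
  define A where "A x = P (\<rho> h (P x))" for x
  define A' where "A' x = P (\<rho> (inv h) (P x))" for x
  have blin: "bounded_linear A" "bounded_linear A'"
    unfolding A_def[abs_def] A'_def[abs_def]
    by (intro bounded_linear_compose[OF bounded_linear_orth_proj[OF M]]
        bounded_linear_compose[OF bounded_linear_rep] bounded_linear_orth_proj[OF M] inv_closed hG)+
  have AM: "A x \<in> M" "A' x \<in> M" for x
    by (simp_all add: A_def A'_def orth_proj_in[OF M])
  have adj: "cinner (A x) y = cinner x (A' y)" for x y
    by (simp add: A_def A'_def cinner_orth_proj_commute[OF M] rep_adjoint hG)
  have adj': "cinner (A' x) y = cinner x (A y)" for x y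
    by (metis adj cinner_commute)
  have comm: "cinner (\<rho> g (A u)) w = cinner (\<rho> g u) (A' w)"
    "cinner (\<rho> g (A' u)) w = cinner (\<rho> g u) (A w)"
    if "g \<in> carrier G" "u \<in> M" "w \<in> M" for g u w
    using compressions_commute[OF h that] compressions_commute[OF h' that] that(2,3) hG
    by (simp_all add: A_def A'_def orth_proj_id[OF M])
  define S where "S x = A x + A' x" for x
  define T where "T x = scaleC \<i> (A x - A' x)" for x
  have "\<exists>s::real. \<forall>x\<in>M. S x = s *\<^sub>R x"
  proof (rule intertwines_scalar[OF M])
    show "bounded_linear S"
      unfolding S_def[abs_def] by (intro bounded_linear_add blin)
    show "intertwines M S"
      unfolding intertwines_def[OF M]
      by (simp add: S_def AM closed_csubspaceD[OF M] rep_add cinner_add_left cinner_add_right comm)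
    show "inner (S x) y = inner x (S y)" for x y
      by (simp add: S_def inner_eq_Re_cinner cinner_add_left cinner_add_right adj adj')
  qed
  then obtain s :: real where s: "\<And>x. x \<in> M \<Longrightarrow> S x = s *\<^sub>R x" by blast
  have "\<exists>t::real. \<forall>x\<in>M. T x = t *\<^sub>R x"
  proof (rule intertwines_scalar[OF M])
    show "bounded_linear T"
      unfolding T_def[abs_def]
      by (intro bounded_linear_compose[OF scaleC.bounded_linear_right] bounded_linear_sub blin)
    show "intertwines M T"
      unfolding intertwines_def[OF M]
      by (simp add: T_def AM closed_csubspaceD[OF M] closed_csubspace_diff[OF M] rep_diff rep_scaleC
          cinner.diff_left cinner.diff_right cinner_scaleC_left cinner_scaleC_right comm
          right_diff_distrib)
    show "inner (T x) y = inner x (T y)" for x y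
      by (simp add: T_def inner_eq_Re_cinner cinner.diff_left cinner.diff_right cinner_scaleC_left
          cinner_scaleC_right adj adj')
  qed
  then obtain t :: real where t: "\<And>x. x \<in> M \<Longrightarrow> T x = t *\<^sub>R x" by blast
  let ?c = "Complex (s / 2) (- t / 2)"
  have "cinner (\<rho> h u) z = ?c * cinner u z" if u: "u \<in> M" and z: "z \<in> M" for u z
  proof -
    have "cinner (\<rho> h u) z = cinner (A u) z"
      by (simp add: A_def orth_proj_id[OF M u] cinner_orth_proj[OF M z])
    moreover have "cinner (A u) z + cinner (A' u) z = s * cinner u z"
      using arg_cong[OF s[OF u], of "\<lambda>x. cinner x z"]
      by (simp add: S_def cinner_add_left cinner.scaleR_left scaleR_conv_of_real)
    moreover have "\<i> * (cinner (A u) z - cinner (A' u) z) = t * cinner u z"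
      using arg_cong[OF t[OF u], of "\<lambda>x. cinner x z"]
      by (simp add: T_def cinner.diff_left cinner_scaleC_left cinner.scaleR_left scaleR_conv_of_real)
    ultimately show ?thesis
      by (simp add: complex_eq_iff algebra_simps)
  qed
  then show ?thesis by blast
qed

end

section \<open>Cyclic representations\<close>

definition closed_cspan :: "'h::chilbert_space set \<Rightarrow> 'h set" where
  "closed_cspan S = \<Inter> {W. closed_csubspace W \<and> S \<subseteq> W}"

lemma closed_csubspace_closed_cspan: "closed_csubspace (closed_cspan S)"
proof -
  have "closed (closed_cspan S)"
    unfolding closed_cspan_def by (rule closed_Inter) (simp add: closed_csubspace_def)
  then show ?thesis
    unfolding closed_csubspace_def by (simp add: closed_cspan_def closed_csubspace_def)
qed

lemma closed_cspan_superset: "x \<in> S \<Longrightarrow> x \<in> closed_cspan S"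
  by (auto simp: closed_cspan_def)

lemma closed_cspan_minimal: "closed_csubspace W \<Longrightarrow> S \<subseteq> W \<Longrightarrow> x \<in> closed_cspan S \<Longrightarrow> x \<in> W"
  by (auto simp: closed_cspan_def)

text \<open>Two families with the same Gram matrix are intertwined by a unitary operator between their closed
  spans. Its graph is the closure of the span of the pairs.\<close>

inductive linked :: "'i set \<Rightarrow> ('i \<Rightarrow> 'h::chilbert_space) \<Rightarrow> ('i \<Rightarrow> 'h) \<Rightarrow> 'h \<Rightarrow> 'h \<Rightarrow> bool"
  for I x y where
  base: "i \<in> I \<Longrightarrow> linked I x y (x i) (y i)"
| zero: "linked I x y 0 0"
| add: "linked I x y p q \<Longrightarrow> linked I x y p' q' \<Longrightarrow> linked I x y (p + p') (q + q')"
| scale: "linked I x y p q \<Longrightarrow> linked I x y (scaleC c p) (scaleC c q)"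

definition lim_linked :: "'i set \<Rightarrow> ('i \<Rightarrow> 'h::chilbert_space) \<Rightarrow> ('i \<Rightarrow> 'h) \<Rightarrow> 'h \<Rightarrow> 'h \<Rightarrow> bool" where
  "lim_linked I x y p q \<longleftrightarrow> (p, q) \<in> closure {(p, q). linked I x y p q}"

lemma linked_sym: "linked I x y p q \<Longrightarrow> linked I y x q p"
  by (induction rule: linked.induct) (simp_all add: linked.intros)

lemma lim_linked_iff:
  "lim_linked I x y p q \<longleftrightarrow>
    (\<exists>a b. (\<forall>n. linked I x y (a n) (b n)) \<and> a \<longlonglongrightarrow> p \<and> b \<longlonglongrightarrow> q)"
proof
  assume "lim_linked I x y p q"
  then obtain f where f: "\<And>n. f n \<in> {(p, q). linked I x y p q}" "f \<longlonglongrightarrow> (p, q)"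
    unfolding lim_linked_def closure_sequential by blast
  have "linked I x y (fst (f n)) (snd (f n))" for n
    using f(1)[of n] by (simp add: case_prod_beta)
  moreover have "(\<lambda>n. fst (f n)) \<longlonglongrightarrow> p" "(\<lambda>n. snd (f n)) \<longlonglongrightarrow> q"
    using tendsto_fst[OF f(2)] tendsto_snd[OF f(2)] by simp_all
  ultimately show "\<exists>a b. (\<forall>n. linked I x y (a n) (b n)) \<and> a \<longlonglongrightarrow> p \<and> b \<longlonglongrightarrow> q"
    by (intro exI[of _ "\<lambda>n. fst (f n)"] exI[of _ "\<lambda>n. snd (f n)"]) simp
next
  assume "\<exists>a b. (\<forall>n. linked I x y (a n) (b n)) \<and> a \<longlonglongrightarrow> p \<and> b \<longlonglongrightarrow> q"
  then obtain a b where ab: "\<And>n. linked I x y (a n) (b n)" "a \<longlonglongrightarrow> p" "b \<longlonglongrightarrow> q" by blast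
  have "(\<lambda>n. (a n, b n)) \<longlonglongrightarrow> (p, q)"
    by (intro tendsto_Pair ab)
  then show "lim_linked I x y p q"
    unfolding lim_linked_def closure_sequential
    using ab(1) by (intro exI[of _ "\<lambda>n. (a n, b n)"]) simp
qed

lemma lim_linked_sym: "lim_linked I x y p q \<Longrightarrow> lim_linked I y x q p"
  unfolding lim_linked_iff by (metis linked_sym)

lemma lim_linked_base: "i \<in> I \<Longrightarrow> lim_linked I x y (x i) (y i)"
  unfolding lim_linked_iff
  by (intro exI[of _ "\<lambda>n. x i"] exI[of _ "\<lambda>n. y i"]) (simp add: linked.base)

lemma lim_linked_zero: "lim_linked I x y 0 0"
  unfolding lim_linked_iff
  by (intro exI[of _ "\<lambda>n. 0"]) (simp add: linked.zero)

lemma lim_linked_add: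
  assumes "lim_linked I x y p q" "lim_linked I x y p' q'"
  shows "lim_linked I x y (p + p') (q + q')"
proof -
  obtain a b a' b' where "\<And>n. linked I x y (a n) (b n)" "a \<longlonglongrightarrow> p" "b \<longlonglongrightarrow> q"
    "\<And>n. linked I x y (a' n) (b' n)" "a' \<longlonglongrightarrow> p'" "b' \<longlonglongrightarrow> q'"
    using assms unfolding lim_linked_iff by auto
  then show ?thesis
    unfolding lim_linked_iff
    by (intro exI[of _ "\<lambda>n. a n + a' n"] exI[of _ "\<lambda>n. b n + b' n"])
      (simp add: linked.add tendsto_add)
qed

lemma lim_linked_scale:
  assumes "lim_linked I x y p q"
  shows "lim_linked I x y (scaleC c p) (scaleC c q)"
proof -
  obtain a b where "\<And>n. linked I x y (a n) (b n)" "a \<longlonglongrightarrow> p" "b \<longlonglongrightarrow> q"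
    using assms unfolding lim_linked_iff by auto
  then show ?thesis
    unfolding lim_linked_iff
    by (intro exI[of _ "\<lambda>n. scaleC c (a n)"] exI[of _ "\<lambda>n. scaleC c (b n)"])
      (simp add: linked.scale scaleC.tendsto)
qed

lemma lim_linked_diff:
  assumes "lim_linked I x y p q" "lim_linked I x y p' q'"
  shows "lim_linked I x y (p - p') (q - q')"
  using lim_linked_add[OF assms(1) lim_linked_scale[OF assms(2), of "-1"]]
  by (simp add: scaleC_minus_one)

context
  fixes I :: "'i set" and x y :: "'i \<Rightarrow> 'h::chilbert_space"
  assumes gram: "\<forall>i\<in>I. \<forall>j\<in>I. cinner (x i) (x j) = cinner (y i) (y j)"
begin

lemma linked_cinner:
  assumes "linked I x y p q" "linked I x y p' q'"
  shows "cinner p p' = cinner q q'"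
proof -
  have *: "cinner (x i) p' = cinner (y i) q'" if "i \<in> I" for i
    using assms(2)
    by induction (simp_all add: gram that cinner_add_right cinner_scaleC_right cinner.zero_right)
  show ?thesis
    using assms(1)
    by induction (simp_all add: * cinner_add_left cinner_scaleC_left cinner.zero_left)
qed

lemma lim_linked_cinner:
  assumes "lim_linked I x y p q" "lim_linked I x y p' q'"
  shows "cinner p p' = cinner q q'"
proof -
  obtain a b a' b' where "\<And>n. linked I x y (a n) (b n)" "a \<longlonglongrightarrow> p" "b \<longlonglongrightarrow> q"
    "\<And>n. linked I x y (a' n) (b' n)" "a' \<longlonglongrightarrow> p'" "b' \<longlonglongrightarrow> q'"
    using assms unfolding lim_linked_iff by auto
  note ab = this
  have "(\<lambda>n. cinner (a n) (a' n)) \<longlonglongrightarrow> cinner p p'"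
    by (intro cinner.tendsto ab)
  moreover have "(\<lambda>n. cinner (b n) (b' n)) \<longlonglongrightarrow> cinner q q'"
    by (intro cinner.tendsto ab)
  moreover have "cinner (a n) (a' n) = cinner (b n) (b' n)" for n
    by (intro linked_cinner ab)
  ultimately show ?thesis
    using LIMSEQ_unique by simp
qed

lemma lim_linked_norm:
  assumes "lim_linked I x y p q"
  shows "norm p = norm q"
proof -
  have "complex_of_real ((norm p)\<^sup>2) = of_real ((norm q)\<^sup>2)"
    using lim_linked_cinner[OF assms assms] by (simp add: cinner_self)
  then have "(norm p)\<^sup>2 = (norm q)\<^sup>2"
    using of_real_eq_iff by blast
  then show ?thesis by simp
qed

lemma lim_linked_unique: "lim_linked I x y p q \<Longrightarrow> lim_linked I x y p q' \<Longrightarrow> q = q'"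
  using lim_linked_norm[OF lim_linked_diff[of I x y p q p q']] by simp

text \<open>The domain of the closed graph is closed because the graph is isometric.\<close>

lemma lim_linked_domain: "{p. \<exists>q. lim_linked I x y p q} = closed_cspan (x ` I)" (is "?D = _")
proof
  have "closed ?D"
    unfolding closed_sequential_limits
  proof (intro allI impI)
    fix f p assume f: "(\<forall>n. f n \<in> ?D) \<and> f \<longlonglongrightarrow> p"
    then obtain h where h: "\<And>n. lim_linked I x y (f n) (h n)" by simp metis
    have "dist (h m) (h n) = dist (f m) (f n)" for m n
      using lim_linked_norm[OF lim_linked_diff[OF h h]] by (simp add: dist_norm)
    moreover have "Cauchy f"
      using f LIMSEQ_imp_Cauchy by blast
    ultimately have "Cauchy h"
      unfolding Cauchy_def by simp
    then obtain q where "h \<longlonglongrightarrow> q"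
      using Cauchy_convergent_iff convergent_def by blast
    then have "(\<lambda>n. (f n, h n)) \<longlonglongrightarrow> (p, q)"
      using f by (intro tendsto_Pair) simp_all
    then have "lim_linked I x y p q"
      using closed_sequentially[OF closed_closure, of "\<lambda>n. (f n, h n)"] h
      unfolding lim_linked_def by simp
    then show "p \<in> ?D" by blast
  qed
  moreover have "0 \<in> ?D"
    using lim_linked_zero by blast
  moreover have "p + p' \<in> ?D" if "p \<in> ?D" "p' \<in> ?D" for p p'
    using that lim_linked_add by blast
  moreover have "scaleC c p \<in> ?D" if "p \<in> ?D" for p c
    using that lim_linked_scale by blast
  ultimately have D: "closed_csubspace ?D"
    unfolding closed_csubspace_def by simp
  have "x ` I \<subseteq> ?D"
    by (auto intro: lim_linked_base)
  then show "closed_cspan (x ` I) \<subseteq> ?D"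
    by (intro subsetI) (rule closed_cspan_minimal[OF D])
  note S = closed_csubspace_closed_cspan[of "x ` I"]
  have *: "p \<in> closed_cspan (x ` I)" if "linked I x y p q" for p q
    using that by induction (simp_all add: closed_cspan_superset closed_csubspaceD[OF S])
  show "?D \<subseteq> closed_cspan (x ` I)"
  proof
    fix p assume "p \<in> ?D"
    then obtain a b q where "\<And>n. linked I x y (a n) (b n)" "a \<longlonglongrightarrow> p"
      unfolding lim_linked_iff by auto
    then show "p \<in> closed_cspan (x ` I)"
      using closed_sequentially[OF closed_csubspaceD(1)[OF S]] * by blast
  qed
qed

end

lemma ex_unitary_between_closed_cspan:
  fixes x y :: "'i \<Rightarrow> 'h::chilbert_space"
  assumes gram: "\<forall>i\<in>I. \<forall>j\<in>I. cinner (x i) (x j) = cinner (y i) (y j)"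
  shows "\<exists>T. unitary_between (closed_cspan (x ` I)) (closed_cspan (y ` I)) T \<and> (\<forall>i\<in>I. T (x i) = y i)"
proof -
  let ?V = "closed_cspan (x ` I)" and ?W = "closed_cspan (y ` I)"
  have gram': "\<forall>i\<in>I. \<forall>j\<in>I. cinner (y i) (y j) = cinner (x i) (x j)"
    using gram by simp
  define T where "T p = (SOME q. lim_linked I x y p q)" for p
  have T: "lim_linked I x y p (T p)" if "p \<in> ?V" for p
    unfolding T_def by (rule someI_ex) (use that lim_linked_domain[OF gram] in auto)
  have domain: "p \<in> ?V" if "lim_linked I x y p q" for p q
    using that lim_linked_domain[OF gram] by auto
  have T_eq: "T p = q" if "lim_linked I x y p q" for p q
    by (rule lim_linked_unique[OF gram T[OF domain[OF that]] that])
  have "T ` ?V = ?W"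
  proof
    show "T ` ?V \<subseteq> ?W"
      using lim_linked_sym[OF T] lim_linked_domain[OF gram'] by auto
    show "?W \<subseteq> T ` ?V"
    proof
      fix q assume "q \<in> ?W"
      then obtain p where "lim_linked I y x q p"
        using lim_linked_domain[OF gram'] by auto
      then have "lim_linked I x y p q"
        by (rule lim_linked_sym)
      then show "q \<in> T ` ?V"
        using T_eq domain by (metis imageI)
    qed
  qed
  moreover have "inj_on T ?V"
  proof (rule inj_onI)
    fix p p' assume p: "p \<in> ?V" "p' \<in> ?V" "T p = T p'"
    have "lim_linked I y x (T p) p" "lim_linked I y x (T p) p'"
      using T[OF p(1)] T[OF p(2)] p(3) lim_linked_sym by simp_all
    then show "p = p'"
      by (rule lim_linked_unique[OF gram'])
  qed
  ultimately have "bij_betw T ?V ?W"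
    by (simp add: bij_betw_def)
  then have "unitary_between ?V ?W T"
    unfolding unitary_between_def
    by (auto intro!: T_eq[OF lim_linked_add[OF T T]] T_eq[OF lim_linked_scale[OF T]]
        lim_linked_cinner[OF gram, symmetric] T)
  then show ?thesis
    using T_eq[OF lim_linked_base[of _ I x y]] by (intro exI[of _ T]) simp
qed

lemma unitary_between_norm:
  assumes "unitary_between V W T" "x \<in> V"
  shows "norm (T x) = norm x"
proof -
  have "cinner (T x) (T x) = cinner x x"
    using assms by (simp add: unitary_between_def)
  then have "(norm (T x))\<^sup>2 = (norm x)\<^sup>2"
    by (simp add: cinner_self flip: of_real_power)
  then show ?thesis by simp
qed

lemma unitary_between_diff:
  assumes "unitary_between V W T" "closed_csubspace V" "x \<in> V" "y \<in> V"
  shows "T (x - y) = T x - T y"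
proof -
  have "T (x + scaleC (-1) y) = T x + scaleC (-1) (T y)"
    using assms by (simp add: unitary_between_def closed_csubspaceD)
  then show ?thesis by (simp add: scaleC_minus_one)
qed

lemma unitary_between_tendsto:
  assumes "unitary_between V W T" "closed_csubspace V" "\<And>n. f n \<in> V" "f \<longlonglongrightarrow> x"
  shows "(\<lambda>n. T (f n)) \<longlonglongrightarrow> T x"
proof -
  have x: "x \<in> V"
    using closed_sequentially[OF closed_csubspaceD(1)[OF assms(2)] assms(3,4)] .
  have "norm (T (f n) - T x) = norm (f n - x)" for n
    using unitary_between_norm[OF assms(1) closed_csubspace_diff[OF assms(2) assms(3) x]]
      unitary_between_diff[OF assms(1,2) assms(3) x] by metis
  then show ?thesis
    using assms(4) by (simp add: tendsto_iff dist_norm)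
qed

text \<open>The matrix element of the cyclic vector determines the Gram matrix of its orbit.\<close>

lemma equivalent_cyclic_reps:
  fixes G' (structure)
  assumes G: "group G'"
    and V: "unitary_rep G' V \<pi>" "V = closed_cspan ((\<lambda>g. \<pi> g v) ` carrier G')" "v \<in> V"
    and W: "unitary_rep G' W \<pi>'" "W = closed_cspan ((\<lambda>g. \<pi>' g w) ` carrier G')" "w \<in> W"
    and eq: "\<And>g. g \<in> carrier G' \<Longrightarrow> cinner (\<pi> g v) v = cinner (\<pi>' g w) w"
  shows "equivalent_reps G' V \<pi> W \<pi>'"
proof -
  interpret group G' by fact
  have gram: "cinner (\<sigma> g u) (\<sigma> h u) = cinner (\<sigma> (inv h \<otimes> g) u) u"
    if "unitary_rep G' U \<sigma>" "u \<in> U" "g \<in> carrier G'" "h \<in> carrier G'" for \<sigma> u U g h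
  proof -
    let ?k = "inv h \<otimes> g"
    have k: "?k \<in> carrier G'" "h \<otimes> ?k = g"
      using that by (simp_all add: m_assoc[symmetric])
    have uh: "unitary_between U U (\<sigma> h)" "unitary_between U U (\<sigma> ?k)"
      using that k unfolding unitary_rep_def by blast+
    have "\<sigma> g u = \<sigma> h (\<sigma> ?k u)"
      using that k unfolding unitary_rep_def by metis
    moreover have "\<sigma> ?k u \<in> U"
      using uh(2) that(2) by (auto simp: unitary_between_def bij_betw_def)
    ultimately show ?thesis
      using uh(1) that(2) by (simp add: unitary_between_def)
  qed
  have "\<forall>g\<in>carrier G'. \<forall>h\<in>carrier G'. cinner (\<pi> g v) (\<pi> h v) = cinner (\<pi>' g w) (\<pi>' h w)"
    using gram[OF V(1,3)] gram[OF W(1,3)] eq by simp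
  then obtain T where T: "unitary_between V W T" and Tg: "\<And>g. g \<in> carrier G' \<Longrightarrow> T (\<pi> g v) = \<pi>' g w"
    using ex_unitary_between_closed_cspan[of "carrier G'" "\<lambda>g. \<pi> g v" "\<lambda>g. \<pi>' g w"]
    unfolding V(2)[symmetric] W(2)[symmetric] by blast
  have "T (\<pi> g x) = \<pi>' g (T x)" if g: "g \<in> carrier G'" and x: "x \<in> V" for g x
  proof -
    have cV: "closed_csubspace V"
      using V(1) by (simp add: unitary_rep_def)
    have ug: "unitary_between V V (\<pi> g)" "unitary_between W W (\<pi>' g)"
      using V(1) W(1) g by (simp_all add: unitary_rep_def)
    have TW: "T x \<in> W" and gV: "\<pi> g x \<in> V" if "x \<in> V" for x
      using T ug that by (auto simp: unitary_between_def bij_betw_def)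
    have cW: "closed_csubspace W"
      using W(1) by (simp add: unitary_rep_def)
    let ?E = "{x \<in> V. T (\<pi> g x) = \<pi>' g (T x)}"
    have "closed ?E"
      unfolding closed_sequential_limits
    proof (intro allI impI)
      fix f z assume f: "(\<forall>n. f n \<in> ?E) \<and> f \<longlonglongrightarrow> z"
      then have fV: "\<And>n. f n \<in> V" and fe: "\<And>n. T (\<pi> g (f n)) = \<pi>' g (T (f n))" and lim: "f \<longlonglongrightarrow> z"
        by simp_all
      have "(\<lambda>n. T (\<pi> g (f n))) \<longlonglongrightarrow> T (\<pi> g z)"
        by (intro unitary_between_tendsto[OF T cV] unitary_between_tendsto[OF ug(1) cV] gV fV lim)
      moreover have "(\<lambda>n. \<pi>' g (T (f n))) \<longlonglongrightarrow> \<pi>' g (T z)"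
        by (intro unitary_between_tendsto[OF ug(2) cW] unitary_between_tendsto[OF T cV] TW fV lim)
      ultimately have "T (\<pi> g z) = \<pi>' g (T z)"
        using LIMSEQ_unique fe by simp
      moreover have "z \<in> V"
        using closed_sequentially[OF closed_csubspaceD(1)[OF cV] fV lim] .
      ultimately show "z \<in> ?E" by simp
    qed
    moreover have "0 \<in> ?E"
      using unitary_between_norm[OF T, of 0] unitary_between_norm[OF ug(1), of 0]
        unitary_between_norm[OF ug(2), of 0] closed_csubspaceD(2)[OF cV] closed_csubspaceD(2)[OF cW]
      by simp
    moreover have "x + y \<in> ?E" if "x \<in> ?E" "y \<in> ?E" for x y
      using that T ug TW gV closed_csubspaceD(3)[OF cV] by (simp add: unitary_between_def)
    moreover have "scaleC c x \<in> ?E" if "x \<in> ?E" for c x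
      using that T ug TW gV closed_csubspaceD(4)[OF cV] by (simp add: unitary_between_def)
    ultimately have "closed_csubspace ?E"
      unfolding closed_csubspace_def by simp
    moreover have "(\<lambda>g. \<pi> g v) ` carrier G' \<subseteq> ?E"
    proof safe
      fix h assume h: "h \<in> carrier G'"
      show "\<pi> h v \<in> V"
        unfolding V(2) using h by (intro closed_cspan_superset) simp
      have "\<pi> g (\<pi> h v) = \<pi> (g \<otimes> h) v" "\<pi>' g (\<pi>' h w) = \<pi>' (g \<otimes> h) w"
        using V(1,3) W(1,3) g h by (simp_all add: unitary_rep_def)
      then show "T (\<pi> g (\<pi> h v)) = \<pi>' g (T (\<pi> h v))"
        using Tg g h by simp
    qed
    ultimately have "x \<in> ?E"
      by (rule closed_cspan_minimal) (simp add: x flip: V(2))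
    then show ?thesis by simp
  qed
  then show ?thesis
    using T by (auto simp: equivalent_reps_def)
qed

section \<open>Spherical representations of subgroups\<close>

context unitary_group_rep
begin

lemma invariant_orbit_span:
  assumes "subgroup D G" "g \<in> D" "x \<in> closed_cspan ((\<lambda>h. \<rho> h v) ` D)"
  shows "\<rho> g x \<in> closed_cspan ((\<lambda>h. \<rho> h v) ` D)" (is "_ \<in> ?V")
proof -
  have g: "g \<in> carrier G"
    using subgroup.mem_carrier[OF assms(1,2)] .
  note V = closed_csubspace_closed_cspan[of "(\<lambda>h. \<rho> h v) ` D"]
  have "closed (\<rho> g -` ?V)"
    by (intro continuous_closed_vimage closed_csubspaceD(1)[OF V]
        linear_continuous_at[OF bounded_linear_rep[OF g]])
  then have "closed_csubspace (\<rho> g -` ?V)"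
    using closed_csubspaceD[OF V] linear_0[OF bounded_linear.linear[OF bounded_linear_rep[OF g]]]
    by (simp add: closed_csubspace_def rep_add[OF g] rep_scaleC[OF g])
  moreover have "(\<lambda>h. \<rho> h v) ` D \<subseteq> \<rho> g -` ?V"
  proof
    fix y assume "y \<in> (\<lambda>h. \<rho> h v) ` D"
    then obtain h where h: "h \<in> D" "y = \<rho> h v" by blast
    have "\<rho> g y = \<rho> (g \<otimes> h) v"
      using rep_mult[OF g subgroup.mem_carrier[OF assms(1) h(1)]] h(2) by simp
    then show "y \<in> \<rho> g -` ?V"
      using subgroup.m_closed[OF assms(1,2) h(1)] by (simp add: closed_cspan_superset)
  qed
  ultimately show ?thesis
    using closed_cspan_minimal[OF _ _ assms(3), of "\<rho> g -` ?V"] by simp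
qed

lemma unitary_subrep:
  assumes D: "subgroup D G" and V: "closed_csubspace V"
    and inv: "\<And>g x. g \<in> D \<Longrightarrow> x \<in> V \<Longrightarrow> \<rho> g x \<in> V"
  shows "unitary_rep (G\<lparr>carrier := D\<rparr>) V \<rho>"
proof -
  have "bij_betw (\<rho> g) V V" if g: "g \<in> D" for g
  proof -
    have gG: "g \<in> carrier G"
      using subgroup.mem_carrier[OF D g] .
    have "V \<subseteq> \<rho> g ` V"
    proof
      fix x assume "x \<in> V"
      then have "\<rho> (inv g) x \<in> V"
        using inv subgroup.m_inv_closed[OF D g] by simp
      then show "x \<in> \<rho> g ` V"
        using rep_inv(2)[OF gG, of x] by (metis imageI)
    qed
    then have "\<rho> g ` V = V"
      using inv[OF g] by blast
    then show ?thesis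
      using inj_rep[OF gG] by (simp add: bij_betw_def inj_on_def)
  qed
  then show ?thesis
    using V subgroup.mem_carrier[OF D]
    by (simp add: unitary_rep_def unitary_between_def rep_add rep_scaleC rep_cinner rep_mult)
qed

lemma spherical_rep_cyclic:
  assumes D: "subgroup D G" and V: "spherical_rep (G\<lparr>carrier := D\<rparr>) K V \<rho>"
  shows "\<exists>v. v \<in> V \<and> v \<in> fixed_vectors K \<and> norm v = 1 \<and> V = closed_cspan ((\<lambda>g. \<rho> g v) ` D)"
proof -
  obtain w where w: "w \<in> V" "w \<noteq> 0" "{u \<in> V. \<forall>l\<in>K. \<rho> l u = u} = range (\<lambda>c. scaleC c w)"
    using V unfolding spherical_rep_def by blast
  define v where "v = scaleC (of_real (1 / norm w)) w"
  have "v \<in> range (\<lambda>c. scaleC c w)"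
    by (simp add: v_def)
  then have v: "v \<in> V" "v \<in> fixed_vectors K"
    unfolding w(3)[symmetric] by (simp_all add: fixed_vectors_def)
  have "norm v = 1"
    using w(2) by (simp add: v_def norm_scaleC norm_divide)
  have irr: "irreducible_rep (G\<lparr>carrier := D\<rparr>) V \<rho>"
    using V by (simp add: spherical_rep_def)
  let ?W = "closed_cspan ((\<lambda>g. \<rho> g v) ` D)"
  have inv: "\<rho> g x \<in> V" if "g \<in> D" "x \<in> V" for g x
  proof -
    have "\<rho> g ` V = V"
      using irr that(1)
      by (simp add: irreducible_rep_def unitary_rep_def unitary_between_def bij_betw_def)
    then show ?thesis
      using that(2) by blast
  qed
  have cV: "closed_csubspace V"
    using irr by (simp add: irreducible_rep_def unitary_rep_def)
  have "?W \<subseteq> V"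
    by (intro subsetI, rule closed_cspan_minimal[OF cV, of "(\<lambda>g. \<rho> g v) ` D"]) (auto intro: inv v(1))
  moreover have "\<forall>g\<in>D. \<forall>x\<in>?W. \<rho> g x \<in> ?W"
    using invariant_orbit_span[OF D] by blast
  ultimately have disj: "?W = {0} \<or> ?W = V"
    using irr closed_csubspace_closed_cspan[of "(\<lambda>g. \<rho> g v) ` D"] by (simp add: irreducible_rep_def)
  have "v \<in> ?W"
    using subgroup.one_closed[OF D] rep_one[of v] by (intro closed_cspan_superset) (metis imageI)
  then have "?W \<noteq> {0}"
    using \<open>norm v = 1\<close> by (metis norm_zero singletonD zero_neq_one)
  with disj have "V = ?W"
    by argo
  then show ?thesis
    using v \<open>norm v = 1\<close> by (intro exI[of _ v] conjI)
qed

end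

context asymptotically_commuting
begin

text \<open>By \<open>compression_scalar\<close>, a fixed vector orthogonal to \<open>v\<close> is orthogonal to the whole orbit of \<open>v\<close>; hence
  the fixed vectors of the span are the multiples of \<open>v\<close>. The projection of \<open>v\<close> to an invariant subspace
  \<open>W\<close> is such a multiple, which leaves only \<open>W = {0}\<close> and the whole span.\<close>

lemma spherical_orbit_span:
  assumes v: "v \<in> M" "v \<noteq> 0"
  shows "spherical_rep (G\<lparr>carrier := D\<rparr>) K (closed_cspan ((\<lambda>g. \<rho> g v) ` D)) \<rho>"
    (is "spherical_rep _ _ ?V _")
proof -
  note V = closed_csubspace_closed_cspan[of "(\<lambda>g. \<rho> g v) ` D"]
  have inv: "\<rho> g x \<in> ?V" if "g \<in> D" "x \<in> ?V" for g x
    using invariant_orbit_span[OF D that] .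
  have vV: "v \<in> ?V"
    using subgroup.one_closed[OF D] rep_one[of v] by (intro closed_cspan_superset) (metis imageI)
  have multiple: "u \<in> range (\<lambda>c. scaleC c v)" if u: "u \<in> ?V" "u \<in> M" for u
  proof -
    let ?c = "cinner u v / cinner v v"
    define z where "z = u - scaleC ?c v"
    have z: "z \<in> M"
      unfolding z_def by (intro closed_csubspace_diff[OF M] closed_csubspaceD(4)[OF M] u v)
    have "cinner z v = 0"
      using v(2) by (simp add: z_def cinner.diff_left cinner_scaleC_left cinner_self)
    then have vz: "cinner v z = 0"
      by (metis cinner_commute complex_cnj_zero)
    have "cinner z (\<rho> h v) = 0" if h: "h \<in> D" for h
    proof -
      obtain c where "cinner (\<rho> h v) z = c * cinner v z"
        using compression_scalar[OF h] v(1) z by auto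
      then show ?thesis
        using vz cinner_commute[of z "\<rho> h v"] by simp
    qed
    then have "x \<in> {x. \<forall>y\<in>{z}. cinner y x = 0}" if "x \<in> ?V" for x
      by (intro closed_cspan_minimal[OF closed_csubspace_orthogonal _ that]) auto
    then have "cinner z u = 0" "cinner z v = 0"
      using u(1) vV by auto
    then have "cinner z z = 0"
      by (subst (2) z_def) (simp add: cinner.diff_right cinner_scaleC_right)
    then have "u = scaleC ?c v"
      by (simp add: cinner_self z_def)
    then show ?thesis by blast
  qed
  have "W = {0} \<or> W = ?V"
    if W: "W \<subseteq> ?V" "closed_csubspace W" "\<forall>g\<in>D. \<forall>w\<in>W. \<rho> g w \<in> W" for W
  proof -
    let ?p = "orth_proj W v"
    have "?p \<in> M"
      unfolding fixed_vectors_def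
    proof safe
      fix k assume k: "k \<in> K"
      then have kD: "k \<in> D" "inv k \<in> D"
        using K_le_D inv_K[OF k] by auto
      have "?p = \<rho> k ?p"
      proof (rule orth_proj_unique[OF W(2)])
        show "\<rho> k ?p \<in> W"
          using W(3) kD orth_proj_in[OF W(2)] by blast
        fix m assume m: "m \<in> W"
        have "cinner (\<rho> k ?p) m = cinner ?p (\<rho> (inv k) m)"
          by (rule rep_adjoint[OF K_carrier[OF k]])
        also have "\<dots> = cinner v (\<rho> (inv k) m)"
          using W(3) kD m by (intro cinner_orth_proj[OF W(2)]) blast
        also have "\<dots> = cinner (\<rho> k v) m"
          by (rule rep_adjoint[OF K_carrier[OF k], symmetric])
        finally show "cinner v m = cinner (\<rho> k ?p) m"
          using rep_fixed[OF v(1) k] by simp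
      qed
      then show "\<rho> k ?p = ?p" by simp
    qed
    then obtain c where c: "?p = scaleC c v"
      using multiple orth_proj_in[OF W(2)] W(1) by blast
    show ?thesis
    proof (cases "c = 0")
      case True
      then have orth: "cinner v x = 0" if "x \<in> W" for x
        using cinner_orth_proj[OF W(2) that, of v] c
        by (simp add: cinner.zero_left scaleC.zero_left)
      have "cinner x (\<rho> h v) = 0" if "x \<in> W" "h \<in> D" for x h
      proof -
        have "cinner x (\<rho> h v) = cinner (\<rho> (inv h) x) v"
          using rep_adjoint[OF inv_closed[OF D_carrier[OF that(2)]], of x v] D_carrier[OF that(2)]
          by simp
        also have "\<dots> = cnj (cinner v (\<rho> (inv h) x))"
          by (rule cinner_commute)
        also have "cinner v (\<rho> (inv h) x) = 0"
          using orth W(3) that(1) subgroup.m_inv_closed[OF D that(2)] by simp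
        finally show ?thesis by simp
      qed
      then have sub: "(\<lambda>g. \<rho> g v) ` D \<subseteq> {y. \<forall>x\<in>W. cinner x y = 0}"
        by auto
      have "cinner x x = 0" if "x \<in> W" for x
        using closed_cspan_minimal[OF closed_csubspace_orthogonal sub, of x] W(1) that by auto
      then have "W \<subseteq> {0}"
        by (auto simp: cinner_self)
      then show ?thesis
        using closed_csubspaceD(2)[OF W(2)] by (intro disjI1) auto
    next
      case False
      then have "v = scaleC (1 / c) ?p"
        by (simp add: c scaleC_scaleC)
      then have "v \<in> W"
        using closed_csubspaceD(4)[OF W(2) orth_proj_in[OF W(2)]] by metis
      then have "(\<lambda>g. \<rho> g v) ` D \<subseteq> W"
        using W(3) by auto
      then have "?V \<subseteq> W"
        by (intro subsetI) (rule closed_cspan_minimal[OF W(2)])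
      then show ?thesis
        using W(1) by (intro disjI2 equalityI)
    qed
  qed
  then have "irreducible_rep (G\<lparr>carrier := D\<rparr>) ?V \<rho>"
    using unitary_subrep[OF D V inv] vV v(2) by (auto simp: irreducible_rep_def)
  moreover have "{w \<in> ?V. \<forall>l\<in>K. \<rho> l w = w} = range (\<lambda>c. scaleC c v)"
  proof
    show "{w \<in> ?V. \<forall>l\<in>K. \<rho> l w = w} \<subseteq> range (\<lambda>c. scaleC c v)"
      using multiple by (auto simp: fixed_vectors_def)
    show "range (\<lambda>c. scaleC c v) \<subseteq> {w \<in> ?V. \<forall>l\<in>K. \<rho> l w = w}"
      using closed_csubspaceD(4)[OF V vV] closed_csubspaceD(4)[OF M v(1)]
      by (auto simp: fixed_vectors_def)
  qed
  ultimately show ?thesis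
    unfolding spherical_rep_def using vV v(2) by blast
qed

end

section \<open>Quaternions\<close>

lemmas quat_defs = quat_eq_iff zero_quat_def one_quat_def plus_quat_def minus_quat_def
  uminus_quat_def times_quat_def qcnj_def

lemma qcnj_mult: "qcnj (x * y) = qcnj y * qcnj x"
  and qcnj_add: "qcnj (x + y) = qcnj x + qcnj y"
  and qcnj_minus: "qcnj (- x) = - qcnj x"
  and qcnj_0 [simp]: "qcnj 0 = 0"
  and qcnj_1 [simp]: "qcnj 1 = 1"
  and qcnj_qcnj [simp]: "qcnj (qcnj x) = x"
  by (simp_all add: quat_defs algebra_simps)

lemma qcnj_eq_0_iff [simp]: "qcnj x = 0 \<longleftrightarrow> x = 0"
  by (metis qcnj_0 qcnj_qcnj)

lemma qcnj_sum: "qcnj (sum f A) = (\<Sum>x\<in>A. qcnj (f x))"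
  by (induction A rule: infinite_finite_induct) (simp_all add: qcnj_add)

lemma norm_quat_mult: "norm (x * y) = norm x * norm y" for x y :: quat
  unfolding norm_quat_def inner_quat_def real_sqrt_mult[symmetric]
  by (rule arg_cong[of _ _ sqrt]) (simp add: times_quat_def algebra_simps)

lemma norm_qcnj [simp]: "norm (qcnj x) = norm x"
  by (simp add: norm_quat_def inner_quat_def qcnj_def)

lemma qcnj_times_self: "qcnj x * x = ((norm x)\<^sup>2) *\<^sub>R 1"
proof -
  have "(norm x)\<^sup>2 = qre x * qre x + qi x * qi x + qj x * qj x + qk x * qk x"
    by (simp add: power2_norm_eq_inner inner_quat_def)
  then show ?thesis
    by (simp add: scaleR_quat_def quat_defs)
qed

lemma scalars_closed [simp]:
  "0 \<in> scalars F" "1 \<in> scalars F" "x \<in> scalars F \<Longrightarrow> y \<in> scalars F \<Longrightarrow> x + y \<in> scalars F"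
  "x \<in> scalars F \<Longrightarrow> y \<in> scalars F \<Longrightarrow> x * y \<in> scalars F"
  "x \<in> scalars F \<Longrightarrow> - x \<in> scalars F" "x \<in> scalars F \<Longrightarrow> qcnj x \<in> scalars F"
  by (cases F; simp add: quat_defs)+

lemma scalars_sum: "(\<And>x. x \<in> A \<Longrightarrow> f x \<in> scalars F) \<Longrightarrow> sum f A \<in> scalars F"
  by (induction A rule: infinite_finite_induct) simp_all

lemma scalars_CC_commute: "x \<in> scalars CC \<Longrightarrow> y \<in> scalars CC \<Longrightarrow> x * y = y * x"
  by (simp add: quat_defs algebra_simps)

lemma scalars_RR_qcnj: "x \<in> scalars RR \<Longrightarrow> qcnj x = x"
  by (simp add: quat_defs)

lemma scalars_RR_le: "x \<in> scalars RR \<Longrightarrow> x \<in> scalars F"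
  by (cases F) simp_all

lemma proj_add: "proj B (x + y) = proj B x + proj B y"
  and proj_0 [simp]: "proj B 0 = 0"
  and proj_in: "proj B x \<in> scalars B"
  and qcnj_proj: "qcnj (proj B x) = proj B (qcnj x)"
  by (cases B; simp add: quat_defs)+

lemma proj_sum: "proj B (sum f A) = (\<Sum>x\<in>A. proj B (f x))"
  by (induction A rule: infinite_finite_induct) (simp_all add: proj_add)

lemma proj_mult_right: "b \<in> scalars B \<Longrightarrow> proj B (x * b) = proj B x * b"
  by (cases B) (simp_all add: quat_defs)

text \<open>With right \<open>B\<close>-linearity of the projection and orthonormality, this is all that the restriction and the
  extension of scalars need to know about the three algebras.\<close>

lemma scalar_basis_expand:
  assumes "x \<in> scalars A"
  shows "(\<Sum>s<length (scalar_basis A B).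
    scalar_basis A B ! s * proj B (qcnj (scalar_basis A B ! s) * x)) = x"
  using assms by (cases A; cases B) (simp_all add: quat_defs numeral_eq_Suc)

lemma scalar_basis_in:
  "r < length (scalar_basis A B) \<Longrightarrow> scalar_basis A B ! r \<in> scalars A"
  by (cases A; cases B) (auto simp: less_Suc_eq numeral_eq_Suc quat_defs)

lemma scalar_basis_orthonormal:
  assumes "r < length (scalar_basis A B)" "s < length (scalar_basis A B)"
  shows "proj B (qcnj (scalar_basis A B ! r) * scalar_basis A B ! s) = (if r = s then 1 else 0)"
  using assms by (cases A; cases B) (auto simp: less_Suc_eq numeral_eq_Suc quat_defs)

section \<open>Locally finite matrices\<close>

definition locally_finite :: "'a qmat \<Rightarrow> bool" where
  "locally_finite g \<longleftrightarrow> (\<forall>a. finite {b. g a b \<noteq> 0}) \<and> (\<forall>b. finite {a. g a b \<noteq> 0})"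

definition supported_on :: "'a set \<Rightarrow> 'a qmat \<Rightarrow> bool" where
  "supported_on S g \<longleftrightarrow> (\<forall>a b. a \<notin> S \<or> b \<notin> S \<longrightarrow> g a b = mat_one a b)"

lemma supported_onD:
  "supported_on S g \<Longrightarrow> a \<notin> S \<Longrightarrow> g a b = mat_one a b"
  "supported_on S g \<Longrightarrow> b \<notin> S \<Longrightarrow> g a b = mat_one a b"
  by (simp_all add: supported_on_def)

lemma supported_on_mono: "supported_on S g \<Longrightarrow> S \<subseteq> T \<Longrightarrow> supported_on T g"
  by (auto simp: supported_on_def)

lemma supported_on_one: "supported_on S mat_one"
  by (simp add: supported_on_def)

lemma locally_finite_supported:
  assumes "finite S" "supported_on S g"
  shows "locally_finite g"
proof -
  have "finite {b. g a b \<noteq> 0}" for a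
    by (rule finite_subset[of _ "insert a S"])
      (use assms in \<open>auto simp: supported_on_def mat_one_def split: if_splits\<close>)
  moreover have "finite {a. g a b \<noteq> 0}" for b
    by (rule finite_subset[of _ "insert b S"])
      (use assms in \<open>auto simp: supported_on_def mat_one_def split: if_splits\<close>)
  ultimately show ?thesis by (simp add: locally_finite_def)
qed

lemma mat_mult_eq_sum:
  assumes "finite T" "\<And>b. b \<notin> T \<Longrightarrow> g a b * h b c = 0"
  shows "mat_mult g h a c = (\<Sum>b\<in>T. g a b * h b c)"
  unfolding mat_mult_def using assms by (intro Sum_any.expand_superset) auto

lemma mat_mult_row:
  assumes "finite T" "\<And>b. b \<notin> T \<Longrightarrow> g a b = 0"
  shows "mat_mult g h a c = (\<Sum>b\<in>T. g a b * h b c)"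
  using assms by (intro mat_mult_eq_sum) simp_all

lemma mat_mult_col:
  assumes "finite T" "\<And>b. b \<notin> T \<Longrightarrow> h b c = 0"
  shows "mat_mult g h a c = (\<Sum>b\<in>T. g a b * h b c)"
  using assms by (intro mat_mult_eq_sum) simp_all

lemma mat_mult_row_one:
  assumes "\<And>b. g a b = mat_one a b"
  shows "mat_mult g h a c = h a c"
  using mat_mult_row[of "{a}" g a h c] assms by (simp add: mat_one_def)

lemma mat_mult_col_one:
  assumes "\<And>b. h b c = mat_one b c"
  shows "mat_mult g h a c = g a c"
  using mat_mult_col[of "{c}" h c g a] assms by (simp add: mat_one_def)

lemma mat_mult_one_left [simp]: "mat_mult mat_one g = g"
  by (intro ext mat_mult_row_one) simp

lemma mat_mult_one_right [simp]: "mat_mult g mat_one = g"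
  by (intro ext mat_mult_col_one) simp

text \<open>The rows of \<open>f\<close> and the columns of \<open>h\<close> are finite, whatever \<open>g\<close> is; this makes the double sum finite.\<close>

lemma mat_mult_assoc:
  assumes f: "locally_finite f" and h: "locally_finite h"
  shows "mat_mult (mat_mult f g) h = mat_mult f (mat_mult g h)"
proof (intro ext)
  fix a d
  let ?B = "{b. f a b \<noteq> 0}" and ?C = "{c. h c d \<noteq> 0}"
  have fin: "finite ?B" "finite ?C"
    using f h by (simp_all add: locally_finite_def)
  have fg: "mat_mult f g a c = (\<Sum>b\<in>?B. f a b * g b c)" for c
    by (rule mat_mult_row[OF fin(1)]) simp
  have gh: "mat_mult g h b d = (\<Sum>c\<in>?C. g b c * h c d)" for b
    by (rule mat_mult_col[OF fin(2)]) simp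
  have "mat_mult (mat_mult f g) h a d = (\<Sum>c\<in>?C. \<Sum>b\<in>?B. f a b * g b c * h c d)"
    by (subst mat_mult_col[OF fin(2)]) (simp_all add: fg sum_distrib_right)
  also have "\<dots> = (\<Sum>b\<in>?B. \<Sum>c\<in>?C. f a b * g b c * h c d)"
    by (rule sum.swap)
  also have "\<dots> = mat_mult f (mat_mult g h) a d"
    by (subst mat_mult_row[OF fin(1)]) (simp_all add: gh sum_distrib_left mult.assoc)
  finally show "mat_mult (mat_mult f g) h a d = mat_mult f (mat_mult g h) a d" .
qed

lemma locally_finite_mult:
  assumes g: "locally_finite g" and h: "locally_finite h"
  shows "locally_finite (mat_mult g h)"
proof -
  have "finite {c. mat_mult g h a c \<noteq> 0}" for a
  proof (rule finite_subset)
    let ?B = "{b. g a b \<noteq> 0}"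
    have fin: "finite ?B"
      using g by (simp add: locally_finite_def)
    show "{c. mat_mult g h a c \<noteq> 0} \<subseteq> (\<Union>b\<in>?B. {c. h b c \<noteq> 0})"
    proof
      fix c assume "c \<in> {c. mat_mult g h a c \<noteq> 0}"
      then have "(\<Sum>b\<in>?B. g a b * h b c) \<noteq> 0"
        using mat_mult_row[OF fin, of g a h c] by simp
      then obtain b where "b \<in> ?B" "g a b * h b c \<noteq> 0"
        by (rule sum.not_neutral_contains_not_neutral)
      then show "c \<in> (\<Union>b\<in>?B. {c. h b c \<noteq> 0})" by auto
    qed
    show "finite (\<Union>b\<in>?B. {c. h b c \<noteq> 0})"
      using fin h by (simp add: locally_finite_def)
  qed
  moreover have "finite {a. mat_mult g h a c \<noteq> 0}" for c
  proof (rule finite_subset)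
    let ?B = "{b. h b c \<noteq> 0}"
    have fin: "finite ?B"
      using h by (simp add: locally_finite_def)
    show "{a. mat_mult g h a c \<noteq> 0} \<subseteq> (\<Union>b\<in>?B. {a. g a b \<noteq> 0})"
    proof
      fix a assume "a \<in> {a. mat_mult g h a c \<noteq> 0}"
      then have "(\<Sum>b\<in>?B. g a b * h b c) \<noteq> 0"
        using mat_mult_col[OF fin, of h c g a] by simp
      then obtain b where "b \<in> ?B" "g a b * h b c \<noteq> 0"
        by (rule sum.not_neutral_contains_not_neutral)
      then show "a \<in> (\<Union>b\<in>?B. {a. g a b \<noteq> 0})" by auto
    qed
    show "finite (\<Union>b\<in>?B. {a. g a b \<noteq> 0})"
      using fin g by (simp add: locally_finite_def)
  qed
  ultimately show ?thesis by (simp add: locally_finite_def)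
qed

lemma locally_finite_adjoint: "locally_finite g \<Longrightarrow> locally_finite (mat_adjoint g)"
  by (simp add: locally_finite_def mat_adjoint_def)

lemma locally_finite_transpose: "locally_finite g \<Longrightarrow> locally_finite (mat_transpose g)"
  by (simp add: locally_finite_def mat_transpose_def)

lemma qcnj_mat_one [simp]: "qcnj (mat_one a b) = mat_one a b"
  by (simp add: mat_one_def)

lemma mat_one_commute: "mat_one a b = mat_one b a"
  by (auto simp: mat_one_def)

lemma mat_one_in [simp]: "mat_one a b \<in> scalars F"
  by (simp add: mat_one_def)

lemma mat_adjoint_one [simp]: "mat_adjoint mat_one = mat_one"
  by (intro ext) (simp add: mat_adjoint_def mat_one_commute)

lemma mat_adjoint_adjoint [simp]: "mat_adjoint (mat_adjoint g) = g"
  by (intro ext) (simp add: mat_adjoint_def)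

lemma mat_adjoint_mult:
  assumes "locally_finite g"
  shows "mat_adjoint (mat_mult g h) = mat_mult (mat_adjoint h) (mat_adjoint g)"
proof (intro ext)
  fix a c
  let ?B = "{b. g c b \<noteq> 0}"
  have fin: "finite ?B"
    using assms by (simp add: locally_finite_def)
  show "mat_adjoint (mat_mult g h) a c = mat_mult (mat_adjoint h) (mat_adjoint g) a c"
    unfolding mat_adjoint_def mat_mult_row[OF fin, of g c h a, simplified]
    by (subst mat_mult_col[OF fin]) (simp_all add: qcnj_sum qcnj_mult)
qed

text \<open>Transposition reverses products only over a commutative algebra.\<close>

lemma mat_transpose_mult:
  assumes "locally_finite g" "\<And>a b. g a b \<in> scalars CC" "\<And>a b. h a b \<in> scalars CC"
  shows "mat_transpose (mat_mult g h) = mat_mult (mat_transpose h) (mat_transpose g)"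
proof (intro ext)
  fix a c
  let ?B = "{b. g c b \<noteq> 0}"
  have fin: "finite ?B"
    using assms(1) by (simp add: locally_finite_def)
  show "mat_transpose (mat_mult g h) a c = mat_mult (mat_transpose h) (mat_transpose g) a c"
    unfolding mat_transpose_def mat_mult_row[OF fin, of g c h a, simplified]
    by (subst mat_mult_col[OF fin])
      (auto intro!: sum.cong scalars_CC_commute assms simp del: scalars.simps)
qed

lemma mat_mult_in_scalars:
  assumes "locally_finite g" "\<And>a b. g a b \<in> scalars F" "\<And>a b. h a b \<in> scalars F"
  shows "mat_mult g h a c \<in> scalars F"
proof -
  have "finite {b. g a b \<noteq> 0}"
    using assms(1) by (simp add: locally_finite_def)
  from mat_mult_row[OF this, of g a h c] show ?thesis
    by (simp add: scalars_sum assms)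
qed

lemma supported_on_mult:
  assumes g: "supported_on S g" and h: "supported_on S h"
  shows "supported_on S (mat_mult g h)"
  unfolding supported_on_def
proof (intro allI impI)
  fix a c assume ac: "a \<notin> S \<or> c \<notin> S"
  show "mat_mult g h a c = mat_one a c"
  proof (cases "a \<in> S")
    case True
    then have c: "c \<notin> S" using ac by simp
    have "mat_mult g h a c = g a c"
      by (rule mat_mult_col_one) (rule supported_onD(2)[OF h c])
    then show ?thesis
      using supported_onD(2)[OF g c] by simp
  next
    case False
    have "mat_mult g h a c = h a c"
      by (rule mat_mult_row_one) (rule supported_onD(1)[OF g False])
    then show ?thesis
      using supported_onD(1)[OF h False] by simp
  qed
qed

lemma mat_mult_commute_disjoint:
  assumes g: "supported_on S g" and h: "supported_on T h" and "S \<inter> T = {}"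
  shows "mat_mult g h = mat_mult h g"
proof -
  have *: "mat_mult g h a c = (if a \<notin> S then h a c else g a c)"
    if g: "supported_on S g" and h: "supported_on T h" and ST: "S \<inter> T = {}" for g h :: "'a qmat" and S T a c
  proof (cases "a \<in> S")
    case False
    have "mat_mult g h a c = h a c"
      by (rule mat_mult_row_one) (rule supported_onD(1)[OF g False])
    then show ?thesis using False by simp
  next
    case True
    show ?thesis
    proof (cases "c \<in> T")
      case False
      have "mat_mult g h a c = g a c"
        by (rule mat_mult_col_one) (rule supported_onD(2)[OF h False])
      then show ?thesis using True by simp
    next
      case c: True
      have "g a b * h b c = 0" for b
      proof (cases "b \<in> S")
        case True
        then have "b \<notin> T" "b \<noteq> c" using ST c by auto
        then show ?thesis
          using supported_onD(1)[OF h, of b c] by (simp add: mat_one_def)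
      next
        case False
        then have "b \<noteq> a" using True by auto
        then show ?thesis
          using supported_onD(2)[OF g False, of a] by (simp add: mat_one_def)
      qed
      then have "mat_mult g h a c = 0"
        using mat_mult_eq_sum[of "{}" g a h c] by simp
      moreover have "c \<notin> S" "a \<noteq> c" using True c ST by auto
      ultimately show ?thesis
        using True supported_onD(2)[OF g, of c a] by (simp add: mat_one_def)
    qed
  qed
  have ST': "T \<inter> S = {}" using assms(3) by auto
  show ?thesis
  proof (intro ext)
    fix a c
    show "mat_mult g h a c = mat_mult h g a c"
      using *[OF g h assms(3), of a c] *[OF h g ST', of a c] assms(3)
        supported_onD(1)[OF g, of a c] supported_onD(1)[OF h, of a c]
      by (cases "a \<in> S"; cases "a \<in> T") auto
  qed
qed

section \<open>Groups of finite matrices\<close>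

lemma finite_mats_iff:
  "g \<in> finite_mats F B \<longleftrightarrow>
    (\<forall>a b. g a b \<in> scalars F) \<and> (\<exists>S\<subseteq>B. finite S \<and> supported_on S g)"
proof (intro iffI conjI)
  assume g: "g \<in> finite_mats F B"
  then show "\<forall>a b. g a b \<in> scalars F"
    by (simp add: finite_mats_def)
  let ?D = "{(a, b). g a b \<noteq> mat_one a b}"
  have "finite (fst ` ?D \<union> snd ` ?D)"
    using g by (simp add: finite_mats_def)
  moreover have "a \<in> B \<and> b \<in> B" if "g a b \<noteq> mat_one a b" for a b
    using g that by (auto simp: finite_mats_def)
  then have "fst ` ?D \<union> snd ` ?D \<subseteq> B"
    by auto
  moreover have "supported_on (fst ` ?D \<union> snd ` ?D) g"
    unfolding supported_on_def by (force simp: image_iff)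
  ultimately show "\<exists>S\<subseteq>B. finite S \<and> supported_on S g" by (intro exI conjI)
next
  assume g: "(\<forall>a b. g a b \<in> scalars F) \<and> (\<exists>S\<subseteq>B. finite S \<and> supported_on S g)"
  then obtain S where S: "S \<subseteq> B" "finite S" "supported_on S g" by auto
  have "finite {(a, b). g a b \<noteq> mat_one a b}"
    by (rule finite_subset[of _ "S \<times> S"]) (use S in \<open>auto simp: supported_on_def\<close>)
  then show "g \<in> finite_mats F B"
    using g S by (auto simp: finite_mats_def supported_on_def)
qed

lemma finite_mats_scalars: "g \<in> finite_mats F B \<Longrightarrow> g a b \<in> scalars F"
  by (simp add: finite_mats_iff)

lemma finite_mats_locally_finite: "g \<in> finite_mats F B \<Longrightarrow> locally_finite g"
  using locally_finite_supported by (auto simp: finite_mats_iff)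

lemma finite_mats_supported: "g \<in> finite_mats F B \<Longrightarrow> supported_on B g"
  by (auto simp: finite_mats_iff intro: supported_on_mono)

lemma one_finite_mats: "mat_one \<in> finite_mats F B"
  by (auto simp: finite_mats_iff supported_on_one)

lemma finite_mats_mult:
  assumes g: "g \<in> finite_mats F B" and h: "h \<in> finite_mats F B"
  shows "mat_mult g h \<in> finite_mats F B"
proof -
  obtain S T where S: "S \<subseteq> B" "finite S" "supported_on S g"
    and T: "T \<subseteq> B" "finite T" "supported_on T h"
    using g h by (auto simp: finite_mats_iff)
  have "supported_on (S \<union> T) (mat_mult g h)"
    by (intro supported_on_mult supported_on_mono[OF S(3)] supported_on_mono[OF T(3)]) auto
  moreover have "S \<union> T \<subseteq> B" "finite (S \<union> T)"
    using S T by auto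
  moreover have "mat_mult g h a c \<in> scalars F" for a c
    by (intro mat_mult_in_scalars finite_mats_locally_finite[OF g] finite_mats_scalars[OF g]
        finite_mats_scalars[OF h])
  ultimately show ?thesis
    unfolding finite_mats_iff by (intro conjI allI exI)
qed

lemma finite_mats_adjoint:
  assumes g: "g \<in> finite_mats F B"
  shows "mat_adjoint g \<in> finite_mats F B"
proof -
  obtain S where S: "S \<subseteq> B" "finite S" "supported_on S g"
    using g by (auto simp: finite_mats_iff)
  have "supported_on S (mat_adjoint g)"
    unfolding supported_on_def mat_adjoint_def
  proof (intro allI impI)
    fix a b assume "a \<notin> S \<or> b \<notin> S"
    then have "g b a = mat_one b a"
      using supported_onD[OF S(3)] by auto
    then show "qcnj (g b a) = mat_one a b"
      by (simp add: mat_one_commute)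
  qed
  moreover have "mat_adjoint g a c \<in> scalars F" for a c
    by (simp add: mat_adjoint_def finite_mats_scalars[OF g] del: scalars.simps)
  ultimately show ?thesis
    unfolding finite_mats_iff using S by (intro conjI allI exI)
qed

lemma invertible_matsD:
  "g \<in> invertible_mats F B \<Longrightarrow> g \<in> finite_mats F B"
  by (simp add: invertible_mats_def)

lemma invertible_mats_mult:
  assumes "g \<in> invertible_mats F B" "h \<in> invertible_mats F B"
  shows "mat_mult g h \<in> invertible_mats F B"
proof -
  obtain g' h' where g': "g \<in> finite_mats F B" "g' \<in> finite_mats F B" "mat_mult g g' = mat_one" "mat_mult g' g = mat_one"
    and h': "h \<in> finite_mats F B" "h' \<in> finite_mats F B" "mat_mult h h' = mat_one" "mat_mult h' h = mat_one"
    using assms by (auto simp: invertible_mats_def)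
  note lf = finite_mats_locally_finite[OF g'(1)] finite_mats_locally_finite[OF g'(2)]
    finite_mats_locally_finite[OF h'(1)] finite_mats_locally_finite[OF h'(2)]
  have "mat_mult (mat_mult g h) (mat_mult h' g') = mat_mult g (mat_mult (mat_mult h h') g')"
    by (simp add: mat_mult_assoc lf locally_finite_mult)
  moreover have "mat_mult (mat_mult h' g') (mat_mult g h) = mat_mult h' (mat_mult (mat_mult g' g) h)"
    by (simp add: mat_mult_assoc lf locally_finite_mult)
  ultimately show ?thesis
    using g' h' finite_mats_mult[OF g'(1) h'(1)] finite_mats_mult[OF h'(2) g'(2)]
    unfolding invertible_mats_def by (intro CollectI conjI bexI[of _ "mat_mult h' g'"]) simp_all
qed

lemma unitary_mats_iff:
  "g \<in> unitary_mats F B \<longleftrightarrow> g \<in> finite_mats F B \<and>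
    mat_mult (mat_adjoint g) g = mat_one \<and> mat_mult g (mat_adjoint g) = mat_one"
proof
  assume "g \<in> unitary_mats F B"
  then obtain h where g: "g \<in> finite_mats F B" and u: "mat_mult (mat_adjoint g) g = mat_one"
    and h: "h \<in> finite_mats F B" "mat_mult g h = mat_one"
    by (auto simp: unitary_mats_def invertible_mats_def)
  note lf = finite_mats_locally_finite[OF g] finite_mats_locally_finite[OF h(1)]
  have "h = mat_mult (mat_mult (mat_adjoint g) g) h"
    using u by simp
  also have "\<dots> = mat_adjoint g"
    by (simp add: mat_mult_assoc lf locally_finite_adjoint h(2))
  finally show "g \<in> finite_mats F B \<and>
      mat_mult (mat_adjoint g) g = mat_one \<and> mat_mult g (mat_adjoint g) = mat_one"
    using g u h by simp
next
  assume "g \<in> finite_mats F B \<and>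
    mat_mult (mat_adjoint g) g = mat_one \<and> mat_mult g (mat_adjoint g) = mat_one"
  then show "g \<in> unitary_mats F B"
    using finite_mats_adjoint by (auto simp: unitary_mats_def invertible_mats_def)
qed

text \<open>The hypothesis on inverses refers to invertibility in the big group, where inverses exist by
  definition.\<close>

lemma group_mat_group:
  assumes sub: "S \<subseteq> invertible_mats F B" and one: "mat_one \<in> S"
    and mult: "\<And>g h. g \<in> S \<Longrightarrow> h \<in> S \<Longrightarrow> mat_mult g h \<in> S"
    and inv: "\<And>g h. g \<in> S \<Longrightarrow> h \<in> invertible_mats F B \<Longrightarrow> mat_mult g h = mat_one \<Longrightarrow>
      mat_mult h g = mat_one \<Longrightarrow> h \<in> S"
  shows "group (mat_group S)"
proof (rule groupI)
  show "x \<otimes>\<^bsub>mat_group S\<^esub> y \<otimes>\<^bsub>mat_group S\<^esub> z = x \<otimes>\<^bsub>mat_group S\<^esub> (y \<otimes>\<^bsub>mat_group S\<^esub> z)"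
    if "x \<in> carrier (mat_group S)" "y \<in> carrier (mat_group S)" "z \<in> carrier (mat_group S)" for x y z
  proof -
    have "x \<in> finite_mats F B" "z \<in> finite_mats F B"
      using that sub invertible_matsD by (auto simp: mat_group_def)
    then show ?thesis
      by (simp add: mat_group_def mat_mult_assoc finite_mats_locally_finite)
  qed
  show "\<exists>y\<in>carrier (mat_group S). y \<otimes>\<^bsub>mat_group S\<^esub> x = \<one>\<^bsub>mat_group S\<^esub>"
    if x: "x \<in> carrier (mat_group S)" for x
  proof -
    have xS: "x \<in> S" using x by (simp add: mat_group_def)
    then have "x \<in> invertible_mats F B" using sub by auto
    then obtain y where y: "x \<in> finite_mats F B" "y \<in> finite_mats F B" "mat_mult x y = mat_one" "mat_mult y x = mat_one"
      by (auto simp: invertible_mats_def)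
    then have "y \<in> invertible_mats F B"
      unfolding invertible_mats_def by (intro CollectI conjI bexI[of _ x]) simp_all
    then have "y \<in> S"
      using inv[OF xS] y by simp
    then show ?thesis
      using y by (intro bexI[of _ y]) (simp_all add: mat_group_def)
  qed
qed (simp_all add: mat_group_def one mult)

lemma finite_mats_mono:
  assumes "B \<subseteq> C" "g \<in> finite_mats F B"
  shows "g \<in> finite_mats F C"
proof -
  obtain S where "S \<subseteq> B" "finite S" "supported_on S g"
    using assms(2) by (auto simp: finite_mats_iff)
  moreover from this assms(1) have "S \<subseteq> C" by simp
  ultimately show ?thesis
    using finite_mats_scalars[OF assms(2)] unfolding finite_mats_iff by (intro conjI allI exI)
qed

lemma unitary_mats_mono: "B \<subseteq> C \<Longrightarrow> g \<in> unitary_mats F B \<Longrightarrow> g \<in> unitary_mats F C"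
  by (simp add: unitary_mats_iff finite_mats_mono)

section \<open>Change of scalars\<close>

lemma change_scalars_inside:
  "r < length (scalar_basis A B) \<Longrightarrow> s < length (scalar_basis A B) \<Longrightarrow>
    change_scalars A B g (a, r) (b, s) =
      proj B (qcnj (scalar_basis A B ! r) * g a b * scalar_basis A B ! s)"
  and change_scalars_outside:
  "\<not> (r < length (scalar_basis A B) \<and> s < length (scalar_basis A B)) \<Longrightarrow>
    change_scalars A B g (a, r) (b, s) = mat_one (a, r) (b, s)"
  by (auto simp: change_scalars_def Let_def)

lemma change_scalars_one_entry:
  assumes "g a b = mat_one a b"
  shows "change_scalars A B g (a, r) (b, s) = mat_one (a, r) (b, s)"
proof (cases "r < length (scalar_basis A B) \<and> s < length (scalar_basis A B)")
  case True
  then show ?thesis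
    using assms by (auto simp: change_scalars_inside scalar_basis_orthonormal mat_one_def)
next
  case False
  then show ?thesis by (rule change_scalars_outside)
qed

lemma change_scalars_one: "change_scalars A B mat_one = mat_one"
  by (intro ext) (auto simp: change_scalars_one_entry)

lemma change_scalars_in: "change_scalars A B g x y \<in> scalars B"
  by (cases x; cases y) (simp add: change_scalars_def Let_def proj_in del: scalars.simps)

lemma change_scalars_adjoint:
  "mat_adjoint (change_scalars A B g) = change_scalars A B (mat_adjoint g)"
proof (intro ext)
  fix x y :: "'a \<times> nat"
  obtain a r b s where xy: "x = (a, r)" "y = (b, s)" by (cases x; cases y)
  show "mat_adjoint (change_scalars A B g) x y = change_scalars A B (mat_adjoint g) x y"
    unfolding xy
  proof (cases "r < length (scalar_basis A B) \<and> s < length (scalar_basis A B)")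
    case True
    then show "mat_adjoint (change_scalars A B g) (a, r) (b, s) =
        change_scalars A B (mat_adjoint g) (a, r) (b, s)"
      by (simp add: mat_adjoint_def change_scalars_inside qcnj_proj qcnj_mult mult.assoc)
  next
    case False
    then have False': "\<not> (s < length (scalar_basis A B) \<and> r < length (scalar_basis A B))" by auto
    then show "mat_adjoint (change_scalars A B g) (a, r) (b, s) =
        change_scalars A B (mat_adjoint g) (a, r) (b, s)"
      unfolding mat_adjoint_def change_scalars_outside[OF False] change_scalars_outside[OF False']
      by (simp add: mat_one_commute)
  qed
qed

text \<open>Expanding \<open>h b c * e\<^sub>t\<close> in the basis \<open>e\<close> and pulling the coordinates, which lie in \<open>B\<close>, out of the
  projection turns the sum over the intermediate basis vectors into one projection.\<close>

lemma change_scalars_mult: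
  assumes g: "locally_finite g" and h: "\<And>b c. h b c \<in> scalars A"
  shows "mat_mult (change_scalars A B g) (change_scalars A B h) = change_scalars A B (mat_mult g h)"
proof (intro ext)
  fix x y :: "'a \<times> nat"
  obtain a r c t where xy: "x = (a, r)" "y = (c, t)" by (cases x; cases y)
  let ?e = "scalar_basis A B"
  let ?n = "length ?e"
  let ?T = "{b. g a b \<noteq> 0}"
  have fin: "finite ?T"
    using g by (simp add: locally_finite_def)
  show "mat_mult (change_scalars A B g) (change_scalars A B h) x y =
      change_scalars A B (mat_mult g h) x y"
    unfolding xy
  proof (cases "r < ?n")
    case False
    have "mat_mult (change_scalars A B g) (change_scalars A B h) (a, r) (c, t) =
        change_scalars A B h (a, r) (c, t)"
    proof (rule mat_mult_row_one)
      show "change_scalars A B g (a, r) b = mat_one (a, r) b" for b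
        using False by (cases b) (simp add: change_scalars_outside)
    qed
    then show "mat_mult (change_scalars A B g) (change_scalars A B h) (a, r) (c, t) =
        change_scalars A B (mat_mult g h) (a, r) (c, t)"
      using False by (simp add: change_scalars_outside)
  next
    case r: True
    have "mat_mult (change_scalars A B g) (change_scalars A B h) (a, r) (c, t) =
        (\<Sum>b\<in>?T \<times> {..<?n}. change_scalars A B g (a, r) b * change_scalars A B h b (c, t))"
    proof (rule mat_mult_row)
      show "change_scalars A B g (a, r) x = 0" if "x \<notin> ?T \<times> {..<?n}" for x
      proof -
        obtain b s where x: "x = (b, s)" by (cases x)
        show ?thesis
          using that r unfolding x
          by (cases "s < ?n") (auto simp: change_scalars_inside change_scalars_outside mat_one_def)
      qed
    qed (use fin in simp)
    also have "\<dots> = (\<Sum>b\<in>?T. \<Sum>s<?n.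
        change_scalars A B g (a, r) (b, s) * change_scalars A B h (b, s) (c, t))"
      by (simp add: sum.cartesian_product)
    finally have eq: "mat_mult (change_scalars A B g) (change_scalars A B h) (a, r) (c, t) = \<dots>" .
    show "mat_mult (change_scalars A B g) (change_scalars A B h) (a, r) (c, t) =
        change_scalars A B (mat_mult g h) (a, r) (c, t)"
    proof (cases "t < ?n")
      case False
      then have "change_scalars A B h (b, s) (c, t) = 0" if "s < ?n" for b s
        using that by (auto simp: change_scalars_outside mat_one_def)
      then have "mat_mult (change_scalars A B g) (change_scalars A B h) (a, r) (c, t) = 0"
        unfolding eq by simp
      moreover have "r \<noteq> t" using r False by auto
      ultimately show ?thesis
        using False by (simp add: change_scalars_outside mat_one_def)
    next
      case t: True
      have "(\<Sum>s<?n. change_scalars A B g (a, r) (b, s) * change_scalars A B h (b, s) (c, t)) =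
          proj B (qcnj (?e ! r) * (g a b * h b c) * ?e ! t)" for b
      proof -
        have ht: "h b c * ?e ! t \<in> scalars A"
          using h scalar_basis_in[OF t] by simp
        have "(\<Sum>s<?n. change_scalars A B g (a, r) (b, s) * change_scalars A B h (b, s) (c, t)) =
            (\<Sum>s<?n. proj B (qcnj (?e ! r) * g a b * (?e ! s * proj B (qcnj (?e ! s) * (h b c * ?e ! t)))))"
          using r t
          by (intro sum.cong) (simp_all add: change_scalars_inside proj_in mult.assoc
              flip: proj_mult_right)
        also have "\<dots> = proj B (qcnj (?e ! r) * g a b *
            (\<Sum>s<?n. ?e ! s * proj B (qcnj (?e ! s) * (h b c * ?e ! t))))"
          by (simp add: sum_distrib_left proj_sum)
        also have "\<dots> = proj B (qcnj (?e ! r) * (g a b * h b c) * ?e ! t)"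
          unfolding scalar_basis_expand[OF ht] by (simp add: mult.assoc)
        finally show ?thesis .
      qed
      then have "mat_mult (change_scalars A B g) (change_scalars A B h) (a, r) (c, t) =
          proj B (qcnj (?e ! r) * (\<Sum>b\<in>?T. g a b * h b c) * ?e ! t)"
        unfolding eq by (simp add: sum_distrib_left sum_distrib_right proj_sum)
      also have "(\<Sum>b\<in>?T. g a b * h b c) = mat_mult g h a c"
        by (rule mat_mult_row[OF fin, symmetric]) simp
      finally show ?thesis
        using r t by (simp add: change_scalars_inside)
    qed
  qed
qed

lemma change_scalars_supported:
  assumes "supported_on S g"
  shows "supported_on (S \<times> {..<length (scalar_basis A B)}) (change_scalars A B g)"
  unfolding supported_on_def
proof (intro allI impI)
  fix x y :: "'a \<times> nat"
  assume out: "x \<notin> S \<times> {..<length (scalar_basis A B)} \<or> y \<notin> S \<times> {..<length (scalar_basis A B)}"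
  obtain a r b s where xy: "x = (a, r)" "y = (b, s)" by (cases x; cases y)
  show "change_scalars A B g x y = mat_one x y"
  proof (cases "a \<in> S \<and> b \<in> S")
    case True
    then show ?thesis
      using out unfolding xy by (intro change_scalars_outside) auto
  next
    case False
    then show ?thesis
      unfolding xy using supported_onD[OF assms] by (intro change_scalars_one_entry) auto
  qed
qed

lemma change_scalars_unitary:
  assumes "g \<in> unitary_mats A X"
  shows "change_scalars A B g \<in> unitary_mats B (X \<times> {..<length (scalar_basis A B)})"
proof -
  have g: "g \<in> finite_mats A X" "mat_mult (mat_adjoint g) g = mat_one" "mat_mult g (mat_adjoint g) = mat_one"
    using assms by (simp_all add: unitary_mats_iff)
  note ga = finite_mats_adjoint[OF g(1)]
  obtain S where S: "S \<subseteq> X" "finite S" "supported_on S g"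
    using g(1) by (auto simp: finite_mats_iff)
  have "change_scalars A B g \<in> finite_mats B (X \<times> {..<length (scalar_basis A B)})"
    unfolding finite_mats_iff
    using S change_scalars_in[of A B g] change_scalars_supported[OF S(3), of A B]
    by (intro conjI allI exI[of _ "S \<times> {..<length (scalar_basis A B)}"]) auto
  then show ?thesis
    by (simp add: unitary_mats_iff change_scalars_adjoint change_scalars_mult g change_scalars_one
        finite_mats_locally_finite[OF g(1)] finite_mats_locally_finite[OF ga]
        finite_mats_scalars[OF g(1)] finite_mats_scalars[OF ga] del: scalars.simps)
qed

section \<open>Block diagonal matrices\<close>

text \<open>The index set of \<open>M\<close> contains disjoint copies \<open>d i\<close>, \<open>i \<in> J\<close>, of the index sets of the blocks; the
  remaining indices form a unit block.\<close>

definition block_diagonal :: "'i set \<Rightarrow> ('i \<Rightarrow> 'y \<Rightarrow> 'x) \<Rightarrow> ('i \<Rightarrow> 'y qmat) \<Rightarrow> 'x qmat \<Rightarrow> bool" where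
  "block_diagonal J d g M \<longleftrightarrow>
     (\<forall>i\<in>J. \<forall>y z. M (d i y) (d i z) = g i y z) \<and>
     (\<forall>a b. (\<nexists>i y z. i \<in> J \<and> a = d i y \<and> b = d i z) \<longrightarrow> M a b = mat_one a b)"

lemma block_diagonal_unique:
  assumes "block_diagonal J d g M" "block_diagonal J d g N"
  shows "M = N"
proof (intro ext)
  fix a b
  show "M a b = N a b"
    using assms by (cases "\<exists>i y z. i \<in> J \<and> a = d i y \<and> b = d i z") (auto simp: block_diagonal_def)
qed

lemma block_diagonal_scalars:
  assumes "block_diagonal J d g M" "\<And>i y z. i \<in> J \<Longrightarrow> g i y z \<in> scalars F"
  shows "M a b \<in> scalars F"
  using assms
  by (cases "\<exists>i y z. i \<in> J \<and> a = d i y \<and> b = d i z") (auto simp: block_diagonal_def simp del: scalars.simps)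

lemma block_diagonal_adjoint:
  assumes "block_diagonal J d g M"
  shows "block_diagonal J d (\<lambda>i. mat_adjoint (g i)) (mat_adjoint M)"
  unfolding block_diagonal_def mat_adjoint_def
proof (intro conjI ballI allI impI)
  show "qcnj (M (d i z) (d i y)) = qcnj (g i z y)" if "i \<in> J" for i y z
    using assms that by (simp add: block_diagonal_def)
  fix a b assume "\<nexists>i y z. i \<in> J \<and> a = d i y \<and> b = d i z"
  then have "\<nexists>i y z. i \<in> J \<and> b = d i y \<and> a = d i z" by auto
  then have "M b a = mat_one b a"
    using assms by (simp add: block_diagonal_def)
  then show "qcnj (M b a) = mat_one a b"
    by (simp add: mat_one_commute)
qed

lemma block_diagonal_supported:
  assumes "block_diagonal J d g M" "inj_on (\<lambda>(i, y). d i y) (J \<times> UNIV)"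
    and "\<And>i. i \<in> J \<Longrightarrow> supported_on (S i) (g i)"
  shows "supported_on (\<Union>i\<in>J. d i ` S i) M"
  unfolding supported_on_def
proof (intro allI impI)
  fix a b assume out: "a \<notin> (\<Union>i\<in>J. d i ` S i) \<or> b \<notin> (\<Union>i\<in>J. d i ` S i)"
  show "M a b = mat_one a b"
  proof (cases "\<exists>i y z. i \<in> J \<and> a = d i y \<and> b = d i z")
    case True
    then obtain i y z where i: "i \<in> J" "a = d i y" "b = d i z" by auto
    then have "g i y z = mat_one y z"
      using out assms(3)[OF i(1)] by (auto simp: supported_on_def)
    moreover have "d i y = d i z \<longleftrightarrow> y = z"
      using inj_onD[OF assms(2), of "(i, y)" "(i, z)"] i(1) by auto
    ultimately show ?thesis
      using assms(1) i by (simp add: block_diagonal_def mat_one_def)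
  next
    case False
    then show ?thesis
      using assms(1) by (simp add: block_diagonal_def)
  qed
qed

lemma block_diagonal_one:
  assumes "inj_on (\<lambda>(i, y). d i y) (J \<times> UNIV)"
  shows "block_diagonal J d (\<lambda>_. mat_one) mat_one"
proof -
  have "d i y = d i z \<longleftrightarrow> y = z" if "i \<in> J" for i y z
    using inj_onD[OF assms(1), of "(i, y)" "(i, z)"] that by auto
  then show ?thesis
    by (auto simp: block_diagonal_def mat_one_def)
qed

lemma block_diagonal_mult:
  assumes M: "block_diagonal J d g M" and N: "block_diagonal J d h N"
    and inj: "inj_on (\<lambda>(i, y). d i y) (J \<times> UNIV)"
    and lf: "\<And>i. i \<in> J \<Longrightarrow> locally_finite (g i)"
  shows "block_diagonal J d (\<lambda>i. mat_mult (g i) (h i)) (mat_mult M N)"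
proof -
  have d_eq: "i = j \<and> y = z" if "d i y = d j z" "i \<in> J" "j \<in> J" for i j y z
    using inj_onD[OF inj, of "(i, y)" "(j, z)"] that by auto
  have outside: "M' (d i y) b = mat_one (d i y) b"
    if "block_diagonal J d g' M'" "i \<in> J" "b \<notin> range (d i)" for M' g' i y b
  proof -
    have "\<nexists>j u v. j \<in> J \<and> d i y = d j u \<and> b = d j v"
      using that(2,3) d_eq by blast
    then show ?thesis
      using that(1) by (simp add: block_diagonal_def)
  qed
  have row: "mat_mult M N (d i y) c = (\<Sum>z | g i y z \<noteq> 0. g i y z * N (d i z) c)" if i: "i \<in> J" for i y c
  proof -
    let ?T = "{z. g i y z \<noteq> 0}"
    have inj_i: "inj_on (d i) ?T"
      using d_eq[OF _ i i] by (auto intro: inj_onI)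
    have "mat_mult M N (d i y) c = (\<Sum>b\<in>d i ` ?T. M (d i y) b * N b c)"
    proof (rule mat_mult_row)
      show "finite (d i ` ?T)"
        using lf[OF i] by (simp add: locally_finite_def)
      show "M (d i y) b = 0" if "b \<notin> d i ` ?T" for b
      proof (cases "b \<in> range (d i)")
        case True
        then obtain z where "b = d i z" by auto
        then show ?thesis
          using that M i by (auto simp: block_diagonal_def)
      next
        case False
        then have "d i y \<noteq> b" by auto
        then show ?thesis
          using outside[OF M i False, of y] by (simp add: mat_one_def)
      qed
    qed
    also have "\<dots> = (\<Sum>z\<in>?T. M (d i y) (d i z) * N (d i z) c)"
      by (simp add: sum.reindex[OF inj_i])
    finally show ?thesis
      using M i by (simp add: block_diagonal_def)
  qed
  show ?thesis
    unfolding block_diagonal_def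
  proof (intro conjI ballI allI impI)
    fix i y z assume i: "i \<in> J"
    have "finite {z. g i y z \<noteq> 0}"
      using lf[OF i] by (simp add: locally_finite_def)
    from mat_mult_row[OF this, of "g i" y "h i" z]
    show "mat_mult M N (d i y) (d i z) = mat_mult (g i) (h i) y z"
      using N i by (simp add: row[OF i] block_diagonal_def)
  next
    fix a b assume ab: "\<nexists>i y z. i \<in> J \<and> a = d i y \<and> b = d i z"
    show "mat_mult M N a b = mat_one a b"
    proof (cases "\<exists>i y. i \<in> J \<and> a = d i y")
      case True
      then obtain i y where i: "i \<in> J" "a = d i y" by auto
      then have b: "b \<notin> range (d i)" using ab by auto
      then have "N (d i z) b = 0" for z
        using outside[OF N i(1) b, of z] by (auto simp: mat_one_def)
      then have "mat_mult M N a b = 0"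
        using row[OF i(1), of y b] i(2) by simp
      moreover have "a \<noteq> b" using i b by auto
      ultimately show ?thesis by (simp add: mat_one_def)
    next
      case False
      have "mat_mult M N a b = N a b"
        by (rule mat_mult_row_one) (use False M in \<open>auto simp: block_diagonal_def\<close>)
      then show ?thesis
        using N ab by (simp add: block_diagonal_def)
    qed
  qed
qed

lemma block_diagonal_unitary:
  assumes M: "block_diagonal J d g M" and inj: "inj_on (\<lambda>(i, y). d i y) (J \<times> UNIV)" and "finite J"
    and g: "\<And>i. i \<in> J \<Longrightarrow> g i \<in> unitary_mats F (B i)"
  shows "M \<in> unitary_mats F (\<Union>i\<in>J. d i ` B i)"
proof -
  have gu: "g i \<in> finite_mats F (B i)" "mat_mult (mat_adjoint (g i)) (g i) = mat_one"
    "mat_mult (g i) (mat_adjoint (g i)) = mat_one" if "i \<in> J" for i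
    using g[OF that] by (simp_all add: unitary_mats_iff)
  have "\<exists>S. S \<subseteq> B i \<and> finite S \<and> supported_on S (g i)" if "i \<in> J" for i
    using gu(1)[OF that] by (auto simp: finite_mats_iff)
  then obtain S where S: "\<And>i. i \<in> J \<Longrightarrow> S i \<subseteq> B i \<and> finite (S i) \<and> supported_on (S i) (g i)"
    by metis
  have "supported_on (\<Union>i\<in>J. d i ` S i) M"
    by (rule block_diagonal_supported[OF M inj]) (use S in simp)
  moreover have "(\<Union>i\<in>J. d i ` S i) \<subseteq> (\<Union>i\<in>J. d i ` B i)" "finite (\<Union>i\<in>J. d i ` S i)"
    using S \<open>finite J\<close> by (auto intro!: UN_mono image_mono)
  moreover have "M a b \<in> scalars F" for a b
    by (rule block_diagonal_scalars[OF M]) (rule finite_mats_scalars[OF gu(1)])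
  ultimately have "M \<in> finite_mats F (\<Union>i\<in>J. d i ` B i)"
    unfolding finite_mats_iff by (intro conjI allI exI)
  moreover note adj = block_diagonal_adjoint[OF M]
  have lf: "locally_finite (g i)" "locally_finite (mat_adjoint (g i))" if "i \<in> J" for i
    using finite_mats_locally_finite[OF gu(1)[OF that]] locally_finite_adjoint by auto
  have cong: "block_diagonal J d (\<lambda>_. mat_one) N" if "block_diagonal J d f N" "\<And>i. i \<in> J \<Longrightarrow> f i = mat_one" for f N
    using that by (simp add: block_diagonal_def)
  have "mat_mult (mat_adjoint M) M = mat_one"
    by (rule block_diagonal_unique[OF cong[OF block_diagonal_mult[OF adj M inj]] block_diagonal_one[OF inj]])
      (simp_all add: lf gu)
  moreover have "mat_mult M (mat_adjoint M) = mat_one"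
    by (rule block_diagonal_unique[OF cong[OF block_diagonal_mult[OF M adj inj]] block_diagonal_one[OF inj]])
      (simp_all add: lf gu)
  ultimately show ?thesis
    by (simp add: unitary_mats_iff)
qed

section \<open>The embedding of the heavy group\<close>

abbreviation conj_mat :: "'a qmat \<Rightarrow> 'a qmat" where
  "conj_mat g \<equiv> \<lambda>a b. qcnj (g a b)"

lemma conj_mat_mult:
  assumes "locally_finite g" "\<And>a b. g a b \<in> scalars CC" "\<And>a b. h a b \<in> scalars CC"
  shows "conj_mat (mat_mult g h) = mat_mult (conj_mat g) (conj_mat h)"
proof (intro ext)
  fix a c
  have fin: "finite {b. g a b \<noteq> 0}"
    using assms(1) by (simp add: locally_finite_def)
  have "mat_mult (conj_mat g) (conj_mat h) a c = (\<Sum>b | g a b \<noteq> 0. qcnj (g a b) * qcnj (h b c))"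
    by (rule mat_mult_row[OF fin]) simp
  moreover have "mat_mult g h a c = (\<Sum>b | g a b \<noteq> 0. g a b * h b c)"
    by (rule mat_mult_row[OF fin]) simp
  ultimately show "conj_mat (mat_mult g h) a c = mat_mult (conj_mat g) (conj_mat h) a c"
    using assms(2,3)
    by (auto simp: qcnj_sum qcnj_mult simp del: scalars.simps
        intro!: sum.cong scalars_CC_commute scalars_closed)
qed

lemma conj_mat_one: "conj_mat mat_one = mat_one"
  by (intro ext) simp

lemma conj_mat_unitary:
  assumes "g \<in> unitary_mats CC X"
  shows "conj_mat g \<in> unitary_mats CC X"
proof -
  have g: "g \<in> finite_mats CC X" "mat_mult (mat_adjoint g) g = mat_one" "mat_mult g (mat_adjoint g) = mat_one"
    using assms by (simp_all add: unitary_mats_iff)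
  note ga = finite_mats_adjoint[OF g(1)]
  note lf = finite_mats_locally_finite[OF g(1)] finite_mats_locally_finite[OF ga]
  note sc = finite_mats_scalars[OF g(1)] finite_mats_scalars[OF ga]
  obtain S where S: "S \<subseteq> X" "finite S" "supported_on S g"
    using g(1) by (auto simp: finite_mats_iff)
  have adj: "mat_adjoint (conj_mat g) = conj_mat (mat_adjoint g)"
    by (intro ext) (simp add: mat_adjoint_def)
  have "supported_on S (conj_mat g)"
    using S(3) by (simp add: supported_on_def)
  then have "conj_mat g \<in> finite_mats CC X"
    unfolding finite_mats_iff using S sc(1)
    by (intro conjI allI exI[of _ S]) (simp_all del: scalars.simps)
  moreover have "mat_mult (mat_adjoint (conj_mat g)) (conj_mat g) = conj_mat (mat_mult (mat_adjoint g) g)"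
    unfolding adj by (rule conj_mat_mult[symmetric, OF lf(2) sc(2) sc(1)])
  moreover have "mat_mult (conj_mat g) (mat_adjoint (conj_mat g)) = conj_mat (mat_mult g (mat_adjoint g))"
    unfolding adj by (rule conj_mat_mult[symmetric, OF lf(1) sc(1) sc(2)])
  ultimately show ?thesis
    by (simp add: unitary_mats_iff g conj_mat_one)
qed

lemma unitary_mats_locally_finite: "g \<in> unitary_mats F B \<Longrightarrow> locally_finite g"
  by (auto simp: unitary_mats_iff intro: finite_mats_locally_finite)

lemma unitary_mats_scalars: "g \<in> unitary_mats F B \<Longrightarrow> g a b \<in> scalars F"
  by (rule finite_mats_scalars[of g F B]) (simp add: unitary_mats_iff)

lemma trivial_hom_unitary:
  assumes "g \<in> unitary_mats A X" "c = Conjugation \<longrightarrow> A = CC"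
  shows "trivial_hom c A B g \<in> unitary_mats B (X \<times> {..<length (scalar_basis A B)})"
proof (cases c)
  case Standard
  then show ?thesis
    using change_scalars_unitary[OF assms(1), of B] by simp
next
  case Conjugation
  then have A: "A = CC" using assms(2) by simp
  show ?thesis
    using change_scalars_unitary[OF conj_mat_unitary[OF assms(1)[unfolded A]], of B]
    unfolding Conjugation A by simp
qed

lemma trivial_hom_mult:
  assumes "g \<in> unitary_mats A X" "h \<in> unitary_mats A X" "c = Conjugation \<longrightarrow> A = CC"
  shows "trivial_hom c A B (mat_mult g h) = mat_mult (trivial_hom c A B g) (trivial_hom c A B h)"
proof (cases c)
  case Standard
  then show ?thesis
    using assms by (simp add: change_scalars_mult unitary_mats_locally_finite unitary_mats_scalars del: scalars.simps)
next
  case Conjugation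
  then have A: "A = CC" using assms(3) by simp
  note g = conj_mat_unitary[OF assms(1)[unfolded A]] and h = conj_mat_unitary[OF assms(2)[unfolded A]]
  have "conj_mat (mat_mult g h) = mat_mult (conj_mat g) (conj_mat h)"
    using assms(1,2) unfolding A
    by (intro conj_mat_mult unitary_mats_locally_finite unitary_mats_scalars)
  then show ?thesis
    using Conjugation A change_scalars_mult[OF unitary_mats_locally_finite[OF g] unitary_mats_scalars[OF h], of B]
    by simp
qed

lemma straight_hom_block:
  "block_diagonal {..<length (blocks s)} (\<lambda>j (k, r). Copy j k r)
     (\<lambda>j. trivial_hom (snd (blocks s ! j)) (Fs ! fst (blocks s ! j)) F (l (fst (blocks s ! j))))
     (straight_hom Fs F s l)"
  unfolding block_diagonal_def
proof (intro conjI ballI allI impI)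
  fix j y z assume "j \<in> {..<length (blocks s)}"
  then show "straight_hom Fs F s l (case y of (k, r) \<Rightarrow> Copy j k r) (case z of (k, r) \<Rightarrow> Copy j k r) =
      trivial_hom (snd (blocks s ! j)) (Fs ! fst (blocks s ! j)) F (l (fst (blocks s ! j))) y z"
    by (cases y; cases z; cases "blocks s ! j") simp
next
  fix a b assume out: "\<nexists>j y z. j \<in> {..<length (blocks s)} \<and>
    a = (case y of (k, r) \<Rightarrow> Copy j k r) \<and> b = (case z of (k, r) \<Rightarrow> Copy j k r)"
  show "straight_hom Fs F s l a b = mat_one a b"
  proof (cases "\<exists>j k r j' k' r'. a = Copy j k r \<and> b = Copy j' k' r'")
    case True
    then obtain j k r j' k' r' where ab: "a = Copy j k r" "b = Copy j' k' r'" by auto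
    have "\<not> (j = j' \<and> j < length (blocks s))"
    proof
      assume "j = j' \<and> j < length (blocks s)"
      then have "j \<in> {..<length (blocks s)} \<and> a = (case (k, r) of (k, r) \<Rightarrow> Copy j k r) \<and>
          b = (case (k', r') of (k, r) \<Rightarrow> Copy j k r)"
        using ab by simp
      then show False using out by blast
    qed
    then show ?thesis
      unfolding ab straight_hom.simps(1) by (rule if_not_P)
  next
    case False
    then show ?thesis
      by (cases a; cases b) simp_all
  qed
qed

lemma inj_Copy: "inj_on (\<lambda>(j, y). case y of (k, r) \<Rightarrow> Copy j k r) S"
  by (auto intro!: inj_onI)

lemma heavy_carrierD: "l \<in> carrier (heavy_group Fs) \<Longrightarrow> m < length Fs \<Longrightarrow> l m \<in> unitary_mats (Fs ! m) UNIV"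
  by (auto simp: heavy_group_def irreducible_heavy_group_def mat_group_def PiE_iff)

lemma heavy_mult: "m < length Fs \<Longrightarrow> (l \<otimes>\<^bsub>heavy_group Fs\<^esub> l') m = mat_mult (l m) (l' m)"
  by (simp add: heavy_group_def irreducible_heavy_group_def mat_group_def)

lemma straight_blockD:
  assumes "straight_data Fs F s" "j < length (blocks s)"
  shows "fst (blocks s ! j) < length Fs"
    "snd (blocks s ! j) = Conjugation \<longrightarrow> Fs ! fst (blocks s ! j) = CC"
proof -
  have "(fst (blocks s ! j), snd (blocks s ! j)) \<in> set (blocks s)"
    using assms(2) by simp
  then show "fst (blocks s ! j) < length Fs"
    "snd (blocks s ! j) = Conjugation \<longrightarrow> Fs ! fst (blocks s ! j) = CC"
    using assms(1) unfolding straight_data_def by blast+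
qed

lemma straight_hom_unitary:
  assumes s: "straight_data Fs F s" and l: "l \<in> carrier (heavy_group Fs)"
  shows "straight_hom Fs F s l \<in> unitary_mats F (label_set Fs F s)"
proof (rule unitary_mats_mono)
  show "straight_hom Fs F s l \<in> unitary_mats F (\<Union>j\<in>{..<length (blocks s)}.
      (\<lambda>(k, r). Copy j k r) ` (UNIV \<times> {..<length (scalar_basis (Fs ! fst (blocks s ! j)) F)}))"
  proof (rule block_diagonal_unitary[OF straight_hom_block inj_Copy finite_lessThan])
    fix j assume "j \<in> {..<length (blocks s)}"
    then have j: "j < length (blocks s)" by simp
    show "trivial_hom (snd (blocks s ! j)) (Fs ! fst (blocks s ! j)) F (l (fst (blocks s ! j)))
        \<in> unitary_mats F (UNIV \<times> {..<length (scalar_basis (Fs ! fst (blocks s ! j)) F)})"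
      by (rule trivial_hom_unitary[OF heavy_carrierD[OF l straight_blockD(1)[OF s j]]
            straight_blockD(2)[OF s j]])
  qed
qed (auto simp: label_set_def)

lemma straight_hom_mult:
  assumes s: "straight_data Fs F s" and l: "l \<in> carrier (heavy_group Fs)" "l' \<in> carrier (heavy_group Fs)"
  shows "straight_hom Fs F s (l \<otimes>\<^bsub>heavy_group Fs\<^esub> l') =
    mat_mult (straight_hom Fs F s l) (straight_hom Fs F s l')"
proof (rule block_diagonal_unique[OF straight_hom_block])
  let ?g = "\<lambda>l j. trivial_hom (snd (blocks s ! j)) (Fs ! fst (blocks s ! j)) F (l (fst (blocks s ! j)))"
  have "locally_finite (?g l j)" if "j \<in> {..<length (blocks s)}" for j
  proof -
    have j: "j < length (blocks s)" using that by simp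
    show ?thesis
      by (rule unitary_mats_locally_finite[OF trivial_hom_unitary[OF
              heavy_carrierD[OF l(1) straight_blockD(1)[OF s j]] straight_blockD(2)[OF s j]]])
  qed
  then have "block_diagonal {..<length (blocks s)} (\<lambda>j (k, r). Copy j k r)
      (\<lambda>j. mat_mult (?g l j) (?g l' j)) (mat_mult (straight_hom Fs F s l) (straight_hom Fs F s l'))"
    by (intro block_diagonal_mult straight_hom_block inj_Copy)
  moreover have "mat_mult (?g l j) (?g l' j) = ?g (l \<otimes>\<^bsub>heavy_group Fs\<^esub> l') j"
    if "j < length (blocks s)" for j
    unfolding heavy_mult[OF straight_blockD(1)[OF s that]]
    by (rule trivial_hom_mult[symmetric, OF heavy_carrierD[OF l(1) straight_blockD(1)[OF s that]]
          heavy_carrierD[OF l(2) straight_blockD(1)[OF s that]] straight_blockD(2)[OF s that]])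
  ultimately show "block_diagonal {..<length (blocks s)} (\<lambda>j (k, r). Copy j k r)
      (?g (l \<otimes>\<^bsub>heavy_group Fs\<^esub> l')) (mat_mult (straight_hom Fs F s l) (straight_hom Fs F s l'))"
    by (simp add: block_diagonal_def)
qed

text \<open>The entries of the image of the maximal heavy subgroup may lie in a smaller algebra than those of the
  classical group: this is what makes the two kinds of transposition agree on \<open>O(\<infinity>)\<close> in \<open>O(\<infinity>,\<complex>)\<close>, and
  \<open>\<i>\<close> central for \<open>U(\<infinity>)\<close> in \<open>SO\<^sup>*(2\<infinity>)\<close>.\<close>

fun heavy_alg :: "classical_type \<Rightarrow> division_alg" where
  "heavy_alg Sp_R = RR"
| "heavy_alg Sp_C = CC"
| "heavy_alg X = heavy_kind X"

fun classical_alg :: "classical_type \<Rightarrow> division_alg" where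
  "classical_alg Sp_R = RR"
| "classical_alg Sp_C = CC"
| "classical_alg O_C = CC"
| "classical_alg SO_star = HH"
| "classical_alg X = heavy_kind X"

lemma heavy_alg_le: "x \<in> scalars (heavy_alg X) \<Longrightarrow> x \<in> scalars (classical_alg X)"
  by (cases X) auto

lemma heavy_embedding_block_Sp:
  fixes k :: "nat \<Rightarrow> 'b qmat"
  assumes "X = Sp_R \<and> A = CC \<and> B = RR \<or> X = Sp_C \<and> A = HH \<and> B = CC"
  shows "block_diagonal {0::nat} (\<lambda>_ (b, t). Vec t b) (\<lambda>_. change_scalars A B (k 0)) (heavy_embedding X k)"
  unfolding block_diagonal_def
proof (intro conjI ballI allI impI)
  fix y z
  show "heavy_embedding X k (case y of (b, t) \<Rightarrow> Vec t b) (case z of (b, t) \<Rightarrow> Vec t b) =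
      change_scalars A B (k 0) y z"
    using assms by (cases y; cases z) auto
next
  fix a b :: "'b coord" assume out: "\<nexists>i y z. i \<in> {0::nat} \<and> a = (case y of (b, t) \<Rightarrow> Vec t b) \<and> b = (case z of (b, t) \<Rightarrow> Vec t b)"
  then have "\<not> (\<exists>t u c d. a = Vec t c \<and> b = Vec u d)"
    by auto
  then show "heavy_embedding X k a b = mat_one a b"
    by (cases a; cases b) simp_all
qed

lemma heavy_embedding_block:
  fixes k :: "nat \<Rightarrow> 'b qmat"
  assumes "X \<noteq> Sp_R" "X \<noteq> Sp_C"
  shows "block_diagonal {..<heavy_count X} Vec k (heavy_embedding X k)"
  unfolding block_diagonal_def
proof (intro conjI ballI allI impI)
  fix t b c assume "t \<in> {..<heavy_count X}"
  then show "heavy_embedding X k (Vec t b) (Vec t c) = k t b c"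
    using assms by (cases X) simp_all
next
  fix a b :: "'b coord" assume out: "\<nexists>t y z. t \<in> {..<heavy_count X} \<and> a = Vec t y \<and> b = Vec t z"
  then show "heavy_embedding X k a b = mat_one a b"
    using assms by (cases a; cases b; cases X) auto
qed

lemma inj_Vec: "inj_on (\<lambda>(t, b). Vec t b) S" "inj_on (\<lambda>(i, y). case y of (b, t) \<Rightarrow> Vec t b) ({0::nat} \<times> UNIV)"
  by (auto intro!: inj_onI)

lemma heavy_embedding_unitary:
  assumes "\<And>t. t < heavy_count X \<Longrightarrow> k t \<in> unitary_mats (heavy_kind X) (B t)"
  shows "heavy_embedding X k \<in> unitary_mats (heavy_alg X) (coord_set X B)"
proof (cases "X = Sp_R \<or> X = Sp_C")
  case True
  define A where "A = heavy_kind X"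
  have cases: "X = Sp_R \<and> A = CC \<and> heavy_alg X = RR \<or> X = Sp_C \<and> A = HH \<and> heavy_alg X = CC"
    using True by (auto simp: A_def)
  have "k 0 \<in> unitary_mats A (B 0)"
    unfolding A_def by (rule assms) (use True in auto)
  then have "change_scalars A (heavy_alg X) (k 0) \<in> unitary_mats (heavy_alg X) (B 0 \<times> {..<length (scalar_basis A (heavy_alg X))})"
    by (rule change_scalars_unitary)
  then have "heavy_embedding X k \<in> unitary_mats (heavy_alg X)
      (\<Union>i\<in>{0::nat}. (\<lambda>(b, t). Vec t b) ` (B 0 \<times> {..<length (scalar_basis A (heavy_alg X))}))"
    by (intro block_diagonal_unitary[OF heavy_embedding_block_Sp[OF cases] inj_Vec(2)]) simp_all
  then show ?thesis
    by (rule unitary_mats_mono[rotated]) (use cases in auto)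
next
  case False
  then have alg: "heavy_alg X = heavy_kind X"
    by (cases X) simp_all
  have "heavy_embedding X k \<in> unitary_mats (heavy_kind X) (\<Union>t\<in>{..<heavy_count X}. Vec t ` B t)"
    using False
    by (intro block_diagonal_unitary[OF heavy_embedding_block inj_Vec(1)]) (simp_all add: assms)
  then show ?thesis
    unfolding alg by (rule unitary_mats_mono[rotated]) (use False in \<open>cases X; auto\<close>)
qed

lemma heavy_embedding_mult:
  assumes k: "\<And>t. t < heavy_count X \<Longrightarrow> k t \<in> unitary_mats (heavy_kind X) (B t)"
    and k': "\<And>t. t < heavy_count X \<Longrightarrow> k' t \<in> unitary_mats (heavy_kind X) (B t)"
  shows "heavy_embedding X (\<lambda>t. mat_mult (k t) (k' t)) =
    mat_mult (heavy_embedding X k) (heavy_embedding X k')"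
proof (cases "X = Sp_R \<or> X = Sp_C")
  case True
  define A where "A = heavy_kind X"
  have cases: "X = Sp_R \<and> A = CC \<and> heavy_alg X = RR \<or> X = Sp_C \<and> A = HH \<and> heavy_alg X = CC"
    using True by (auto simp: A_def)
  have u: "k 0 \<in> unitary_mats A (B 0)" "k' 0 \<in> unitary_mats A (B 0)"
    unfolding A_def by (rule k k'; use True in auto)+
  have "block_diagonal {0::nat} (\<lambda>_ (b, t). Vec t b)
      (\<lambda>_. mat_mult (change_scalars A (heavy_alg X) (k 0)) (change_scalars A (heavy_alg X) (k' 0)))
      (mat_mult (heavy_embedding X k) (heavy_embedding X k'))"
    by (intro block_diagonal_mult heavy_embedding_block_Sp[OF cases] inj_Vec(2)
        unitary_mats_locally_finite[OF change_scalars_unitary[OF u(1)]])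
  then show ?thesis
    using block_diagonal_unique[OF heavy_embedding_block_Sp[OF cases, of "\<lambda>t. mat_mult (k t) (k' t)"]]
    by (simp add: change_scalars_mult unitary_mats_locally_finite[OF u(1)] unitary_mats_scalars[OF u(2)] del: scalars.simps)
next
  case False
  have "block_diagonal {..<heavy_count X} Vec (\<lambda>t. mat_mult (k t) (k' t))
      (mat_mult (heavy_embedding X k) (heavy_embedding X k'))"
    using False
    by (intro block_diagonal_mult heavy_embedding_block inj_Vec(1) unitary_mats_locally_finite[OF k]) simp_all
  then show ?thesis
    using block_diagonal_unique[OF heavy_embedding_block] False by blast
qed

subsection \<open>Invariant forms\<close>

fun preserves_form :: "classical_type \<Rightarrow> 'b coord qmat \<Rightarrow> bool" where
  "preserves_form (GL F) g = True"
| "preserves_form (U_inf_inf F) g = preserves_hermitian signature_form g"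
| "preserves_form (U_fin_inf p F) g = preserves_hermitian signature_form g"
| "preserves_form Sp_R g = preserves_bilinear symplectic_form g"
| "preserves_form Sp_C g = preserves_bilinear symplectic_form g"
| "preserves_form O_C g = preserves_bilinear mat_one g"
| "preserves_form SO_star g = preserves_hermitian skew_form g"

lemma classical_mats_eq:
  "classical_mats X I = {g \<in> invertible_mats (classical_alg X) I. preserves_form X g}"
  by (cases X) simp_all

lemma locally_finite_signature: "locally_finite (signature_form :: 'b coord qmat)"
proof -
  have "a = b" if "signature_form a b \<noteq> 0" for a b :: "'b coord"
    using that by (cases a) (auto simp: mat_one_def split: if_splits)
  then have "{b. signature_form a b \<noteq> 0} \<subseteq> {a}" "{b. signature_form b a \<noteq> 0} \<subseteq> {a}" for a :: "'b coord"
    by blast+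
  then show ?thesis
    unfolding locally_finite_def by (meson finite.emptyI finite.insertI finite_subset)
qed

lemma locally_finite_symplectic: "locally_finite (symplectic_form :: 'b coord qmat)"
proof -
  have "finite {b. symplectic_form a b \<noteq> 0} \<and> finite {b. symplectic_form b a \<noteq> 0}" for a :: "'b coord"
  proof (cases a)
    case (Neg n)
    then have "symplectic_form a b = 0" "symplectic_form b a = 0" for b
      by (cases b; simp)+
    then show ?thesis by simp
  next
    case (Vec t b)
    have "symplectic_form a c = 0 \<and> symplectic_form c a = 0" if "c \<notin> {Vec 0 b, Vec 1 b}" for c
      using that Vec by (cases c) auto
    then have "{c. symplectic_form a c \<noteq> 0} \<subseteq> {Vec 0 b, Vec 1 b}"
      "{c. symplectic_form c a \<noteq> 0} \<subseteq> {Vec 0 b, Vec 1 b}" by auto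
    then show ?thesis
      by (meson finite.emptyI finite.insertI finite_subset)
  qed
  then show ?thesis by (simp add: locally_finite_def)
qed

lemma locally_finite_skew: "locally_finite skew_form"
proof -
  have "{b. skew_form a b \<noteq> 0} \<subseteq> {a}" "{b. skew_form b a \<noteq> 0} \<subseteq> {a}" for a :: 'a
    by (auto simp: skew_form_def split: if_splits)
  then show ?thesis
    unfolding locally_finite_def by (meson finite.emptyI finite.insertI finite_subset)
qed

lemma locally_finite_one: "locally_finite mat_one"
  by (rule locally_finite_supported[OF finite.emptyI supported_on_one])

text \<open>Here \<open>g'\<close> and \<open>h'\<close> stand for the adjoints or for the transposes.\<close>

lemma preserved_form_mult:
  assumes lf: "locally_finite g" "locally_finite h" "locally_finite g'" "locally_finite h'" "locally_finite S"
    and g: "mat_mult (mat_mult g' S) g = S" and h: "mat_mult (mat_mult h' S) h = S"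
  shows "mat_mult (mat_mult (mat_mult h' g') S) (mat_mult g h) = S"
proof -
  have "mat_mult (mat_mult (mat_mult h' g') S) (mat_mult g h) = mat_mult (mat_mult h' (mat_mult (mat_mult g' S) g)) h"
    by (simp add: mat_mult_assoc lf locally_finite_mult)
  then show ?thesis
    by (simp add: g h)
qed

lemma preserved_form_inverse:
  assumes lf: "locally_finite g" "locally_finite h" "locally_finite g'" "locally_finite h'" "locally_finite S"
    and g: "mat_mult (mat_mult g' S) g = S" and gh: "mat_mult g h = mat_one" "mat_mult h' g' = mat_one"
  shows "mat_mult (mat_mult h' S) h = S"
proof -
  have "mat_mult (mat_mult h' S) h = mat_mult (mat_mult h' (mat_mult (mat_mult g' S) g)) h"
    by (simp add: g)
  also have "\<dots> = mat_mult (mat_mult (mat_mult h' g') S) (mat_mult g h)"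
    by (simp add: mat_mult_assoc lf locally_finite_mult)
  finally show ?thesis
    by (simp add: gh)
qed

lemma mat_transpose_one: "mat_transpose mat_one = mat_one"
  by (intro ext) (simp add: mat_transpose_def mat_one_commute)

lemma preserves_form_mult:
  assumes g: "g \<in> finite_mats (classical_alg X) I" "preserves_form X g"
    and h: "h \<in> finite_mats (classical_alg X) I" "preserves_form X h"
  shows "preserves_form X (mat_mult g h)"
proof -
  note lf = finite_mats_locally_finite[OF g(1)] finite_mats_locally_finite[OF h(1)]
  have herm: "preserves_hermitian S (mat_mult g h)"
    if "preserves_hermitian S g" "preserves_hermitian S h" "locally_finite S" for S
    using that unfolding preserves_hermitian_def mat_adjoint_mult[OF lf(1)]
    by (intro preserved_form_mult lf locally_finite_adjoint)
  have bil: "preserves_bilinear S (mat_mult g h)"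
    if "preserves_bilinear S g" "preserves_bilinear S h" "locally_finite S"
      "\<And>x. x \<in> scalars (classical_alg X) \<Longrightarrow> x \<in> scalars CC" for S
  proof -
    have "mat_transpose (mat_mult g h) = mat_mult (mat_transpose h) (mat_transpose g)"
      using that(4) finite_mats_scalars[OF g(1)] finite_mats_scalars[OF h(1)]
      by (intro mat_transpose_mult lf) blast+
    then show ?thesis
      using that unfolding preserves_bilinear_def
      by (simp only:) (intro preserved_form_mult lf locally_finite_transpose)
  qed
  show ?thesis
    using g(2) h(2)
    by (cases X) (auto intro!: herm bil locally_finite_signature locally_finite_symplectic
        locally_finite_skew locally_finite_one)
qed

lemma preserves_form_inverse:
  assumes g: "g \<in> finite_mats (classical_alg X) I" "preserves_form X g"
    and h: "h \<in> finite_mats (classical_alg X) I" and gh: "mat_mult g h = mat_one"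
  shows "preserves_form X h"
proof -
  note lf = finite_mats_locally_finite[OF g(1)] finite_mats_locally_finite[OF h(1)]
  have herm: "preserves_hermitian S h"
    if "preserves_hermitian S g" "locally_finite S" for S
  proof -
    have "mat_mult (mat_adjoint h) (mat_adjoint g) = mat_one"
      using arg_cong[OF gh, of mat_adjoint] by (simp add: mat_adjoint_mult lf)
    then show ?thesis
      using that gh unfolding preserves_hermitian_def
      by (intro preserved_form_inverse[of g h "mat_adjoint g"] lf locally_finite_adjoint)
  qed
  have bil: "preserves_bilinear S h"
    if "preserves_bilinear S g" "locally_finite S"
      "\<And>x. x \<in> scalars (classical_alg X) \<Longrightarrow> x \<in> scalars CC" for S
  proof -
    have "mat_transpose (mat_mult g h) = mat_mult (mat_transpose h) (mat_transpose g)"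
      using that(3) finite_mats_scalars[OF g(1)] finite_mats_scalars[OF h(1)]
      by (intro mat_transpose_mult lf) blast+
    then have "mat_mult (mat_transpose h) (mat_transpose g) = mat_one"
      by (simp add: gh mat_transpose_one)
    then show ?thesis
      using that gh unfolding preserves_bilinear_def
      by (intro preserved_form_inverse[of g h "mat_transpose g"] lf locally_finite_transpose)
  qed
  show ?thesis
    using g(2)
    by (cases X) (auto intro!: herm bil locally_finite_signature locally_finite_symplectic
        locally_finite_skew locally_finite_one)
qed

lemma group_classical: "group (irreducible_classical_group X B)"
proof -
  let ?I = "coord_set X B"
  show ?thesis
    unfolding irreducible_classical_group_def
  proof (rule group_mat_group[where F = "classical_alg X" and B = ?I])
    have one: "mat_one \<in> invertible_mats (classical_alg X) ?I"
      using one_finite_mats by (auto simp: invertible_mats_def intro!: bexI[of _ mat_one])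
    have "preserves_form X mat_one"
      by (cases X) (simp_all add: preserves_hermitian_def preserves_bilinear_def mat_transpose_one)
    then show "mat_one \<in> classical_mats X ?I"
      using one by (simp add: classical_mats_eq)
    show "mat_mult g h \<in> classical_mats X ?I" if "g \<in> classical_mats X ?I" "h \<in> classical_mats X ?I" for g h
      using that invertible_mats_mult preserves_form_mult invertible_matsD
      unfolding classical_mats_eq mem_Collect_eq by (metis (no_types))
    show "h \<in> classical_mats X ?I"
      if "g \<in> classical_mats X ?I" "h \<in> invertible_mats (classical_alg X) ?I" "mat_mult g h = mat_one" for g h
      using that preserves_form_inverse[of g X ?I h] invertible_matsD
      unfolding classical_mats_eq mem_Collect_eq by (metis (no_types))
  qed (auto simp: classical_mats_eq)
qed

lemma preserves_hermitian_commute: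
  assumes "g \<in> unitary_mats F B" "locally_finite S" "mat_mult S g = mat_mult g S"
  shows "preserves_hermitian S g"
proof -
  have lf: "locally_finite g" "locally_finite (mat_adjoint g)"
    using unitary_mats_locally_finite[OF assms(1)] locally_finite_adjoint by auto
  have "mat_mult (mat_mult (mat_adjoint g) S) g = mat_mult (mat_mult (mat_adjoint g) g) S"
    by (simp add: mat_mult_assoc lf assms(2,3))
  then show ?thesis
    using assms(1) by (simp add: preserves_hermitian_def unitary_mats_iff)
qed

text \<open>From \<open>S g = cnj(g) S\<close> one gets \<open>g\<^sup>T S g = g\<^sup>T cnj(g) S\<close>, and \<open>g\<^sup>T cnj(g)\<close> is the conjugate of
  \<open>g\<^sup>* g = 1\<close>.\<close>

lemma preserves_bilinear_conj:
  assumes g: "g \<in> unitary_mats F B" and sc: "\<And>a b. g a b \<in> scalars CC"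
    and S: "locally_finite S" "mat_mult S g = mat_mult (conj_mat g) S"
  shows "preserves_bilinear S g"
proof -
  have lf: "locally_finite g" "locally_finite (mat_adjoint g)" "locally_finite (mat_transpose g)"
    using unitary_mats_locally_finite[OF g] locally_finite_adjoint locally_finite_transpose by auto
  have "mat_mult (mat_transpose g) (conj_mat g) = conj_mat (mat_mult (mat_adjoint g) g)"
  proof -
    have "mat_transpose g = conj_mat (mat_adjoint g)"
      by (intro ext) (simp add: mat_adjoint_def mat_transpose_def)
    moreover have "mat_adjoint g a b \<in> scalars CC" for a b
      unfolding mat_adjoint_def by (rule scalars_closed(6)[OF sc])
    ultimately show ?thesis
      using conj_mat_mult[OF lf(2) _ sc] by simp
  qed
  also have "\<dots> = mat_one"
    using g by (simp add: unitary_mats_iff conj_mat_one)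
  finally have "mat_mult (mat_mult (mat_transpose g) (conj_mat g)) S = S" by simp
  then show ?thesis
    unfolding preserves_bilinear_def
    by (simp add: mat_mult_assoc lf S)
qed

lemma mat_mult_diagonal:
  assumes "\<And>a b. S a b = (if a = b then s a else 0)"
  shows "mat_mult S g a c = s a * g a c" "mat_mult g S a c = g a c * s c"
  using mat_mult_row[of "{a}" S a g c] mat_mult_col[of "{c}" S c g a] assms by simp_all

lemma signature_commute:
  assumes "\<And>a b. g a b \<noteq> 0 \<Longrightarrow> (\<exists>x. a = Vec 0 x) \<longleftrightarrow> (\<exists>x. b = Vec 0 x)"
  shows "mat_mult signature_form g = mat_mult g signature_form"
proof (intro ext)
  fix a c
  define s where "s a = (if \<exists>x. a = Vec 0 x then 1 else -1 :: quat)" for a :: "'a coord"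
  have "signature_form a b = (if a = b then s a else 0)" for a b :: "'a coord"
    by (cases a) (auto simp: s_def mat_one_def)
  from mat_mult_diagonal[of signature_form, OF this]
  show "mat_mult signature_form g a c = mat_mult g signature_form a c"
    using assms[of a c] by (cases "g a c = 0") (simp_all add: s_def)
qed

lemma symplectic_row:
  "mat_mult symplectic_form g (Vec 0 b) c = g (Vec 1 b) c"
  "mat_mult symplectic_form g (Vec 1 b) c = - g (Vec 0 b) c"
  "1 < t \<Longrightarrow> mat_mult symplectic_form g (Vec t b) c = 0"
  "mat_mult symplectic_form g (Neg n) c = 0"
proof -
  have "symplectic_form (Vec 0 b) x = 0" if "x \<notin> {Vec 1 b}" for x
    using that by (cases x) auto
  then show "mat_mult symplectic_form g (Vec 0 b) c = g (Vec 1 b) c"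
    using mat_mult_row[of "{Vec 1 b}" symplectic_form "Vec 0 b" g c] by simp
  have "symplectic_form (Vec 1 b) x = 0" if "x \<notin> {Vec 0 b}" for x
    using that by (cases x) auto
  then show "mat_mult symplectic_form g (Vec 1 b) c = - g (Vec 0 b) c"
    using mat_mult_row[of "{Vec 0 b}" symplectic_form "Vec 1 b" g c] by simp
  show "mat_mult symplectic_form g (Vec t b) c = 0" if "1 < t"
  proof -
    have "symplectic_form (Vec t b) x = 0" for x
      using that by (cases x) auto
    then show ?thesis
      using mat_mult_row[of "{}" symplectic_form "Vec t b" g c] by simp
  qed
  show "mat_mult symplectic_form g (Neg n) c = 0"
    using mat_mult_row[of "{}" symplectic_form "Neg n" g c] by simp
qed

lemma symplectic_col:
  "mat_mult g symplectic_form a (Vec 0 c) = - g a (Vec 1 c)"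
  "mat_mult g symplectic_form a (Vec 1 c) = g a (Vec 0 c)"
  "1 < t \<Longrightarrow> mat_mult g symplectic_form a (Vec t c) = 0"
  "mat_mult g symplectic_form a (Neg n) = 0"
proof -
  have "symplectic_form x (Vec 0 c) = 0" if "x \<notin> {Vec 1 c}" for x
    using that by (cases x) auto
  then show "mat_mult g symplectic_form a (Vec 0 c) = - g a (Vec 1 c)"
    using mat_mult_col[of "{Vec 1 c}" symplectic_form "Vec 0 c" g a] by simp
  have "symplectic_form x (Vec 1 c) = 0" if "x \<notin> {Vec 0 c}" for x
    using that by (cases x) auto
  then show "mat_mult g symplectic_form a (Vec 1 c) = g a (Vec 0 c)"
    using mat_mult_col[of "{Vec 0 c}" symplectic_form "Vec 1 c" g a] by simp
  show "mat_mult g symplectic_form a (Vec t c) = 0" if "1 < t"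
  proof -
    have "symplectic_form x (Vec t c) = 0" for x
      using that by (cases x) auto
    then show ?thesis
      using mat_mult_col[of "{}" symplectic_form "Vec t c" g a] by simp
  qed
  have "symplectic_form x (Neg n) = 0" for x :: "'a coord"
    by (cases x) auto
  then show "mat_mult g symplectic_form a (Neg n) = 0"
    using mat_mult_col[of "{}" symplectic_form "Neg n" g a] by simp
qed

lemma coord_trichotomy:
  obtains n where "a = Neg n" | b where "a = Vec 0 b" | b where "a = Vec 1 b"
  | t b where "a = Vec t b" "1 < (t::nat)"
proof (cases a)
  case (Vec t b)
  then show ?thesis
    using that by (cases "t = 0"; cases "t = 1") auto
qed (use that in auto)

text \<open>Left multiplications commute with the right multiplication by the second vector of the basis \<open>(1, \<i>)\<close> or
  \<open>(1, j)\<close>; in coordinates the latter is, up to sign, \<open>symplectic_form\<close> composed with conjugation.\<close>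

lemma symplectic_heavy:
  assumes "X = Sp_R \<and> A = CC \<and> B = RR \<or> X = Sp_C \<and> A = HH \<and> B = CC"
    and k: "\<And>a b. k 0 a b \<in> scalars A"
  shows "mat_mult symplectic_form (heavy_embedding X k) = mat_mult (conj_mat (heavy_embedding X k)) symplectic_form"
proof (intro ext)
  fix a c :: "'a coord"
  let ?e = "scalar_basis A B"
  have e: "length ?e = 2" "?e ! 0 = 1" "?e ! Suc 0 = (if A = CC then Quat 0 1 0 0 else Quat 0 0 1 0)"
    using assms(1) by auto
  have M: "heavy_embedding X k (Vec t b) (Vec u d) =
      (if t < 2 \<and> u < 2 then proj B (qcnj (?e ! t) * k 0 b d * ?e ! u) else mat_one (b, t) (d, u))" for t b u d
    using assms(1) e(1) by (auto simp: change_scalars_inside change_scalars_outside)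
  have qk: "A = CC \<Longrightarrow> qj (k 0 b d) = 0 \<and> qk (k 0 b d) = 0" for b d
    using k[of b d] by auto
  note defs = symplectic_row symplectic_row[unfolded One_nat_def] symplectic_col symplectic_col[unfolded One_nat_def]
  show "mat_mult symplectic_form (heavy_embedding X k) a c =
      mat_mult (conj_mat (heavy_embedding X k)) symplectic_form a c"
    by (rule coord_trichotomy[of a]; rule coord_trichotomy[of c])
      (use assms(1) in \<open>auto simp: defs M[unfolded One_nat_def] e mat_one_def quat_defs qk
        simp del: heavy_embedding.simps(1)\<close>)
qed

text \<open>Hermitian forms are preserved because they commute with the unitary matrices in question: the signature
  form is constant on the blocks, and \<open>skew_form\<close> is the scalar \<open>\<i>\<close>, which commutes with complex
  entries.\<close>

lemma heavy_preserves_form: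
  fixes k :: "nat \<Rightarrow> 'b qmat"
  assumes k: "\<And>t. t < heavy_count X \<Longrightarrow> k t \<in> unitary_mats (heavy_kind X) (B t)"
  shows "preserves_form X (heavy_embedding X k)"
proof -
  note u = heavy_embedding_unitary[of X k B, OF k]
  have sc: "heavy_embedding X k a b \<in> scalars (heavy_alg X)" for a b
    by (rule unitary_mats_scalars[OF u])
  have sig: "mat_mult signature_form (heavy_embedding X k) = mat_mult (heavy_embedding X k) signature_form"
    if "X \<noteq> Sp_R" "X \<noteq> Sp_C"
  proof (rule signature_commute)
    fix a b assume "heavy_embedding X k a b \<noteq> 0"
    then show "(\<exists>x. a = Vec 0 x) \<longleftrightarrow> (\<exists>x. b = Vec 0 x)"
      using that by (cases a; cases b; cases X) (auto simp: mat_one_def split: if_splits)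
  qed
  have symp: "preserves_bilinear symplectic_form (heavy_embedding X k)" if "X = Sp_R \<or> X = Sp_C"
  proof (rule preserves_bilinear_conj[OF u])
    show "heavy_embedding X k a b \<in> scalars CC" for a b
      using sc[of a b] that by auto
    show "mat_mult symplectic_form (heavy_embedding X k) = mat_mult (conj_mat (heavy_embedding X k)) symplectic_form"
      by (rule symplectic_heavy[where A = "heavy_kind X" and B = "heavy_alg X"])
        (use that unitary_mats_scalars[OF k[of 0]] in \<open>auto simp del: scalars.simps\<close>)
  qed (simp_all add: locally_finite_symplectic)
  have "preserves_bilinear mat_one (heavy_embedding X k)" if "X = O_C"
  proof (rule preserves_bilinear_conj[OF u])
    have "heavy_embedding X k a b \<in> scalars RR" for a b
      using sc[of a b] that by simp
    then show "heavy_embedding X k a b \<in> scalars CC" "mat_mult mat_one (heavy_embedding X k) = mat_mult (conj_mat (heavy_embedding X k)) mat_one" for a b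
      by (simp_all add: scalars_RR_qcnj scalars_RR_le del: scalars.simps)
  qed (simp_all add: locally_finite_one)
  moreover have "preserves_hermitian skew_form (heavy_embedding X k)" if "X = SO_star"
  proof (rule preserves_hermitian_commute[OF u])
    have "mat_mult skew_form (heavy_embedding X k) a c = mat_mult (heavy_embedding X k) skew_form a c" for a c
    proof -
      have "heavy_embedding X k a c \<in> scalars CC" "Quat 0 1 0 0 \<in> scalars CC"
        using sc[of a c] that by simp_all
      then have "heavy_embedding X k a c * Quat 0 1 0 0 = Quat 0 1 0 0 * heavy_embedding X k a c"
        by (rule scalars_CC_commute)
      then show ?thesis
        using mat_mult_diagonal[of "skew_form :: 'b coord qmat" "\<lambda>_. Quat 0 1 0 0"]
        by (simp add: skew_form_def)
    qed
    then show "mat_mult skew_form (heavy_embedding X k) = mat_mult (heavy_embedding X k) skew_form"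
      by (intro ext)
  qed (simp_all add: locally_finite_skew)
  moreover have "preserves_hermitian signature_form (heavy_embedding X k)" if "X \<noteq> Sp_R" "X \<noteq> Sp_C"
    by (rule preserves_hermitian_commute[OF u]) (simp_all add: locally_finite_signature sig that)
  ultimately show ?thesis
    using symp by (cases X) simp_all
qed

lemma heavy_embedding_classical:
  assumes k: "\<And>t. t < heavy_count X \<Longrightarrow> k t \<in> unitary_mats (heavy_kind X) (B t)"
  shows "heavy_embedding X k \<in> classical_mats X (coord_set X B)"
proof -
  note u = heavy_embedding_unitary[of X k B, OF k]
  have "heavy_embedding X k \<in> finite_mats (classical_alg X) (coord_set X B)"
    using u heavy_alg_le unfolding unitary_mats_iff finite_mats_iff by blast
  moreover have "mat_adjoint (heavy_embedding X k) \<in> finite_mats (classical_alg X) (coord_set X B)"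
    by (rule finite_mats_adjoint[OF calculation])
  ultimately have "heavy_embedding X k \<in> invertible_mats (classical_alg X) (coord_set X B)"
    using u unfolding unitary_mats_iff invertible_mats_def by blast
  then show ?thesis
    using heavy_preserves_form[of X k B, OF k] by (simp add: classical_mats_eq)
qed

section \<open>Permutation matrices\<close>

definition perm_mat :: "('a \<Rightarrow> 'a) \<Rightarrow> 'a qmat" where
  "perm_mat p a b = (if a = p b then 1 else 0)"

lemma mat_mult_perm_right: "mat_mult g (perm_mat p) a c = g a (p c)"
  by (subst mat_mult_col[of "{p c}"]) (simp_all add: perm_mat_def)

lemma mat_mult_perm_left:
  assumes "inj p"
  shows "mat_mult (perm_mat p) g (p a) c = g a c"
  by (subst mat_mult_row[of "{a}"]) (auto simp: perm_mat_def inj_eq[OF assms])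

lemma perm_mat_unitary:
  assumes "bij p" "finite {b. p b \<noteq> b}"
  shows "perm_mat p \<in> unitary_mats F UNIV"
proof -
  have inj: "inj p" and surj: "surj p"
    using assms(1) by (simp_all add: bij_def)
  have "supported_on {b. p b \<noteq> b} (perm_mat p)"
    unfolding supported_on_def perm_mat_def mat_one_def
    using inj_eq[OF inj] by auto
  then have fin: "perm_mat p \<in> finite_mats F UNIV"
    unfolding finite_mats_iff using assms(2)
    by (auto simp: perm_mat_def simp del: scalars.simps)
  have adj: "mat_adjoint (perm_mat p) = perm_mat (inv_into UNIV p)"
    by (intro ext) (auto simp: mat_adjoint_def perm_mat_def inv_f_f[OF inj] surj_f_inv_f[OF surj])
  have one: "perm_mat (\<lambda>x. x) = mat_one"
    by (intro ext) (simp add: perm_mat_def mat_one_def)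
  have "mat_mult (perm_mat q) (perm_mat r) = perm_mat (\<lambda>x. q (r x))" for q r :: "'a \<Rightarrow> 'a"
    by (intro ext) (simp add: mat_mult_perm_right, simp add: perm_mat_def)
  then show ?thesis
    using fin by (simp add: unitary_mats_iff adj one inv_f_f[OF inj] surj_f_inv_f[OF surj])
qed

text \<open>The permutation of the natural numbers that exchanges the adjacent intervals of lengths \<open>N\<close> and \<open>d\<close>
  starting at \<open>a\<close>; it shifts the first of them by \<open>d\<close>.\<close>

definition rot :: "nat \<Rightarrow> nat \<Rightarrow> nat \<Rightarrow> nat \<Rightarrow> nat" where
  "rot a N d k = (if k < a then k else if k < a + N then k + d else if k < a + N + d then k - N else k)"

lemma rot_rot: "rot a d N (rot a N d k) = k"
  by (auto simp: rot_def)

lemma bij_rot: "bij (rot a N d)"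
  by (rule o_bij[of "rot a d N"]) (simp_all add: fun_eq_iff rot_rot)

lemma finite_rot: "finite {k. rot a N d k \<noteq> k}"
  by (rule finite_subset[of _ "{..<a + N + d}"]) (auto simp: rot_def split: if_splits)

definition heavy_rot :: "division_alg list \<Rightarrow> (nat \<Rightarrow> nat) \<Rightarrow> nat \<Rightarrow> (nat \<Rightarrow> nat) \<Rightarrow> nat \<Rightarrow> nat qmat" where
  "heavy_rot Fs a N d = (\<lambda>m\<in>{..<length Fs}. perm_mat (rot (a m) N (d m)))"

lemma heavy_group_carrier:
  "carrier (heavy_group Fs) = (\<Pi>\<^sub>E j\<in>{..<length Fs}. unitary_mats (Fs ! j) UNIV)"
  by (simp add: heavy_group_def irreducible_heavy_group_def mat_group_def)

lemma heavy_rot_in_stabilizer: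
  assumes "\<And>m. \<alpha> m \<le> a m"
  shows "heavy_rot Fs a N d \<in> heavy_stabilizer Fs \<alpha>"
proof -
  have "rot (a j) N (d j) k = k" if "k < \<alpha> j" for j k
    using that assms[of j] by (simp add: rot_def)
  then show ?thesis
    unfolding heavy_stabilizer_def heavy_group_carrier
    by (auto simp: heavy_rot_def perm_mat_unitary bij_rot finite_rot perm_mat_def mat_one_def)
qed

section \<open>The groups of a pair\<close>

lemma group_heavy: "group (heavy_group Fs)"
  unfolding heavy_group_def irreducible_heavy_group_def
proof (rule product_group, rule group_mat_group)
  fix j
  let ?F = "Fs ! j"
  show "unitary_mats ?F UNIV \<subseteq> invertible_mats ?F (UNIV :: nat set)"
    by (auto simp: unitary_mats_def)
  show "mat_one \<in> unitary_mats ?F (UNIV :: nat set)"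
    using one_finite_mats by (simp add: unitary_mats_iff)
  fix g h :: "nat qmat" assume g: "g \<in> unitary_mats ?F UNIV"
  have lf: "locally_finite g" "locally_finite (mat_adjoint g)"
    using unitary_mats_locally_finite[OF g] locally_finite_adjoint by auto
  show "mat_mult g h \<in> unitary_mats ?F UNIV" if h: "h \<in> unitary_mats ?F UNIV"
  proof -
    have "locally_finite h" "locally_finite (mat_adjoint h)"
      using unitary_mats_locally_finite[OF h] locally_finite_adjoint by auto
    note lf = lf this
    have "mat_mult (mat_adjoint (mat_mult g h)) (mat_mult g h) =
        mat_mult (mat_adjoint h) (mat_mult (mat_mult (mat_adjoint g) g) h)"
      by (simp add: mat_adjoint_mult mat_mult_assoc lf locally_finite_mult)
    moreover have "mat_mult (mat_mult g h) (mat_adjoint (mat_mult g h)) =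
        mat_mult g (mat_mult (mat_mult h (mat_adjoint h)) (mat_adjoint g))"
      by (simp add: mat_adjoint_mult mat_mult_assoc lf locally_finite_mult)
    ultimately show ?thesis
      using g h by (simp add: unitary_mats_iff finite_mats_mult)
  qed
  show "h \<in> unitary_mats ?F UNIV"
    if "h \<in> invertible_mats ?F UNIV" "mat_mult g h = mat_one" "mat_mult h g = mat_one"
  proof -
    have h: "h \<in> finite_mats ?F UNIV"
      by (rule invertible_matsD[OF that(1)])
    have "h = mat_mult (mat_mult (mat_adjoint g) g) h"
      using g by (simp add: unitary_mats_iff)
    also have "\<dots> = mat_adjoint g"
      by (simp add: mat_mult_assoc lf finite_mats_locally_finite[OF h] that(2))
    finally have "h = mat_adjoint g" .
    then show ?thesis
      using g h by (simp add: unitary_mats_iff)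
  qed
qed

lemma heavy_stabilizer_subgroup: "subgroup (heavy_stabilizer Fs \<alpha>) (heavy_group Fs)"
proof -
  interpret group "heavy_group Fs" by (rule group_heavy)
  have one: "\<one>\<^bsub>heavy_group Fs\<^esub> j = mat_one" if "j < length Fs" for j
    using that by (simp add: heavy_group_def irreducible_heavy_group_def mat_group_def)
  show ?thesis
  proof
    show "heavy_stabilizer Fs \<alpha> \<subseteq> carrier (heavy_group Fs)"
      by (auto simp: heavy_stabilizer_def)
    show "\<one>\<^bsub>heavy_group Fs\<^esub> \<in> heavy_stabilizer Fs \<alpha>"
      by (simp add: heavy_stabilizer_def one)
    show "x \<otimes>\<^bsub>heavy_group Fs\<^esub> y \<in> heavy_stabilizer Fs \<alpha>"
      if "x \<in> heavy_stabilizer Fs \<alpha>" "y \<in> heavy_stabilizer Fs \<alpha>" for x y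
      using that by (auto simp: heavy_stabilizer_def heavy_mult mat_mult_col_one)
    show "inv\<^bsub>heavy_group Fs\<^esub> x \<in> heavy_stabilizer Fs \<alpha>" if x: "x \<in> heavy_stabilizer Fs \<alpha>" for x
    proof -
      let ?y = "inv\<^bsub>heavy_group Fs\<^esub> x"
      have xG: "x \<in> carrier (heavy_group Fs)"
        using x by (simp add: heavy_stabilizer_def)
      have "?y j a k = mat_one a k" if j: "j < length Fs" "k < \<alpha> j" for j a k
      proof -
        have "mat_mult (?y j) (x j) = mat_one"
          using l_inv[OF xG] heavy_mult[OF j(1), of ?y x] one[OF j(1)] by simp
        moreover have "mat_mult (?y j) (x j) a k = ?y j a k"
          by (rule mat_mult_col_one) (use x j in \<open>simp add: heavy_stabilizer_def\<close>)
        ultimately show ?thesis by simp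
      qed
      then show ?thesis
        using xG by (simp add: heavy_stabilizer_def)
    qed
  qed
qed

lemma supported_on_inverse:
  assumes g: "supported_on S g" and "mat_mult g h = mat_one" "mat_mult h g = mat_one"
  shows "supported_on S h"
  unfolding supported_on_def
proof (intro allI impI)
  fix a b assume ab: "a \<notin> S \<or> b \<notin> S"
  show "h a b = mat_one a b"
  proof (cases "a \<in> S")
    case False
    then have "mat_mult g h a b = h a b"
      by (intro mat_mult_row_one supported_onD(1)[OF g])
    then show ?thesis using assms(2) by simp
  next
    case True
    then have "mat_mult h g a b = h a b"
      using ab by (intro mat_mult_col_one supported_onD(2)[OF g]) simp
    then show ?thesis using assms(3) by simp
  qed
qed

text \<open>A unitary matrix that fixes a vector also fixes its orthogonal complement.\<close>

lemma unitary_row_trivial: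
  assumes g: "g \<in> unitary_mats F B" and col: "\<And>a. g a b = mat_one a b"
  shows "g b a = mat_one b a"
proof -
  have "mat_mult (mat_adjoint g) g a b = mat_adjoint g a b"
    by (rule mat_mult_col_one) (rule col)
  then have "qcnj (g b a) = mat_one a b"
    using g by (simp add: unitary_mats_iff mat_adjoint_def)
  then have "qcnj (qcnj (g b a)) = qcnj (mat_one a b)" by simp
  then show ?thesis by (simp add: mat_one_commute)
qed

lemma trivial_hom_col:
  assumes "\<And>a. g a b = mat_one a b"
  shows "trivial_hom c A B g (a, r) (b, s) = mat_one (a, r) (b, s)"
  using assms by (cases c) (simp_all add: change_scalars_one_entry)

lemma heavy_embedding_col:
  assumes "\<And>t a. k t a b = mat_one a b"
  shows "heavy_embedding X k a (Vec t b) = mat_one a (Vec t b)"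
proof (cases a)
  case (Vec u c)
  show ?thesis
  proof (cases "X = Sp_R \<or> X = Sp_C")
    case True
    then show ?thesis
      using change_scalars_one_entry[of "k 0" c b, OF assms] Vec by (auto simp: mat_one_def)
  next
    case False
    then have "heavy_embedding X k (Vec u c) (Vec t b) =
        (if u = t \<and> u < heavy_count X then k u c b else mat_one (Vec u c) (Vec t b))"
      by (cases X) simp_all
    then show ?thesis
      using assms Vec by (simp add: mat_one_def)
  qed
qed simp

lemma straight_hom_col_unit: "straight_hom Fs F s l a (Unit u) = mat_one a (Unit u)"
  by (cases a) simp_all

lemma straight_hom_col:
  assumes "j < length (blocks s) \<Longrightarrow> (\<And>a. l (fst (blocks s ! j)) a k = mat_one a k)"
  shows "straight_hom Fs F s l a (Copy j k r) = mat_one a (Copy j k r)"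
proof (cases a)
  case (Copy j' k' r')
  show ?thesis
  proof (cases "j' = j \<and> j < length (blocks s)")
    case True
    then have "straight_hom Fs F s l a (Copy j k r) =
        trivial_hom (snd (blocks s ! j)) (Fs ! fst (blocks s ! j)) F (l (fst (blocks s ! j))) (k', r') (k, r)"
      using Copy by (simp add: case_prod_beta)
    also have "\<dots> = mat_one (k', r') (k, r)"
      by (rule trivial_hom_col) (use assms True in simp)
    finally show ?thesis
      using Copy True by (simp add: mat_one_def)
  next
    case False
    then show ?thesis
      unfolding Copy straight_hom.simps(1) by (intro if_not_P) auto
  qed
qed simp

text \<open>Trivial homomorphisms send a permutation matrix to the permutation matrix that leaves the coordinates
  introduced by the restriction of scalars alone.\<close>

lemma straight_hom_rot:
  assumes s: "straight_data Fs F s" and y: "Copy j k r \<in> label_set Fs F s" and x: "x \<in> label_set Fs F s"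
    and "\<nexists>u. x = Unit u"
  shows "straight_hom Fs F s (heavy_rot Fs a N d) x (Copy j k r) =
    (if x = Copy j (rot (a (fst (blocks s ! j))) N (d (fst (blocks s ! j))) k) r then 1 else 0)"
proof -
  let ?m = "fst (blocks s ! j)"
  let ?A = "Fs ! ?m"
  obtain j' k' r' where x': "x = Copy j' k' r'"
    using assms(4) by (cases x) auto
  have j: "j < length (blocks s)" and r: "r < length (scalar_basis ?A F)"
    using y by (auto simp: label_set_def)
  show ?thesis
  proof (cases "j' = j")
    case True
    have r': "r' < length (scalar_basis ?A F)"
      using x unfolding x' True by (auto simp: label_set_def)
    have l: "heavy_rot Fs a N d ?m = perm_mat (rot (a ?m) N (d ?m))"
      using straight_blockD(1)[OF s j] by (simp add: heavy_rot_def)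
    have conj: "conj_mat (perm_mat p) = perm_mat p" for p :: "nat \<Rightarrow> nat"
      by (intro ext) (simp add: perm_mat_def)
    have "straight_hom Fs F s (heavy_rot Fs a N d) x (Copy j k r) =
        trivial_hom (snd (blocks s ! j)) ?A F (perm_mat (rot (a ?m) N (d ?m))) (k', r') (k, r)"
      unfolding x' True l[symmetric] using j by (simp add: case_prod_beta)
    also have "\<dots> = change_scalars ?A F (perm_mat (rot (a ?m) N (d ?m))) (k', r') (k, r)"
      by (cases "snd (blocks s ! j)") (simp_all add: conj)
    also have "\<dots> = (if k' = rot (a ?m) N (d ?m) k \<and> r' = r then 1 else 0)"
      using r r' by (simp add: change_scalars_inside perm_mat_def scalar_basis_orthonormal)
    finally show ?thesis
      unfolding x' True by auto
  next
    case False
    then show ?thesis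
      by (simp add: x' mat_one_def)
  qed
qed

text \<open>The number of halves \<open>Vec t\<close> of the space of the classical group.\<close>

fun width :: "classical_type \<Rightarrow> nat" where
  "width (U_inf_inf F) = 2"
| "width Sp_R = 2"
| "width Sp_C = 2"
| "width X = 1"

lemma Vec_in_coord_set: "Vec t b \<in> coord_set X B \<longleftrightarrow> t < width X \<and> b \<in> B (heavy_slot X t)"
  by (cases X) auto

lemma heavy_slot_less: "t < width X \<Longrightarrow> heavy_slot X t < heavy_count X"
  by (cases X) auto

locale gl_pair =
  fixes P :: gl_pair
  assumes pair: "is_gl_pair P"
begin

abbreviation G :: "gelem monoid" where "G \<equiv> pair_G P"
abbreviation n :: nat where "n \<equiv> length (factors P)"
abbreviation X :: "nat \<Rightarrow> classical_type" where "X i \<equiv> factors P ! i"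
abbreviation labels :: "nat \<Rightarrow> nat \<Rightarrow> label set" where
  "labels i t \<equiv> label_set (heavy P) (heavy_kind (X i)) (emb P i t)"
abbreviation coords :: "nat \<Rightarrow> label coord set" where "coords i \<equiv> coord_set (X i) (labels i)"

lemma straight: "i < n \<Longrightarrow> t < heavy_count (X i) \<Longrightarrow> straight_data (heavy P) (heavy_kind (X i)) (emb P i t)"
  using pair by (simp add: is_gl_pair_def)

lemma group_G: "group G"
  unfolding pair_G_def by (rule product_group) (rule group_classical)

lemma carrier_G: "carrier G = (\<Pi>\<^sub>E i\<in>{..<n}. classical_mats (X i) (coords i))"
  by (simp add: pair_G_def irreducible_classical_group_def mat_group_def)

lemma mult_G: "g \<otimes>\<^bsub>G\<^esub> h = (\<lambda>i\<in>{..<n}. mat_mult (g i) (h i))"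
  by (simp add: pair_G_def irreducible_classical_group_def mat_group_def)

lemma one_G: "\<one>\<^bsub>G\<^esub> = (\<lambda>i\<in>{..<n}. mat_one)"
  by (simp add: pair_G_def irreducible_classical_group_def mat_group_def)

lemma G_finite: "g \<in> carrier G \<Longrightarrow> i < n \<Longrightarrow> g i \<in> finite_mats (classical_alg (X i)) (coords i)"
  unfolding carrier_G classical_mats_eq by (auto simp: PiE_iff intro: invertible_matsD)

lemma embedding_apply: "i < n \<Longrightarrow> pair_embedding P l i =
    heavy_embedding (X i) (\<lambda>t. straight_hom (heavy P) (heavy_kind (X i)) (emb P i t) l)"
  by (simp add: pair_embedding_def)

lemma embedding_unitary:
  assumes "l \<in> carrier (pair_L P)" "i < n"
  shows "pair_embedding P l i \<in> unitary_mats (heavy_alg (X i)) (coords i)"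
  unfolding embedding_apply[OF assms(2)]
  by (rule heavy_embedding_unitary) (rule straight_hom_unitary[OF straight[OF assms(2)] assms(1)])

lemma embedding_hom: "pair_embedding P \<in> hom (pair_L P) G"
proof (rule homI)
  show "pair_embedding P l \<in> carrier G" if l: "l \<in> carrier (pair_L P)" for l
  proof -
    have "heavy_embedding (X i) (\<lambda>t. straight_hom (heavy P) (heavy_kind (X i)) (emb P i t) l)
        \<in> classical_mats (X i) (coords i)" if "i < n" for i
      by (rule heavy_embedding_classical) (rule straight_hom_unitary[OF straight[OF that] l])
    then show ?thesis
      unfolding carrier_G by (auto simp: pair_embedding_def)
  qed
  show "pair_embedding P (l \<otimes>\<^bsub>pair_L P\<^esub> l') = pair_embedding P l \<otimes>\<^bsub>G\<^esub> pair_embedding P l'"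
    if l: "l \<in> carrier (pair_L P)" "l' \<in> carrier (pair_L P)" for l l'
  proof -
    have "heavy_embedding (X i) (\<lambda>t. straight_hom (heavy P) (heavy_kind (X i)) (emb P i t) (l \<otimes>\<^bsub>pair_L P\<^esub> l')) =
        mat_mult (pair_embedding P l i) (pair_embedding P l' i)" if i: "i < n" for i
    proof -
      let ?k = "\<lambda>l t. straight_hom (heavy P) (heavy_kind (X i)) (emb P i t) l"
      have u: "?k l t \<in> unitary_mats (heavy_kind (X i)) (labels i t)" "?k l' t \<in> unitary_mats (heavy_kind (X i)) (labels i t)"
        if "t < heavy_count (X i)" for t
        by (rule straight_hom_unitary[OF straight[OF i that]], fact l)+
      have eq: "?k (l \<otimes>\<^bsub>pair_L P\<^esub> l') t = mat_mult (?k l t) (?k l' t)" if "t < heavy_count (X i)" for t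
        by (rule straight_hom_mult[OF straight[OF i that] l])
      have cong: "heavy_embedding (X i) k = heavy_embedding (X i) k'"
        if "\<And>t. t < heavy_count (X i) \<Longrightarrow> k t = k' t" for k k' :: "nat \<Rightarrow> label qmat"
      proof (intro ext)
        fix a b
        show "heavy_embedding (X i) k a b = heavy_embedding (X i) k' a b"
          using that by (cases a; cases b) (auto split: classical_type.split)
      qed
      have "heavy_embedding (X i) (?k (l \<otimes>\<^bsub>pair_L P\<^esub> l')) = heavy_embedding (X i) (\<lambda>t. mat_mult (?k l t) (?k l' t))"
        by (rule cong) (rule eq)
      also have "\<dots> = mat_mult (heavy_embedding (X i) (?k l)) (heavy_embedding (X i) (?k l'))"
        by (rule heavy_embedding_mult) (fact u)+
      finally show ?thesis
        by (simp add: embedding_apply[OF i])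
    qed
    then show ?thesis
      unfolding mult_G by (simp add: pair_embedding_def cong: restrict_cong)
  qed
qed

lemma L_alpha_subgroup: "subgroup (L_alpha P \<alpha>) G"
proof -
  interpret group_hom "pair_L P" G "pair_embedding P"
    using group_heavy group_G embedding_hom by (simp add: group_hom_def group_hom_axioms_def)
  show ?thesis
    unfolding L_alpha_def by (rule subgroup_img_is_subgroup[OF heavy_stabilizer_subgroup])
qed

lemma embedding_carrier: "l \<in> carrier (pair_L P) \<Longrightarrow> pair_embedding P l \<in> carrier G"
  using embedding_hom by (rule hom_in_carrier)

lemma stabilizer_carrier: "l \<in> heavy_stabilizer (heavy P) \<alpha> \<Longrightarrow> l \<in> carrier (pair_L P)"
  by (simp add: heavy_stabilizer_def)

lemma L_alpha_antimono:
  assumes "\<And>j. j < length (heavy P) \<Longrightarrow> \<alpha> j \<le> \<beta> j"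
  shows "L_alpha P \<beta> \<subseteq> L_alpha P \<alpha>"
proof -
  have "heavy_stabilizer (heavy P) \<beta> \<subseteq> heavy_stabilizer (heavy P) \<alpha>"
    unfolding heavy_stabilizer_def
  proof (intro subsetI CollectI conjI allI impI, simp_all, elim conjE)
    fix x j k a
    assume "\<forall>j<length (heavy P). \<forall>k<\<beta> j. \<forall>a. x j a k = mat_one a k" "j < length (heavy P)" "k < \<alpha> j"
    then show "x j a k = mat_one a k"
      using order_less_le_trans[OF _ assms, of k j] by simp
  qed
  then show ?thesis
    unfolding L_alpha_def by (rule image_mono)
qed

lemma G_alpha_carrier:
  "carrier (G_alpha P \<alpha>) = {g \<in> carrier G. \<forall>i<n. supported_on (- fixed_coords P \<alpha> i) (g i)}"
  unfolding G_alpha_def supported_on_def by auto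

lemma G_alpha_eq: "G_alpha P \<alpha> = G\<lparr>carrier := carrier (G_alpha P \<alpha>)\<rparr>"
  unfolding G_alpha_def by simp

lemma G_alpha_subgroup: "subgroup (carrier (G_alpha P \<alpha>)) G"
proof -
  interpret group G by (rule group_G)
  show ?thesis
  proof
    show "carrier (G_alpha P \<alpha>) \<subseteq> carrier G"
      by (auto simp: G_alpha_carrier)
    show "\<one>\<^bsub>G\<^esub> \<in> carrier (G_alpha P \<alpha>)"
      using one_closed unfolding G_alpha_carrier by (simp add: one_G supported_on_one)
    show "x \<otimes>\<^bsub>G\<^esub> y \<in> carrier (G_alpha P \<alpha>)"
      if "x \<in> carrier (G_alpha P \<alpha>)" "y \<in> carrier (G_alpha P \<alpha>)" for x y
    proof -
      have "x \<otimes>\<^bsub>G\<^esub> y \<in> carrier G"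
        using that by (simp add: G_alpha_carrier)
      then show ?thesis
        using that unfolding G_alpha_carrier by (simp add: mult_G supported_on_mult)
    qed
    show "inv\<^bsub>G\<^esub> x \<in> carrier (G_alpha P \<alpha>)" if x: "x \<in> carrier (G_alpha P \<alpha>)" for x
    proof -
      have xG: "x \<in> carrier G"
        using x by (simp add: G_alpha_carrier)
      have "supported_on (- fixed_coords P \<alpha> i) ((inv\<^bsub>G\<^esub> x) i)" if i: "i < n" for i
      proof (rule supported_on_inverse)
        show "supported_on (- fixed_coords P \<alpha> i) (x i)"
          using x i by (simp add: G_alpha_carrier)
        show "mat_mult (x i) ((inv\<^bsub>G\<^esub> x) i) = mat_one" "mat_mult ((inv\<^bsub>G\<^esub> x) i) (x i) = mat_one"
          using fun_cong[OF r_inv[OF xG], of i] fun_cong[OF l_inv[OF xG], of i] i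
          by (simp_all add: mult_G one_G)
      qed
      then show ?thesis
        using xG by (simp add: G_alpha_carrier)
    qed
  qed
qed

lemma L_alpha_le_G_alpha: "L_alpha P \<alpha> \<subseteq> carrier (G_alpha P \<alpha>)"
proof
  fix l assume l: "l \<in> L_alpha P \<alpha>"
  then obtain k where k: "k \<in> carrier (pair_L P)" "l = pair_embedding P k"
    using stabilizer_carrier unfolding L_alpha_def by auto
  have "supported_on (- fixed_coords P \<alpha> i) (l i)" if i: "i < n" for i
  proof -
    have col: "l i a b = mat_one a b" if "b \<in> fixed_coords P \<alpha> i" for a b
      using that l by (simp add: fixed_coords_def)
    have "l i b a = mat_one b a" if "b \<in> fixed_coords P \<alpha> i" for a b
    proof (rule unitary_row_trivial)
      show "l i \<in> unitary_mats (heavy_alg (X i)) (coords i)"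
        using embedding_unitary[OF k(1) i] k(2) by simp
    qed (rule col[OF that])
    then show ?thesis
      using col unfolding supported_on_def by auto
  qed
  then show "l \<in> carrier (G_alpha P \<alpha>)"
    using embedding_carrier[OF k(1)] k(2) by (simp add: G_alpha_carrier)
qed

end

section \<open>Pure pairs\<close>

text \<open>Restricted to a set of basis vectors fixed by \<open>L\<close>, \<open>-1\<close> is a nontrivial element of the centralizer.\<close>

definition sign_mat :: "'a set \<Rightarrow> 'a qmat" where
  "sign_mat S a b = (if a = b then (if a \<in> S then -1 else 1) else 0)"

lemma sign_mat_mult:
  "mat_mult (sign_mat S) g a c = (if a \<in> S then - g a c else g a c)"
  "mat_mult g (sign_mat S) a c = (if c \<in> S then - g a c else g a c)"
  using mat_mult_diagonal[of "sign_mat S" "\<lambda>a. if a \<in> S then -1 else 1" g a c]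
  by (simp_all add: sign_mat_def)

lemma sign_mat_classical:
  fixes S :: "'b coord set"
  assumes S: "finite S" "S \<subseteq> I"
    and swap: "X = Sp_R \<or> X = Sp_C \<Longrightarrow> (\<And>b. Vec 0 b \<in> S \<longleftrightarrow> Vec 1 b \<in> S)"
  shows "sign_mat S \<in> classical_mats X I"
proof -
  have "supported_on S (sign_mat S)"
    by (auto simp: supported_on_def sign_mat_def mat_one_def)
  then have fin: "sign_mat S \<in> finite_mats (classical_alg X) I"
    unfolding finite_mats_iff using S
    by (intro conjI allI exI[of _ S]) (simp_all add: sign_mat_def del: scalars.simps)
  have "mat_mult (sign_mat S) (sign_mat S) = mat_one"
    by (intro ext) (simp add: sign_mat_mult, simp add: sign_mat_def mat_one_def)
  then have inv: "sign_mat S \<in> invertible_mats (classical_alg X) I"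
    using fin by (auto simp: invertible_mats_def)
  have adj: "mat_adjoint (sign_mat S) = sign_mat S" "mat_transpose (sign_mat S) = sign_mat S"
    by (intro ext, simp add: mat_adjoint_def mat_transpose_def sign_mat_def qcnj_minus)+
  have pres: "mat_mult (mat_mult (sign_mat S) F) (sign_mat S) = F"
    if "\<And>a b. F a b \<noteq> 0 \<Longrightarrow> a \<in> S \<longleftrightarrow> b \<in> S" for F
  proof (intro ext)
    fix a b
    show "mat_mult (mat_mult (sign_mat S) F) (sign_mat S) a b = F a b"
      using that[of a b] by (cases "F a b = 0") (auto simp: sign_mat_mult)
  qed
  have sig: "mat_mult (mat_mult (sign_mat S) signature_form) (sign_mat S) = signature_form"
  proof (rule pres)
    fix a b :: "'b coord" assume "signature_form a b \<noteq> 0"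
    then have "a = b" by (cases a) (auto simp: mat_one_def split: if_splits)
    then show "a \<in> S \<longleftrightarrow> b \<in> S" by simp
  qed
  have skew: "mat_mult (mat_mult (sign_mat S) skew_form) (sign_mat S) = skew_form"
    by (rule pres) (auto simp: skew_form_def split: if_splits)
  have one: "mat_mult (mat_mult (sign_mat S) mat_one) (sign_mat S) = mat_one"
    by (rule pres) (auto simp: mat_one_def split: if_splits)
  have symp: "mat_mult (mat_mult (sign_mat S) symplectic_form) (sign_mat S) = symplectic_form"
    if X: "X = Sp_R \<or> X = Sp_C"
  proof (rule pres)
    fix a b :: "'b coord" assume nz: "symplectic_form a b \<noteq> 0"
    then have "\<exists>c. a = Vec 0 c \<and> b = Vec 1 c \<or> a = Vec 1 c \<and> b = Vec 0 c"
      by (cases a; cases b) (auto split: if_splits)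
    then show "a \<in> S \<longleftrightarrow> b \<in> S"
      using swap[OF X] by auto
  qed
  have "preserves_form X (sign_mat S)"
    by (cases X) (simp_all add: preserves_hermitian_def preserves_bilinear_def adj sig skew one symp
        del: mat_mult_one_right mat_mult_one_left)
  then show ?thesis
    using inv by (simp add: classical_mats_eq)
qed

locale pure_gl_pair = gl_pair +
  assumes pure: "is_pure P"
begin

text \<open>Otherwise \<open>sign_mat S\<close> in the \<open>i\<close>-th component would centralize \<open>L\<close>. The condition for the symplectic
  groups says that \<open>S\<close> spans a symplectic subspace.\<close>

lemma no_fixed_block:
  assumes i: "i < n" and S: "finite S" "S \<subseteq> coords i" "b \<in> S"
    and swap: "X i = Sp_R \<or> X i = Sp_C \<Longrightarrow> (\<And>b. Vec 0 b \<in> S \<longleftrightarrow> Vec 1 b \<in> S)"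
    and triv: "\<And>l a b. l \<in> carrier (pair_L P) \<Longrightarrow> b \<in> S \<Longrightarrow> pair_embedding P l i a b = mat_one a b"
  shows False
proof -
  interpret group G by (rule group_G)
  define g where "g = (\<lambda>i'\<in>{..<n}. if i' = i then sign_mat S else mat_one)"
  have "sign_mat S \<in> classical_mats (X i) (coords i)"
    by (rule sign_mat_classical[OF S(1,2)]) (rule swap)
  moreover have "mat_one \<in> classical_mats (X i') (coords i')" if "i' < n" for i'
    using one_closed that unfolding carrier_G one_G by (auto simp: PiE_iff)
  ultimately have g: "g \<in> carrier G"
    unfolding carrier_G g_def by auto
  have comm: "g \<otimes>\<^bsub>G\<^esub> pair_embedding P l = pair_embedding P l \<otimes>\<^bsub>G\<^esub> g" if l: "l \<in> carrier (pair_L P)" for l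
  proof -
    have "mat_mult (sign_mat S) (pair_embedding P l i) = mat_mult (pair_embedding P l i) (sign_mat S)"
    proof (intro ext)
      fix a c
      have row: "pair_embedding P l i a' c' = mat_one a' c'" if "a' \<in> S" for a' c'
      proof (rule unitary_row_trivial)
        show "pair_embedding P l i \<in> unitary_mats (heavy_alg (X i)) (coords i)"
          by (rule embedding_unitary[OF l i])
      qed (rule triv[OF l that])
      show "mat_mult (sign_mat S) (pair_embedding P l i) a c = mat_mult (pair_embedding P l i) (sign_mat S) a c"
        unfolding sign_mat_mult using row[of a c] triv[OF l, of c a]
        by (auto simp: mat_one_def)
    qed
    then show ?thesis
      unfolding mult_G by (intro restrict_ext) (simp add: g_def)
  qed
  have "g \<in> {g \<in> carrier G. \<forall>l\<in>carrier (pair_L P). g \<otimes>\<^bsub>G\<^esub> pair_embedding P l = pair_embedding P l \<otimes>\<^bsub>G\<^esub> g}"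
    using g comm by simp
  then have "g = \<one>\<^bsub>G\<^esub>"
    using pure unfolding is_pure_def by simp
  then have "g i b b = \<one>\<^bsub>G\<^esub> i b b" by simp
  then have "(-1 :: quat) = 1"
    using i S(3) by (simp add: g_def one_G sign_mat_def mat_one_def)
  then show False
    by (simp add: quat_defs)
qed

abbreviation slot :: "nat \<Rightarrow> nat \<Rightarrow> straight" where "slot i t \<equiv> emb P i (heavy_slot (X i) t)"
abbreviation seg :: "nat \<Rightarrow> nat \<Rightarrow> nat \<Rightarrow> nat" where "seg i t j \<equiv> fst (blocks (slot i t) ! j)"

text \<open>Purity excludes unit blocks and the finite part of \<open>U(p,\<infinity>)\<close>: their basis vectors are fixed by \<open>L\<close>. A
  vector of a unit block is taken together with its symplectic partner.\<close>

lemma coord_cases: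
  assumes i: "i < n" and b: "b \<in> coords i"
  obtains t j k r where "b = Vec t (Copy j k r)"
proof (cases b)
  case (Neg m)
  have False
  proof (rule no_fixed_block[OF i, of "{b}" b])
    show "{b} \<subseteq> coords i" using b by simp
  qed (simp_all add: Neg embedding_apply[OF i])
  then show ?thesis ..
next
  case (Vec t c)
  show ?thesis
  proof (cases c)
    case (Unit u)
    let ?S = "{Vec t' (Unit u) | t'. t' < width (X i) \<and> heavy_slot (X i) t' = heavy_slot (X i) t}"
    have bS: "t < width (X i)" "Unit u \<in> labels i (heavy_slot (X i) t)"
      using b unfolding Vec Unit Vec_in_coord_set by simp_all
    have False
    proof (rule no_fixed_block[OF i, of ?S b])
      have "?S \<subseteq> (\<lambda>t'. Vec t' (Unit u)) ` {..<width (X i)}" by auto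
      then show "finite ?S" by (rule finite_subset) simp
      show "?S \<subseteq> coords i"
        using bS(2) by (auto simp: Vec_in_coord_set)
      show "b \<in> ?S"
        using bS(1) Vec Unit by simp
      show "Vec 0 c \<in> ?S \<longleftrightarrow> Vec 1 c \<in> ?S" if "X i = Sp_R \<or> X i = Sp_C" for c
        using that by auto
      show "pair_embedding P l i a c = mat_one a c" if c: "c \<in> ?S" for l a c
      proof -
        obtain t' where "c = Vec t' (Unit u)" using c by auto
        then show ?thesis
          unfolding embedding_apply[OF i]
          by (simp only:) (rule heavy_embedding_col, rule straight_hom_col_unit)
      qed
    qed
    then show ?thesis ..
  next
    case (Copy j k r)
    then show ?thesis using that Vec by simp
  qed
qed

lemma copy_in_coords:
  "Vec t (Copy j k r) \<in> coords i \<longleftrightarrow> t < width (X i) \<and> j < length (blocks (slot i t)) \<and>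
    r < length (scalar_basis (heavy P ! seg i t j) (heavy_kind (X i)))"
  unfolding Vec_in_coord_set by (auto simp: label_set_def)

lemma straight_slot: "i < n \<Longrightarrow> t < width (X i) \<Longrightarrow> straight_data (heavy P) (heavy_kind (X i)) (slot i t)"
  by (rule straight) (auto intro: heavy_slot_less)

lemma seg_less: "i < n \<Longrightarrow> Vec t (Copy j k r) \<in> coords i \<Longrightarrow> seg i t j < length (heavy P)"
  using straight_blockD(1)[OF straight_slot] unfolding copy_in_coords by auto

subsection \<open>Relabelling the basis vectors\<close>

text \<open>The map of basis vectors induced by maps \<open>f m\<close> of the basis of the \<open>\<ell>\<^sub>2\<close> of the \<open>m\<close>-th factor of
  the heavy group.\<close>

fun move :: "nat \<Rightarrow> (nat \<Rightarrow> nat \<Rightarrow> nat) \<Rightarrow> label coord \<Rightarrow> label coord" where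
  "move i f (Vec t (Copy j k r)) = Vec t (Copy j (f (seg i t j) k) r)"
| "move i f (Vec t (Unit u)) = Vec t (Unit u)"
| "move i f (Neg m) = Neg m"

definition move_coords :: "nat \<Rightarrow> (nat \<Rightarrow> nat \<Rightarrow> nat) \<Rightarrow> label coord \<Rightarrow> label coord" where
  "move_coords i f b = (if b \<in> coords i then move i f b else b)"

lemma move_comp: "move i f (move i g b) = move i (\<lambda>m k. f m (g m k)) b"
proof (cases b)
  case (Vec t c)
  then show ?thesis by (cases c) simp_all
qed simp

lemma move_ident: "move i (\<lambda>m k. k) b = b"
proof (cases b)
  case (Vec t c)
  then show ?thesis by (cases c) simp_all
qed simp

lemma move_in_coords: "move i f b \<in> coords i \<longleftrightarrow> b \<in> coords i"
proof (cases b)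
  case (Vec t c)
  then show ?thesis
    by (cases c) (simp_all only: move.simps copy_in_coords)
qed simp

lemma move_coords_in: "move_coords i f b \<in> coords i \<longleftrightarrow> b \<in> coords i"
  by (simp add: move_coords_def move_in_coords)

lemma bij_move_coords:
  assumes "\<And>m k. f' m (f m k) = k" "\<And>m k. f m (f' m k) = k"
  shows "bij (move_coords i f)"
  by (rule o_bij[of "move_coords i f'"])
    (simp_all add: fun_eq_iff move_coords_def move_in_coords move_comp assms move_ident)

lemma shift_coord_move: "shift_coord P \<alpha> i = move i (\<lambda>m k. k + \<alpha> m)"
proof
  fix b
  show "shift_coord P \<alpha> i b = move i (\<lambda>m k. k + \<alpha> m) b"
  proof (cases b)
    case (Vec t c)
    then show ?thesis by (cases c) simp_all
  qed simp
qed

lemma inj_shift_coord: "inj (shift_coord P \<alpha> i)"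
proof (rule inj_on_inverseI)
  show "move i (\<lambda>m k. k - \<alpha> m) (shift_coord P \<alpha> i b) = b" for b
    by (simp add: shift_coord_move move_comp move_ident)
qed

abbreviation rotation :: "(nat \<Rightarrow> nat) \<Rightarrow> nat \<Rightarrow> (nat \<Rightarrow> nat) \<Rightarrow> gelem" where
  "rotation a N d \<equiv> pair_embedding P (heavy_rot (heavy P) a N d)"

abbreviation rot_coords :: "nat \<Rightarrow> (nat \<Rightarrow> nat) \<Rightarrow> nat \<Rightarrow> (nat \<Rightarrow> nat) \<Rightarrow> label coord \<Rightarrow> label coord" where
  "rot_coords i a N d \<equiv> move_coords i (\<lambda>m. rot (a m) N (d m))"

lemma bij_rot_coords: "bij (rot_coords i a N d)"
  by (rule bij_move_coords[of "\<lambda>m. rot (a m) (d m) N"]) (rule rot_rot)+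

lemmas rot_coords_eq = inj_eq[OF bij_is_inj[OF bij_rot_coords]]

lemma rotation_in_L_alpha: "(\<And>m. \<alpha> m \<le> a m) \<Longrightarrow> rotation a N d \<in> L_alpha P \<alpha>"
  unfolding L_alpha_def by (intro imageI heavy_rot_in_stabilizer)

lemma rotation_carrier: "rotation a N d \<in> carrier G"
  by (rule subgroup.mem_carrier[OF L_alpha_subgroup rotation_in_L_alpha[of a a]]) simp

lemma rotation_eq:
  assumes i: "i < n"
  shows "rotation a N d i = perm_mat (rot_coords i a N d)"
proof (intro ext)
  fix x y
  let ?l = "heavy_rot (heavy P) a N d"
  let ?k = "\<lambda>t. straight_hom (heavy P) (heavy_kind (X i)) (emb P i t) ?l"
  have l: "?l \<in> carrier (pair_L P)"
    by (rule stabilizer_carrier[OF heavy_rot_in_stabilizer[of a a]]) simp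
  have sup: "supported_on (coords i) (rotation a N d i)"
    using embedding_unitary[OF l i] by (auto simp: unitary_mats_iff intro: finite_mats_supported)
  show "rotation a N d i x y = perm_mat (rot_coords i a N d) x y"
  proof (cases "x \<in> coords i \<and> y \<in> coords i")
    case False
    then have "rotation a N d i x y = mat_one x y"
      using supported_onD[OF sup] by auto
    moreover have "x = rot_coords i a N d y \<longleftrightarrow> x = y"
      using False move_coords_in[of i "\<lambda>m. rot (a m) N (d m)" y] by (auto simp: move_coords_def)
    ultimately show ?thesis
      by (simp add: perm_mat_def mat_one_def)
  next
    case True
    obtain t j k r where y: "y = Vec t (Copy j k r)"
      by (rule coord_cases[OF i conjunct2[OF True]])
    obtain t' j' k' r' where x: "x = Vec t' (Copy j' k' r')"
      by (rule coord_cases[OF i conjunct1[OF True]])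
    have t: "t < width (X i)" "Copy j k r \<in> labels i (heavy_slot (X i) t)"
      and t': "t' < width (X i)" "Copy j' k' r' \<in> labels i (heavy_slot (X i) t')"
      using True unfolding x y Vec_in_coord_set by simp_all
    let ?z = "Copy j (rot (a (seg i t j)) N (d (seg i t j)) k) r"
    have entry: "?k (heavy_slot (X i) t) (Copy j' k' r') (Copy j k r) =
        (if Copy j' k' r' = ?z then 1 else 0)" if "heavy_slot (X i) t' = heavy_slot (X i) t"
      using that t t' by (intro straight_hom_rot[OF straight_slot[OF i t(1)]]) simp_all
    have "rotation a N d i x y = heavy_embedding (X i) ?k x y"
      by (simp add: embedding_apply[OF i])
    also have "\<dots> = (if t' = t \<and> Copy j' k' r' = ?z then 1 else 0)"
    proof (cases "X i = Sp_R \<or> X i = Sp_C")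
      case True
      define A where "A = heavy_kind (X i)"
      define B where "B = heavy_alg (X i)"
      have AB: "length (scalar_basis A B) = 2" "width (X i) = 2"
        using True by (auto simp: A_def B_def)
      have slots: "heavy_slot (X i) t = 0" "heavy_slot (X i) t' = 0"
        using True by auto
      have e: "?k 0 (Copy j' k' r') (Copy j k r) = (if Copy j' k' r' = ?z then 1 else 0)"
        using entry by (simp only: slots)
      have "heavy_embedding (X i) ?k x y = change_scalars A B (?k 0) (Copy j' k' r', t') (Copy j k r, t)"
        unfolding x y A_def B_def using True by auto
      also have "\<dots> = proj B (qcnj (scalar_basis A B ! t') * ?k 0 (Copy j' k' r') (Copy j k r) * scalar_basis A B ! t)"
        using t t' AB by (simp add: change_scalars_inside)
      also have "\<dots> = (if t' = t \<and> Copy j' k' r' = ?z then 1 else 0)"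
      proof -
        have "proj B (qcnj (scalar_basis A B ! t') * scalar_basis A B ! t) = (if t' = t then 1 else 0)"
          by (rule scalar_basis_orthonormal) (use t(1) t'(1) AB in simp_all)
        then show ?thesis
          unfolding e by (cases "t' = t"; cases "Copy j' k' r' = ?z") (simp_all del: label.inject)
      qed
      finally show ?thesis .
    next
      case False
      then have "heavy_embedding (X i) ?k x y =
          (if t' = t \<and> t' < heavy_count (X i) then ?k t' (Copy j' k' r') (Copy j k r) else mat_one x y)"
        unfolding x y by (cases "X i") simp_all
      moreover have slots: "heavy_slot (X i) t = t" "t < heavy_count (X i)"
        using False t(1) by (cases "X i"; simp)+
      moreover have "?k t (Copy j' k' r') (Copy j k r) = (if Copy j' k' r' = ?z then 1 else 0)" if "t' = t"
        using entry that by (simp only: slots)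
      ultimately show ?thesis
        by (cases "t' = t") (simp_all add: x y mat_one_def del: straight_hom.simps)
    qed
    also have "\<dots> = perm_mat (rot_coords i a N d) x y"
      using True unfolding perm_mat_def move_coords_def x y by auto
    finally show ?thesis .
  qed
qed

abbreviation conjugate :: "gelem \<Rightarrow> gelem \<Rightarrow> gelem" where
  "conjugate \<theta> g \<equiv> \<theta> \<otimes>\<^bsub>G\<^esub> g \<otimes>\<^bsub>G\<^esub> inv\<^bsub>G\<^esub> \<theta>"

lemma conjugate_rotation:
  assumes g: "g \<in> carrier G" and i: "i < n"
  shows "conjugate (rotation a N d) g i (rot_coords i a N d x) (rot_coords i a N d y) = g i x y"
proof -
  interpret group G by (rule group_G)
  let ?\<theta> = "rotation a N d"
  let ?h = "conjugate ?\<theta> g"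
  have "?h \<otimes>\<^bsub>G\<^esub> ?\<theta> = ?\<theta> \<otimes>\<^bsub>G\<^esub> g"
    using g rotation_carrier by (simp add: m_assoc)
  then have "(?h \<otimes>\<^bsub>G\<^esub> ?\<theta>) i = (?\<theta> \<otimes>\<^bsub>G\<^esub> g) i" by simp
  then have "mat_mult (?h i) (perm_mat (rot_coords i a N d)) = mat_mult (perm_mat (rot_coords i a N d)) (g i)"
    unfolding mult_G using i by (simp add: rotation_eq)
  then have "mat_mult (?h i) (perm_mat (rot_coords i a N d)) (rot_coords i a N d x) y =
      mat_mult (perm_mat (rot_coords i a N d)) (g i) (rot_coords i a N d x) y" by simp
  then show ?thesis
    by (simp only: mat_mult_perm_right mat_mult_perm_left[OF bij_is_inj[OF bij_rot_coords]])
qed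

text \<open>The first \<open>N\<close> basis vectors not fixed by \<open>L\<^sup>\<alpha>\<close> in every copy of every \<open>\<ell>\<^sub>2\<close>.\<close>

definition window :: "nat \<Rightarrow> (nat \<Rightarrow> nat) \<Rightarrow> nat \<Rightarrow> label coord set" where
  "window i \<alpha> N = {Vec t (Copy j k r) | t j k r. Vec t (Copy j k r) \<in> coords i \<and>
     \<alpha> (seg i t j) \<le> k \<and> k < \<alpha> (seg i t j) + N}"

lemma window_mono: "N \<le> N' \<Longrightarrow> window i \<alpha> N \<subseteq> window i \<alpha> N'"
  unfolding window_def by auto

lemma window_coords: "window i \<alpha> N \<subseteq> coords i"
  unfolding window_def by auto

lemma ex_window:
  assumes g: "g \<in> carrier G"
  shows "\<exists>N. \<forall>N'\<ge>N. \<forall>i<n. supported_on (window i (\<lambda>_. 0) N') (g i)"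
proof -
  have "\<exists>N. supported_on (window i (\<lambda>_. 0) N) (g i)" if i: "i < n" for i
  proof -
    obtain S where S: "S \<subseteq> coords i" "finite S" "supported_on S (g i)"
      using G_finite[OF g i] by (auto simp: finite_mats_iff)
    define idx where "idx b = (case b of Vec t (Copy j k r) \<Rightarrow> k | _ \<Rightarrow> 0)" for b
    obtain N where N: "\<And>b. b \<in> S \<Longrightarrow> idx b < N"
      using finite_nat_set_iff_bounded[of "idx ` S"] S(2) by auto
    have "S \<subseteq> window i (\<lambda>_. 0) N"
    proof
      fix b assume b: "b \<in> S"
      then obtain t j k r where eq: "b = Vec t (Copy j k r)"
        by (rule coord_cases[OF i subsetD[OF S(1)]])
      then show "b \<in> window i (\<lambda>_. 0) N"
        using N[OF b] S(1) b unfolding window_def idx_def by auto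
    qed
    then show ?thesis
      using supported_on_mono[OF S(3)] by blast
  qed
  then obtain N where N: "\<And>i. i < n \<Longrightarrow> supported_on (window i (\<lambda>_. 0) (N i)) (g i)"
    by metis
  obtain N0 where N0: "\<And>i. i < n \<Longrightarrow> N i < N0"
    using finite_nat_set_iff_bounded[of "N ` {..<n}"] by auto
  show ?thesis
  proof (intro exI allI impI)
    fix N' i assume "N0 \<le> N'" "i < n"
    then show "supported_on (window i (\<lambda>_. 0) N') (g i)"
      using N0[of i] by (intro supported_on_mono[OF N window_mono]) simp_all
  qed
qed

lemma fixed_below:
  assumes i: "i < n" and "k < \<alpha> (seg i t j)" and b: "Vec t (Copy j k r) \<in> coords i"
  shows "Vec t (Copy j k r) \<in> fixed_coords P \<alpha> i"
proof -
  have m: "seg i t j < length (heavy P)"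
    by (rule seg_less[OF i b])
  have "pair_embedding P l i a (Vec t (Copy j k r)) = mat_one a (Vec t (Copy j k r))"
    if l: "l \<in> heavy_stabilizer (heavy P) \<alpha>" for l a
  proof (cases "t < width (X i)")
    case True
    have lk: "l (seg i t j) a k = mat_one a k" for a
      using l m assms(2) by (simp add: heavy_stabilizer_def)
    have col: "straight_hom (heavy P) (heavy_kind (X i)) (slot i t) l a (Copy j k r) = mat_one a (Copy j k r)" for a
      by (rule straight_hom_col) (rule lk)
    let ?k = "\<lambda>u. straight_hom (heavy P) (heavy_kind (X i)) (emb P i u) l"
    let ?k' = "\<lambda>u. ?k (heavy_slot (X i) t)"
    have eq: "heavy_embedding (X i) ?k a (Vec t (Copy j k r)) = heavy_embedding (X i) ?k' a (Vec t (Copy j k r))"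
    proof (cases a)
      case (Vec u c)
      then show ?thesis
        using True by (cases "X i") auto
    qed simp
    have "heavy_embedding (X i) ?k' a (Vec t (Copy j k r)) = mat_one a (Vec t (Copy j k r))"
      by (rule heavy_embedding_col) (rule col)
    then show ?thesis
      unfolding embedding_apply[OF i] eq .
  qed (use b copy_in_coords in simp)
  then show ?thesis
    unfolding fixed_coords_def L_alpha_def by auto
qed

text \<open>The transposition of the \<open>k\<close>-th and the \<open>(k + 1)\<close>-st basis vector lies in \<open>L\<^sup>\<alpha>\<close> and moves the given
  vector.\<close>

lemma not_fixed_above:
  assumes i: "i < n" and k: "\<alpha> (seg i t j) \<le> k" and b: "Vec t (Copy j k r) \<in> coords i"
  shows "Vec t (Copy j k r) \<notin> fixed_coords P \<alpha> i"
proof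
  let ?b = "Vec t (Copy j k r)"
  let ?a = "\<lambda>m. if m = seg i t j then k else \<alpha> m"
  let ?d = "\<lambda>_. 1 :: nat"
  assume "?b \<in> fixed_coords P \<alpha> i"
  moreover have "rotation ?a 1 ?d \<in> L_alpha P \<alpha>"
    by (rule rotation_in_L_alpha) (use k in simp)
  ultimately have "rotation ?a 1 ?d i ?b ?b = mat_one ?b ?b"
    unfolding fixed_coords_def by simp
  then show False
    using b by (simp add: rotation_eq[OF i] perm_mat_def mat_one_def move_coords_def rot_def split: if_splits)
qed

text \<open>By \<open>coord_cases\<close>, every basis vector on which \<open>G\<close> acts comes from a factor of \<open>L\<close>, and it is fixed by
  \<open>L\<^sup>\<alpha>\<close> exactly if its index is below \<open>\<alpha>\<close>.\<close>

lemma G_alpha_iff: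
  "h \<in> carrier (G_alpha P \<alpha>) \<longleftrightarrow>
    h \<in> carrier G \<and> (\<exists>N. \<forall>N'\<ge>N. \<forall>i<n. supported_on (window i \<alpha> N') (h i))"
proof (intro iffI conjI)
  assume h: "h \<in> carrier (G_alpha P \<alpha>)"
  then show hG: "h \<in> carrier G"
    by (simp add: G_alpha_carrier)
  obtain N where N: "\<And>N' i. N' \<ge> N \<Longrightarrow> i < n \<Longrightarrow> supported_on (window i (\<lambda>_. 0) N') (h i)"
    using ex_window[OF hG] by auto
  have "supported_on (window i \<alpha> N') (h i)" if N': "N' \<ge> N" and i: "i < n" for N' i
    unfolding supported_on_def
  proof (intro allI impI)
    fix a b assume ab: "a \<notin> window i \<alpha> N' \<or> b \<notin> window i \<alpha> N'"
    have fixed: "c \<in> fixed_coords P \<alpha> i" if "c \<in> window i (\<lambda>_. 0) N'" "c \<notin> window i \<alpha> N'" for c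
    proof -
      obtain t j k r where c: "c = Vec t (Copy j k r)" "c \<in> coords i" "k < N'"
        using \<open>c \<in> window i (\<lambda>_. 0) N'\<close> unfolding window_def by auto
      then have "k < \<alpha> (seg i t j)"
        using \<open>c \<notin> window i \<alpha> N'\<close> unfolding window_def by fastforce
      then show ?thesis
        using fixed_below[OF i] c(2) unfolding c(1) by simp
    qed
    have sup: "supported_on (- fixed_coords P \<alpha> i) (h i)"
      using h i by (simp add: G_alpha_carrier)
    show "h i a b = mat_one a b"
    proof (cases "a \<in> window i (\<lambda>_. 0) N' \<and> b \<in> window i (\<lambda>_. 0) N'")
      case True
      then show ?thesis
        using ab fixed supported_onD[OF sup] by auto
    next
      case False
      then show ?thesis
        using supported_onD[OF N[OF N' i]] by auto
    qed
  qed
  then show "\<exists>N. \<forall>N'\<ge>N. \<forall>i<n. supported_on (window i \<alpha> N') (h i)" by blast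
next
  assume h: "h \<in> carrier G \<and> (\<exists>N. \<forall>N'\<ge>N. \<forall>i<n. supported_on (window i \<alpha> N') (h i))"
  then obtain N where N: "\<And>i. i < n \<Longrightarrow> supported_on (window i \<alpha> N) (h i)" by auto
  have "supported_on (- fixed_coords P \<alpha> i) (h i)" if i: "i < n" for i
  proof (rule supported_on_mono[OF N[OF i]])
    show "window i \<alpha> N \<subseteq> - fixed_coords P \<alpha> i"
      using not_fixed_above[OF i] unfolding window_def by auto
  qed
  then show "h \<in> carrier (G_alpha P \<alpha>)"
    using h by (simp add: G_alpha_carrier)
qed

subsection \<open>The shift\<close>

lemma shift_apply:
  "i < n \<Longrightarrow> shift_iso P \<alpha> g i = (\<lambda>a b. if a \<in> range (shift_coord P \<alpha> i) \<and> b \<in> range (shift_coord P \<alpha> i)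
     then g i (inv_into UNIV (shift_coord P \<alpha> i) a) (inv_into UNIV (shift_coord P \<alpha> i) b) else mat_one a b)"
  by (simp add: shift_iso_def Let_def)

text \<open>The shift is not surjective on the basis vectors, but on the finite support of \<open>g\<close> it agrees with a
  permutation. Outside the support both sides are the identity matrix.\<close>

lemma shift_eqI:
  assumes h: "h \<in> carrier G"
    and g: "\<And>i. i < n \<Longrightarrow> supported_on (S i) (g i)"
    and bij: "\<And>i. i < n \<Longrightarrow> bij (\<sigma> i)"
    and agree: "\<And>i a. i < n \<Longrightarrow> a \<in> S i \<Longrightarrow> \<sigma> i a = shift_coord P \<alpha> i a"
    and conj: "\<And>i a b. i < n \<Longrightarrow> h i (\<sigma> i a) (\<sigma> i b) = g i a b"
  shows "shift_iso P \<alpha> g = h"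
proof
  fix i
  show "shift_iso P \<alpha> g i = h i"
  proof (cases "i < n")
    case False
    then have "h i = undefined"
      using h unfolding carrier_G by (auto simp: PiE_iff extensional_def)
    then show ?thesis
      using False by (simp add: shift_iso_def)
  next
    case i: True
    let ?s = "shift_coord P \<alpha> i" and ?\<sigma> = "\<sigma> i"
    have \<sigma>_eq: "?\<sigma> a = ?\<sigma> b \<longleftrightarrow> a = b" for a b
      using inj_eq[OF bij_is_inj[OF bij[OF i]]] .
    have s_eq: "?s a = ?s b \<longleftrightarrow> a = b" for a b
      using inj_eq[OF inj_shift_coord] .
    have outside: "a' \<notin> S i" if "?\<sigma> a = ?s a'" "a \<notin> S i" for a a'
    proof
      assume "a' \<in> S i"
      then have "?\<sigma> a = ?\<sigma> a'"
        using that(1) agree[OF i] by simp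
      then have "a = a'"
        unfolding \<sigma>_eq .
      then show False
        using \<open>a' \<in> S i\<close> that(2) by simp
    qed
    have "shift_iso P \<alpha> g i (?\<sigma> a) (?\<sigma> b) = g i a b" for a b
    proof (cases "a \<in> S i \<and> b \<in> S i")
      case True
      then have "?\<sigma> a = ?s a" "?\<sigma> b = ?s b"
        using agree[OF i] by simp_all
      then show ?thesis
        by (simp add: shift_apply[OF i] inv_f_f[OF inj_shift_coord])
    next
      case False
      then have g_ab: "g i a b = mat_one a b"
        using supported_onD[OF g[OF i]] by auto
      show ?thesis
      proof (cases "?\<sigma> a \<in> range ?s \<and> ?\<sigma> b \<in> range ?s")
        case True
        then obtain a' b' where ab': "?\<sigma> a = ?s a'" "?\<sigma> b = ?s b'" by auto
        have "shift_iso P \<alpha> g i (?\<sigma> a) (?\<sigma> b) = g i a' b'"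
          unfolding ab' by (simp add: shift_apply[OF i] inv_f_f[OF inj_shift_coord])
        also have "\<dots> = mat_one a' b'"
          using False outside[OF ab'(1)] outside[OF ab'(2)] supported_onD[OF g[OF i]] by auto
        also have "\<dots> = mat_one (?\<sigma> a) (?\<sigma> b)"
          unfolding ab' mat_one_def s_eq ..
        also have "\<dots> = g i a b"
          unfolding g_ab mat_one_def \<sigma>_eq ..
        finally show ?thesis .
      next
        case False
        have "shift_iso P \<alpha> g i (?\<sigma> a) (?\<sigma> b) = mat_one (?\<sigma> a) (?\<sigma> b)"
          unfolding shift_apply[OF i] by (rule if_not_P[OF False])
        then show ?thesis
          unfolding g_ab mat_one_def \<sigma>_eq .
      qed
    qed
    then have eq: "shift_iso P \<alpha> g i (?\<sigma> a) (?\<sigma> b) = h i (?\<sigma> a) (?\<sigma> b)" for a b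
      using conj[OF i] by simp
    show ?thesis
    proof (intro ext)
      fix x y
      obtain a b where "x = ?\<sigma> a" "y = ?\<sigma> b"
        using bij[OF i] by (metis bij_pointE)
      then show "shift_iso P \<alpha> g i x y = h i x y"
        using eq by simp
    qed
  qed
qed

lemma conjugate_carrier: "\<theta> \<in> carrier G \<Longrightarrow> g \<in> carrier G \<Longrightarrow> conjugate \<theta> g \<in> carrier G"
proof -
  interpret group G by (rule group_G)
  show "\<theta> \<in> carrier G \<Longrightarrow> g \<in> carrier G \<Longrightarrow> conjugate \<theta> g \<in> carrier G" by simp
qed

text \<open>On a given element of the group the shift acts like the inner automorphism of a permutation matrix from \<open>L\<close>.\<close>

lemma shift_eq_conjugate:
  assumes g: "g \<in> carrier G" and N: "\<forall>i<n. supported_on (window i (\<lambda>_. 0) N) (g i)"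
  shows "shift_iso P \<alpha> g = conjugate (rotation (\<lambda>_. 0) N \<alpha>) g"
proof (rule shift_eqI[where \<sigma> = "\<lambda>i. rot_coords i (\<lambda>_. 0) N \<alpha>" and S = "\<lambda>i. window i (\<lambda>_. 0) N"])
  show "rot_coords i (\<lambda>_. 0) N \<alpha> a = shift_coord P \<alpha> i a" if "a \<in> window i (\<lambda>_. 0) N" for i a
    using that unfolding window_def by (auto simp: move_coords_def shift_coord_move rot_def)
qed (simp_all add: conjugate_carrier rotation_carrier g N bij_rot_coords conjugate_rotation)

text \<open>The permutation that carries the window above \<open>\<alpha>\<close> to that above \<open>\<beta>\<close> can be chosen to fix the vectors below
  \<open>\<alpha>\<close>.\<close>

lemma shift_shift:
  assumes g: "g \<in> carrier G" and le: "\<And>j. j < length (heavy P) \<Longrightarrow> \<alpha> j \<le> \<beta> j"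
  shows "\<exists>\<theta>\<in>L_alpha P \<alpha>. shift_iso P \<beta> g = conjugate \<theta> (shift_iso P \<alpha> g)"
proof -
  obtain N where N: "\<forall>i<n. supported_on (window i (\<lambda>_. 0) N) (g i)"
    using ex_window[OF g] by auto
  let ?\<theta> = "rotation (\<lambda>_. 0) N \<alpha>" and ?\<theta>' = "rotation \<alpha> N (\<lambda>m. \<beta> m - \<alpha> m)"
  let ?\<sigma> = "\<lambda>i. rot_coords i (\<lambda>_. 0) N \<alpha>" and ?\<sigma>' = "\<lambda>i. rot_coords i \<alpha> N (\<lambda>m. \<beta> m - \<alpha> m)"
  have \<theta>': "?\<theta>' \<in> L_alpha P \<alpha>"
    by (rule rotation_in_L_alpha) simp
  have "shift_iso P \<beta> g = conjugate ?\<theta>' (conjugate ?\<theta> g)"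
  proof (rule shift_eqI[where \<sigma> = "\<lambda>i a. ?\<sigma>' i (?\<sigma> i a)" and S = "\<lambda>i. window i (\<lambda>_. 0) N"])
    show "bij (\<lambda>a. ?\<sigma>' i (?\<sigma> i a))" for i
      using bij_comp[OF bij_rot_coords bij_rot_coords] by (simp add: o_def)
    show "?\<sigma>' i (?\<sigma> i a) = shift_coord P \<beta> i a" if i: "i < n" and a: "a \<in> window i (\<lambda>_. 0) N" for i a
    proof -
      obtain t j k r where a': "a = Vec t (Copy j k r)" "a \<in> coords i" "k < N"
        using a unfolding window_def by auto
      have "\<alpha> (seg i t j) \<le> \<beta> (seg i t j)"
        using le seg_less[OF i] a'(2) unfolding a'(1) by simp
      then show ?thesis
        using a' move_in_coords[of i "\<lambda>m. rot 0 N (\<alpha> m)" a]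
        by (simp add: move_coords_def shift_coord_move rot_def)
    qed
    show "conjugate ?\<theta>' (conjugate ?\<theta> g) i (?\<sigma>' i (?\<sigma> i a)) (?\<sigma>' i (?\<sigma> i b)) = g i a b" if "i < n" for i a b
      using that g by (simp add: conjugate_rotation conjugate_carrier rotation_carrier)
  qed (simp_all add: conjugate_carrier rotation_carrier g N)
  then show ?thesis
    using \<theta>' shift_eq_conjugate[OF g N] by auto
qed

lemma shift_carrier:
  assumes g: "g \<in> carrier G"
  shows "shift_iso P \<alpha> g \<in> carrier G"
proof -
  obtain N where N: "\<forall>i<n. supported_on (window i (\<lambda>_. 0) N) (g i)"
    using ex_window[OF g] by auto
  show ?thesis
    unfolding shift_eq_conjugate[OF g N] by (rule conjugate_carrier[OF rotation_carrier g])
qed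

lemma rot_coords_window:
  assumes "i < n"
  shows "rot_coords i (\<lambda>_. 0) N \<alpha> a \<in> window i \<alpha> N \<longleftrightarrow> a \<in> window i (\<lambda>_. 0) N"
proof (cases "a \<in> coords i")
  case True
  then obtain t j k r where a: "a = Vec t (Copy j k r)"
    by (rule coord_cases[OF assms])
  have "Vec t (Copy j k' r) \<in> coords i" for k'
    using True unfolding a copy_in_coords .
  then show ?thesis
    using True by (auto simp: a move_coords_def window_def rot_def)
next
  case False
  then show ?thesis
    using window_coords[of i \<alpha> N] window_coords[of i "\<lambda>_. 0" N] move_coords_in by auto
qed

lemma shift_G_alpha:
  assumes g: "g \<in> carrier G"
  shows "shift_iso P \<alpha> g \<in> carrier (G_alpha P \<alpha>)"
proof -
  obtain N where N: "\<And>N'. N' \<ge> N \<Longrightarrow> \<forall>i<n. supported_on (window i (\<lambda>_. 0) N') (g i)"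
    using ex_window[OF g] by auto
  have "supported_on (window i \<alpha> N') (shift_iso P \<alpha> g i)" if N': "N' \<ge> N" and i: "i < n" for N' i
    unfolding supported_on_def
  proof (intro allI impI)
    let ?\<sigma> = "rot_coords i (\<lambda>_. 0) N' \<alpha>"
    fix x y assume xy: "x \<notin> window i \<alpha> N' \<or> y \<notin> window i \<alpha> N'"
    obtain a where a: "x = ?\<sigma> a"
      by (rule surjE[OF bij_is_surj[OF bij_rot_coords]])
    obtain b where b: "y = ?\<sigma> b"
      by (rule surjE[OF bij_is_surj[OF bij_rot_coords]])
    note ab = a b
    have "shift_iso P \<alpha> g i x y = g i a b"
      unfolding ab shift_eq_conjugate[OF g N[OF N']] by (rule conjugate_rotation[OF g i])
    also have "\<dots> = mat_one a b"
      using xy supported_onD[OF N[OF N', rule_format, OF i]] unfolding ab rot_coords_window[OF i] by auto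
    also have "\<dots> = mat_one x y"
      unfolding ab mat_one_def rot_coords_eq ..
    finally show "shift_iso P \<alpha> g i x y = mat_one x y" .
  qed
  then show ?thesis
    unfolding G_alpha_iff using shift_carrier[OF g] by (intro conjI exI[of _ N] allI impI)
qed

lemma shift_surj:
  assumes h: "h \<in> carrier (G_alpha P \<alpha>)"
  shows "\<exists>g\<in>carrier G. shift_iso P \<alpha> g = h"
proof -
  interpret group G by (rule group_G)
  obtain N where hG: "h \<in> carrier G" and N: "\<And>i. i < n \<Longrightarrow> supported_on (window i \<alpha> N) (h i)"
    using h unfolding G_alpha_iff by auto
  let ?\<theta> = "rotation (\<lambda>_. 0) N \<alpha>"
  let ?g = "inv\<^bsub>G\<^esub> ?\<theta> \<otimes>\<^bsub>G\<^esub> h \<otimes>\<^bsub>G\<^esub> ?\<theta>"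
  have g: "?g \<in> carrier G"
    using hG rotation_carrier by simp
  have h_eq: "conjugate ?\<theta> ?g = h"
    using hG rotation_carrier[of "\<lambda>_. 0" N \<alpha>] by (simp add: m_assoc) (simp flip: m_assoc)
  have "supported_on (window i (\<lambda>_. 0) N) (?g i)" if i: "i < n" for i
    unfolding supported_on_def
  proof (intro allI impI)
    let ?\<sigma> = "rot_coords i (\<lambda>_. 0) N \<alpha>"
    fix a b assume ab: "a \<notin> window i (\<lambda>_. 0) N \<or> b \<notin> window i (\<lambda>_. 0) N"
    have "?g i a b = h i (?\<sigma> a) (?\<sigma> b)"
      using conjugate_rotation[OF g i, of "\<lambda>_. 0" N \<alpha> a b] unfolding h_eq by simp
    also have "\<dots> = mat_one (?\<sigma> a) (?\<sigma> b)"
      using ab supported_onD[OF N[OF i]] unfolding rot_coords_window[OF i, symmetric, of _ N \<alpha>] by auto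
    also have "\<dots> = mat_one a b"
      unfolding mat_one_def rot_coords_eq ..
    finally show "?g i a b = mat_one a b" .
  qed
  then have "shift_iso P \<alpha> ?g = h"
    using shift_eq_conjugate[OF g, of N \<alpha>] h_eq by simp
  then show ?thesis
    using g by blast
qed

lemma shift_mult:
  assumes g: "g \<in> carrier G" and h: "h \<in> carrier G"
  shows "shift_iso P \<alpha> (g \<otimes>\<^bsub>G\<^esub> h) = shift_iso P \<alpha> g \<otimes>\<^bsub>G\<^esub> shift_iso P \<alpha> h"
proof -
  interpret group G by (rule group_G)
  obtain N1 where N1: "\<And>N' i. N' \<ge> N1 \<Longrightarrow> i < n \<Longrightarrow> supported_on (window i (\<lambda>_. 0) N') (g i)"
    using ex_window[OF g] by auto
  obtain N2 where N2: "\<And>N' i. N' \<ge> N2 \<Longrightarrow> i < n \<Longrightarrow> supported_on (window i (\<lambda>_. 0) N') (h i)"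
    using ex_window[OF h] by auto
  let ?N = "max N1 N2"
  let ?\<theta> = "rotation (\<lambda>_. 0) ?N \<alpha>"
  have sup: "\<forall>i<n. supported_on (window i (\<lambda>_. 0) ?N) (g i)" "\<forall>i<n. supported_on (window i (\<lambda>_. 0) ?N) (h i)"
    using N1[of ?N] N2[of ?N] by simp_all
  then have "\<forall>i<n. supported_on (window i (\<lambda>_. 0) ?N) ((g \<otimes>\<^bsub>G\<^esub> h) i)"
    unfolding mult_G by (simp add: supported_on_mult)
  then have "shift_iso P \<alpha> (g \<otimes>\<^bsub>G\<^esub> h) = conjugate ?\<theta> (g \<otimes>\<^bsub>G\<^esub> h)"
    by (intro shift_eq_conjugate m_closed g h)
  also have "\<dots> = conjugate ?\<theta> g \<otimes>\<^bsub>G\<^esub> conjugate ?\<theta> h"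
  proof -
    have \<theta>: "?\<theta> \<in> carrier G" by (rule rotation_carrier)
    have "inv\<^bsub>G\<^esub> ?\<theta> \<otimes>\<^bsub>G\<^esub> (?\<theta> \<otimes>\<^bsub>G\<^esub> x) = x" if "x \<in> carrier G" for x
      using that \<theta> by (simp flip: m_assoc)
    then show ?thesis
      using g h \<theta> by (simp add: m_assoc)
  qed
  also have "\<dots> = shift_iso P \<alpha> g \<otimes>\<^bsub>G\<^esub> shift_iso P \<alpha> h"
    using shift_eq_conjugate[OF g sup(1)] shift_eq_conjugate[OF h sup(2)] by simp
  finally show ?thesis .
qed

text \<open>The rotation exchanges the first \<open>N\<close> vectors above \<open>\<alpha>\<close>, which carry \<open>h\<close>, with the next \<open>N\<close> ones, which lie
  outside the support of \<open>g\<close>, provided that \<open>N\<close> is large.\<close>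

lemma eventually_far:
  assumes h: "h \<in> carrier (G_alpha P \<alpha>)" and g: "g \<in> carrier G"
  shows "\<forall>\<^sub>F N in sequentially.
    g \<otimes>\<^bsub>G\<^esub> conjugate (rotation \<alpha> N (\<lambda>_. N)) h = conjugate (rotation \<alpha> N (\<lambda>_. N)) h \<otimes>\<^bsub>G\<^esub> g"
proof -
  obtain N1 where hG: "h \<in> carrier G" and N1: "\<And>N' i. N' \<ge> N1 \<Longrightarrow> i < n \<Longrightarrow> supported_on (window i \<alpha> N') (h i)"
    using h unfolding G_alpha_iff by auto
  obtain N2 where N2: "\<And>N' i. N' \<ge> N2 \<Longrightarrow> i < n \<Longrightarrow> supported_on (window i (\<lambda>_. 0) N') (g i)"
    using ex_window[OF g] by auto
  have "g \<otimes>\<^bsub>G\<^esub> conjugate (rotation \<alpha> N (\<lambda>_. N)) h = conjugate (rotation \<alpha> N (\<lambda>_. N)) h \<otimes>\<^bsub>G\<^esub> g"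
    if N: "N \<ge> max N1 N2" for N
  proof -
    let ?h = "conjugate (rotation \<alpha> N (\<lambda>_. N)) h"
    have "mat_mult (g i) (?h i) = mat_mult (?h i) (g i)" if i: "i < n" for i
    proof (rule mat_mult_commute_disjoint)
      let ?\<sigma> = "rot_coords i \<alpha> N (\<lambda>_. N)"
      let ?T = "window i (\<lambda>m. \<alpha> m + N) N"
      show "supported_on (window i (\<lambda>_. 0) N) (g i)"
        using N2[OF _ i] N by simp
      show "window i (\<lambda>_. 0) N \<inter> ?T = {}"
        unfolding window_def by auto
      have in_T: "?\<sigma> a \<in> ?T" if w: "a \<in> window i \<alpha> N" for a
      proof -
        obtain t j k r where a: "a = Vec t (Copy j k r)" "a \<in> coords i"
          "\<alpha> (seg i t j) \<le> k" "k < \<alpha> (seg i t j) + N"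
          using w unfolding window_def by auto
        have "Vec t (Copy j (k + N) r) \<in> coords i"
          using a(2) unfolding a(1) copy_in_coords .
        moreover have "?\<sigma> a = Vec t (Copy j (k + N) r)"
          using a by (simp add: move_coords_def rot_def)
        ultimately show ?thesis
          using a unfolding window_def by auto
      qed
      show "supported_on ?T (?h i)"
        unfolding supported_on_def
      proof (intro allI impI)
        fix x y assume xy: "x \<notin> ?T \<or> y \<notin> ?T"
        obtain a where a: "x = ?\<sigma> a"
          by (rule surjE[OF bij_is_surj[OF bij_rot_coords]])
        obtain b where b: "y = ?\<sigma> b"
          by (rule surjE[OF bij_is_surj[OF bij_rot_coords]])
        note ab = a b
        have out: "a \<notin> window i \<alpha> N \<or> b \<notin> window i \<alpha> N"
          using xy in_T unfolding ab by auto
        have "?h i x y = h i a b"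
          unfolding ab by (rule conjugate_rotation[OF hG i])
        also have "\<dots> = mat_one a b"
          using supported_onD[OF N1[OF _ i, of N]] N out by auto
        also have "\<dots> = mat_one x y"
          unfolding ab mat_one_def rot_coords_eq ..
        finally show "?h i x y = mat_one x y" .
      qed
    qed
    then show ?thesis
      unfolding mult_G by (intro restrict_ext) simp
  qed
  then show ?thesis
    unfolding eventually_sequentially by blast
qed

end

section \<open>Continuity and fixed vectors\<close>

text \<open>If \<open>f\<close> is not summable, then neither is the perturbed family, and both sums have the default value \<open>0\<close>.\<close>

lemma infsum_finite_perturbation:
  fixes f e :: "'i \<Rightarrow> quat"
  assumes "finite T" "\<And>a. a \<notin> T \<Longrightarrow> e a = 0"
  shows "norm (infsum (\<lambda>a. f a + e a) UNIV - infsum f UNIV) \<le> norm (sum e T)"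
proof -
  have sum_on: "h summable_on UNIV" if "\<And>a. a \<notin> T \<Longrightarrow> h a = 0" for h :: "'i \<Rightarrow> quat"
    using summable_on_finite[OF assms(1), of h] that
    by (subst summable_on_cong_neutral[of T UNIV h h]) auto
  have e: "e summable_on UNIV" "(\<lambda>a. - e a) summable_on UNIV"
    by (rule sum_on; simp add: assms)+
  have "infsum e UNIV = infsum e T"
    by (rule infsum_cong_neutral) (use assms(2) in auto)
  then have ie: "infsum e UNIV = sum e T"
    using assms(1) by simp
  show ?thesis
  proof (cases "f summable_on UNIV")
    case True
    then show ?thesis
      using infsum_add[OF True e(1)] ie by simp
  next
    case False
    have "\<not> (\<lambda>a. f a + e a) summable_on UNIV"
    proof
      assume "(\<lambda>a. f a + e a) summable_on UNIV"
      from summable_on_add[OF this e(2)] show False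
        using False by simp
    qed
    then show ?thesis
      using False by (simp add: infsum_not_exists)
  qed
qed

lemma unitary_isometry:
  assumes g: "g \<in> unitary_mats F B" and T: "finite T" "supported_on T g"
  shows "(\<Sum>a\<in>T. (norm (\<Sum>b\<in>T. g a b * x b))\<^sup>2) = (\<Sum>b\<in>T. (norm (x b))\<^sup>2)"
proof -
  have gg: "(\<Sum>a\<in>T. qcnj (g a b) * g a c) = mat_one b c" if c: "c \<in> T" for b c
  proof -
    have "g a c = 0" if "a \<notin> T" for a
      using supported_onD(1)[OF T(2) that, of c] c that by (auto simp: mat_one_def)
    then have "mat_mult (mat_adjoint g) g b c = (\<Sum>a\<in>T. mat_adjoint g b a * g a c)"
      by (rule mat_mult_col[OF T(1)])
    then show ?thesis
      using g by (simp add: unitary_mats_iff mat_adjoint_def)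
  qed
  have "(\<Sum>a\<in>T. (norm (\<Sum>b\<in>T. g a b * x b))\<^sup>2) *\<^sub>R (1::quat) =
      (\<Sum>a\<in>T. qcnj (\<Sum>b\<in>T. g a b * x b) * (\<Sum>c\<in>T. g a c * x c))"
    by (simp add: scaleR_left.sum qcnj_times_self)
  also have "\<dots> = (\<Sum>a\<in>T. \<Sum>b\<in>T. \<Sum>c\<in>T. qcnj (x b) * (qcnj (g a b) * g a c) * x c)"
    by (simp add: qcnj_sum qcnj_mult sum_product mult.assoc)
  also have "\<dots> = (\<Sum>b\<in>T. \<Sum>a\<in>T. \<Sum>c\<in>T. qcnj (x b) * (qcnj (g a b) * g a c) * x c)"
    by (rule sum.swap)
  also have "\<dots> = (\<Sum>b\<in>T. \<Sum>c\<in>T. \<Sum>a\<in>T. qcnj (x b) * (qcnj (g a b) * g a c) * x c)"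
    by (rule sum.cong[OF refl]) (rule sum.swap)
  also have "\<dots> = (\<Sum>b\<in>T. \<Sum>c\<in>T. qcnj (x b) * (\<Sum>a\<in>T. qcnj (g a b) * g a c) * x c)"
    by (simp add: sum_distrib_left sum_distrib_right)
  also have "\<dots> = (\<Sum>b\<in>T. \<Sum>c\<in>T. if b = c then qcnj (x b) * x b else 0)"
    by (intro sum.cong refl) (simp add: gg, simp add: mat_one_def)
  also have "\<dots> = (\<Sum>b\<in>T. (norm (x b))\<^sup>2) *\<^sub>R 1"
    using T(1) by (simp add: scaleR_left.sum qcnj_times_self)
  finally show ?thesis
    by simp
qed

text \<open>A unitary matrix that fixes the first \<open>N\<close> basis vectors differs from the identity only on the tails
  of \<open>x\<close> and \<open>y\<close>, on which it is isometric.\<close>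

lemma matrix_element_bound:
  assumes g: "g \<in> unitary_mats F (UNIV :: nat set)" and fixes_first: "\<And>a k. k < N \<Longrightarrow> g a k = mat_one a k"
    and x: "summable (\<lambda>k. (norm (x k))\<^sup>2)" and y: "summable (\<lambda>k. (norm (y k))\<^sup>2)"
  shows "norm (matrix_element g x y - matrix_element mat_one x y) \<le>
    2 * sqrt ((suminf (\<lambda>k. (norm (x k))\<^sup>2)) - (\<Sum>k<N. (norm (x k))\<^sup>2)) * sqrt (suminf (\<lambda>k. (norm (y k))\<^sup>2))"
proof -
  obtain S where S: "finite S" "supported_on S g"
    using g by (auto simp: unitary_mats_iff finite_mats_iff)
  define T where "T = S - {..<N}"
  have T: "finite T" "supported_on T g"
  proof -
    show "finite T" using S(1) by (simp add: T_def)
    show "supported_on T g"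
      unfolding supported_on_def
    proof (intro allI impI)
      fix a b assume ab: "a \<notin> T \<or> b \<notin> T"
      have row: "g a b = mat_one a b" if "a < N"
        by (rule unitary_row_trivial[OF g fixes_first[OF that]])
      show "g a b = mat_one a b"
        using ab row fixes_first[of b a] supported_onD[OF S(2)] unfolding T_def by auto
    qed
  qed
  define w where "w a = Sum_any (\<lambda>b. g a b * x b)" for a
  have w_in: "w a = (\<Sum>b\<in>T. g a b * x b)" if "a \<in> T" for a
  proof -
    have sup: "b \<in> T" if "g a b * x b \<noteq> 0" for b
      using supported_onD(2)[OF T(2), of b a] \<open>a \<in> T\<close> that
      by (cases "b \<in> T") (auto simp: mat_one_def split: if_splits)
    show ?thesis
      unfolding w_def by (rule Sum_any.expand_superset[OF T(1) subsetI]) (rule sup, simp)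
  qed
  have one: "Sum_any (\<lambda>b. mat_one a b * x b) = x a" for a
  proof -
    have "Sum_any (\<lambda>b. mat_one a b * x b) = (\<Sum>b\<in>{a}. mat_one a b * x b)"
      by (rule Sum_any.expand_superset) (auto simp: mat_one_def)
    then show ?thesis by (simp add: mat_one_def)
  qed
  have w_out: "w a = x a" if "a \<notin> T" for a
    unfolding w_def using supported_onD(1)[OF T(2) that] one by simp
  let ?e = "\<lambda>a. qcnj (y a) * (w a - x a)"
  have "norm (infsum (\<lambda>a. qcnj (y a) * x a + ?e a) UNIV - infsum (\<lambda>a. qcnj (y a) * x a) UNIV) \<le> norm (sum ?e T)"
    by (rule infsum_finite_perturbation[OF T(1)]) (simp add: w_out)
  then have "norm (matrix_element g x y - matrix_element mat_one x y) \<le> norm (sum ?e T)"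
    unfolding matrix_element_def one w_def[symmetric] by (simp add: right_diff_distrib)
  also have "\<dots> \<le> (\<Sum>a\<in>T. norm (?e a))"
    by (rule norm_sum)
  also have "\<dots> \<le> (\<Sum>a\<in>T. \<bar>norm (w a)\<bar> * \<bar>norm (y a)\<bar> + \<bar>norm (x a)\<bar> * \<bar>norm (y a)\<bar>)"
  proof (rule sum_mono)
    fix a
    have "norm (?e a) \<le> norm (y a) * (norm (w a) + norm (x a))"
      unfolding norm_quat_mult norm_qcnj by (intro mult_left_mono norm_triangle_ineq4) simp
    then show "norm (?e a) \<le> \<bar>norm (w a)\<bar> * \<bar>norm (y a)\<bar> + \<bar>norm (x a)\<bar> * \<bar>norm (y a)\<bar>"
      by (simp add: algebra_simps)
  qed
  also have "\<dots> \<le> L2_set (\<lambda>a. norm (w a)) T * L2_set (\<lambda>a. norm (y a)) T +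
      L2_set (\<lambda>a. norm (x a)) T * L2_set (\<lambda>a. norm (y a)) T"
    unfolding sum.distrib by (intro add_mono L2_set_mult_ineq)
  also have "L2_set (\<lambda>a. norm (w a)) T = L2_set (\<lambda>a. norm (x a)) T"
    unfolding L2_set_def using unitary_isometry[OF g T, of x] by (simp add: w_in)
  finally have "norm (matrix_element g x y - matrix_element mat_one x y) \<le>
      2 * L2_set (\<lambda>a. norm (x a)) T * L2_set (\<lambda>a. norm (y a)) T" by simp
  also have "\<dots> \<le> 2 * sqrt ((suminf (\<lambda>k. (norm (x k))\<^sup>2)) - (\<Sum>k<N. (norm (x k))\<^sup>2)) * sqrt (suminf (\<lambda>k. (norm (y k))\<^sup>2))"
  proof -
    have "(\<Sum>k\<in>T. (norm (x k))\<^sup>2) + (\<Sum>k<N. (norm (x k))\<^sup>2) = (\<Sum>k\<in>T \<union> {..<N}. (norm (x k))\<^sup>2)"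
      using T(1) by (intro sum.union_disjoint[symmetric]) (auto simp: T_def)
    also have "\<dots> \<le> (suminf (\<lambda>k. (norm (x k))\<^sup>2))"
      using T(1) by (intro sum_le_suminf x) auto
    finally have "L2_set (\<lambda>a. norm (x a)) T \<le> sqrt ((suminf (\<lambda>k. (norm (x k))\<^sup>2)) - (\<Sum>k<N. (norm (x k))\<^sup>2))"
      unfolding L2_set_def by (intro real_sqrt_le_mono) simp
    moreover have "L2_set (\<lambda>a. norm (y a)) T \<le> sqrt (suminf (\<lambda>k. (norm (y k))\<^sup>2))"
      unfolding L2_set_def using T(1) by (intro real_sqrt_le_mono sum_le_suminf y) auto
    ultimately show ?thesis
      by (intro mult_mono) (auto simp: L2_set_nonneg intro!: sum_le_suminf x)
  qed
  finally show ?thesis .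
qed

lemma matrix_element_tendsto:
  assumes g: "\<And>N. g N \<in> unitary_mats F UNIV" and fixes_first: "\<And>N a k. k < N \<Longrightarrow> g N a k = mat_one a k"
    and x: "summable (\<lambda>k. (norm (x k))\<^sup>2)" and y: "summable (\<lambda>k. (norm (y k))\<^sup>2)"
  shows "(\<lambda>N. matrix_element (g N) x y) \<longlonglongrightarrow> matrix_element mat_one x y"
proof (rule LIM_zero_cancel, rule Lim_null_comparison)
  let ?X = "suminf (\<lambda>k. (norm (x k))\<^sup>2)" and ?Y = "suminf (\<lambda>k. (norm (y k))\<^sup>2)"
  show "\<forall>\<^sub>F N in sequentially. norm (matrix_element (g N) x y - matrix_element mat_one x y) \<le>
      2 * sqrt (?X - (\<Sum>k<N. (norm (x k))\<^sup>2)) * sqrt ?Y"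
    by (intro always_eventually allI matrix_element_bound[OF g fixes_first x y])
  have "(\<lambda>N. 2 * sqrt (?X - (\<Sum>k<N. (norm (x k))\<^sup>2)) * sqrt ?Y) \<longlonglongrightarrow> 2 * sqrt (?X - ?X) * sqrt ?Y"
    by (intro tendsto_intros summable_LIMSEQ x)
  then show "(\<lambda>N. 2 * sqrt (?X - (\<Sum>k<N. (norm (x k))\<^sup>2)) * sqrt ?Y) \<longlonglongrightarrow> 0" by simp
qed

lemma limitin_pullback:
  assumes "limitin T (\<lambda>n. f (h n)) (f l) G" "l \<in> A" "\<And>n. h n \<in> A"
  shows "limitin (pullback_topology A f T) h l G"
  unfolding limitin_def
proof (intro conjI allI impI)
  show "l \<in> topspace (pullback_topology A f T)"
    using assms(1,2) by (simp add: topspace_pullback_topology limitin_def)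
  fix U assume U: "openin (pullback_topology A f T) U \<and> l \<in> U"
  then obtain V where V: "openin T V" "U = f -` V \<inter> A"
    unfolding openin_pullback_topology by auto
  then have "\<forall>\<^sub>F n in G. f (h n) \<in> V"
    using assms(1) U by (simp add: limitin_def)
  then show "\<forall>\<^sub>F n in G. h n \<in> U"
    unfolding V(2) using assms(3) by simp
qed

lemma heavy_topology_limit:
  assumes l: "\<And>N. l N \<in> heavy_stabilizer Fs (\<lambda>_. N)"
  shows "limitin (heavy_topology Fs) l \<one>\<^bsub>heavy_group Fs\<^esub> sequentially"
proof -
  interpret group "heavy_group Fs" by (rule group_heavy)
  have lc: "l N \<in> carrier (heavy_group Fs)" for N
    using l[of N] by (simp add: heavy_stabilizer_def)
  have one: "\<one>\<^bsub>heavy_group Fs\<^esub> j = mat_one" if "j < length Fs" for j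
    using that by (simp add: heavy_group_def irreducible_heavy_group_def mat_group_def)
  have comp: "limitin (weak_operator_topology (Fs ! j)) (\<lambda>N. l N j) (\<one>\<^bsub>heavy_group Fs\<^esub> j) sequentially"
    if j: "j < length Fs" for j
    unfolding weak_operator_topology_def one[OF j]
  proof (rule limitin_pullback)
    let ?E = "ell2 (Fs ! j) \<times> ell2 (Fs ! j)"
    have u: "l N j \<in> unitary_mats (Fs ! j) UNIV" for N
      by (rule heavy_carrierD[OF lc j])
    then show "l N j \<in> carrier (irreducible_heavy_group (Fs ! j))" for N
      by (simp add: irreducible_heavy_group_def mat_group_def)
    show "mat_one \<in> carrier (irreducible_heavy_group (Fs ! j))"
      using heavy_carrierD[OF one_closed j] one[OF j] by (simp add: irreducible_heavy_group_def mat_group_def)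
    have "limitin euclidean (\<lambda>N. matrix_element (l N j) x y) (matrix_element mat_one x y) sequentially"
      if "x \<in> ell2 (Fs ! j)" "y \<in> ell2 (Fs ! j)" for x y
      unfolding limitin_canonical_iff
    proof (rule matrix_element_tendsto[OF u])
      show "l N j a k = mat_one a k" if "k < N" for N a k
        using l[of N] j that by (simp add: heavy_stabilizer_def)
    qed (use that in \<open>simp_all add: ell2_def\<close>)
    then show "limitin (product_topology (\<lambda>_. euclidean) ?E)
        (\<lambda>N. \<lambda>(x, y)\<in>?E. matrix_element (l N j) x y) (\<lambda>(x, y)\<in>?E. matrix_element mat_one x y) sequentially"
      unfolding limitin_componentwise by (auto simp: case_prod_beta)
  qed
  show ?thesis
    unfolding heavy_topology_def limitin_componentwise
  proof (intro conjI ballI)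
    show "\<one>\<^bsub>heavy_group Fs\<^esub> \<in> extensional {..<length Fs}"
      using one_closed unfolding heavy_group_carrier by (simp add: PiE_iff)
    have ext: "l N \<in> extensional {..<length Fs}" for N
      using lc[of N] unfolding heavy_group_carrier by (simp add: PiE_iff)
    have "l N j \<in> topspace (weak_operator_topology (Fs ! j))" if "j < length Fs" for N j
      using heavy_carrierD[OF lc[of N] that]
      by (auto simp: weak_operator_topology_def topspace_pullback_topology irreducible_heavy_group_def mat_group_def)
    then show "\<forall>\<^sub>F N in sequentially. l N \<in> topspace (product_topology (\<lambda>j. weak_operator_topology (Fs ! j)) {..<length Fs})"
      using ext by (intro always_eventually) (simp add: PiE_iff)
  qed (use comp in simp)
qed

context gl_pair
begin

text \<open>By continuity \<open>L\<^sup>\<alpha>\<close> moves \<open>u\<close> only a little when \<open>\<alpha>\<close> is large, since elements of \<open>L\<^sup>\<alpha>\<close> converge weakly to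
  \<open>1\<close> as \<open>\<alpha>\<close> tends to infinity; then \<open>ex_fixed_vector\<close> applies.\<close>

lemma ex_fixed_by_L_alpha:
  fixes \<rho> :: "gelem \<Rightarrow> 'h::chilbert_space \<Rightarrow> 'h" and u :: 'h
  assumes pair_rep: "rep_of_pair P \<rho>" and u: "u \<noteq> 0"
  shows "\<exists>N v. v \<noteq> 0 \<and> (\<forall>k\<in>L_alpha P (\<lambda>_. N). \<rho> k v = v)"
proof -
  have un: "unitary_group_rep G \<rho>"
    using group_G pair_rep by (simp add: unitary_group_rep_def unitary_group_rep_axioms_def rep_of_pair_def)
  interpret unitary_group_rep G \<rho> by (rule un)
  define \<epsilon> where "\<epsilon> = (norm u)\<^sup>2 / 2"
  have \<epsilon>: "0 < \<epsilon>" "\<epsilon> < (norm u)\<^sup>2"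
    using u by (simp_all add: \<epsilon>_def)
  have "\<exists>N. \<forall>k\<in>L_alpha P (\<lambda>_. N). \<epsilon> \<le> Re (cinner (\<rho> k u) u)"
  proof (rule ccontr)
    assume "\<nexists>N. \<forall>k\<in>L_alpha P (\<lambda>_. N). \<epsilon> \<le> Re (cinner (\<rho> k u) u)"
    then have "\<exists>l\<in>heavy_stabilizer (heavy P) (\<lambda>_. N). Re (cinner (\<rho> (pair_embedding P l) u) u) < \<epsilon>" for N
      unfolding L_alpha_def by (auto simp: not_le)
    then obtain l where l: "\<And>N. l N \<in> heavy_stabilizer (heavy P) (\<lambda>_. N)"
      and small: "\<And>N. Re (cinner (\<rho> (pair_embedding P (l N)) u) u) < \<epsilon>"
      by metis
    have "continuous_map (heavy_topology (heavy P)) euclidean (\<lambda>l. cinner (\<rho> (pair_embedding P l) u) u)"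
      using pair_rep by (simp add: rep_of_pair_def)
    from continuous_map_limit[OF this heavy_topology_limit[OF l]]
    have "(\<lambda>N. cinner (\<rho> (pair_embedding P (l N)) u) u) \<longlonglongrightarrow>
        cinner (\<rho> (pair_embedding P \<one>\<^bsub>pair_L P\<^esub>) u) u"
      by (simp add: o_def)
    also have "pair_embedding P \<one>\<^bsub>pair_L P\<^esub> = \<one>\<^bsub>G\<^esub>"
      by (rule hom_one[OF embedding_hom group_heavy group_G])
    finally have "(\<lambda>N. Re (cinner (\<rho> (pair_embedding P (l N)) u) u)) \<longlonglongrightarrow> Re (cinner u u)"
      by (intro tendsto_Re) simp
    then have "Re (cinner u u) \<le> \<epsilon>"
      by (rule LIMSEQ_le_const2) (use small less_imp_le in blast)
    then show False
      using \<epsilon>(2) by (simp add: cinner_self)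
  qed
  then obtain N where N: "\<And>k. k \<in> L_alpha P (\<lambda>_. N) \<Longrightarrow> \<epsilon> \<le> Re (cinner (\<rho> k u) u)" by auto
  have "\<exists>v\<in>fixed_vectors (L_alpha P (\<lambda>_. N)). v \<noteq> 0"
    by (rule ex_fixed_vector[OF L_alpha_subgroup \<epsilon>(1) N])
  then show ?thesis
    unfolding fixed_vectors_def by auto
qed

end

section \<open>Spherical representations of a pure pair\<close>

lemma (in pure_gl_pair) asymptotically_commuting_G_alpha:
  fixes \<rho> :: "gelem \<Rightarrow> 'h::chilbert_space \<Rightarrow> 'h"
  assumes "irreducible_rep G UNIV \<rho>"
  shows "asymptotically_commuting G \<rho> (L_alpha P \<alpha>) (carrier (G_alpha P \<alpha>)) (\<lambda>N. rotation \<alpha> N (\<lambda>_. N))"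
  unfolding asymptotically_commuting_def asymptotically_commuting_axioms_def
    irreducible_group_rep_def irreducible_group_rep_axioms_def
  by (auto simp: group_G assms L_alpha_subgroup G_alpha_subgroup subsetD[OF L_alpha_le_G_alpha]
      intro!: rotation_in_L_alpha eventually_far)

theorem mainTheorem4:
  fixes P :: gl_pair
    and \<rho> :: "gelem \<Rightarrow> 'h::chilbert_space \<Rightarrow> 'h"
  assumes "is_gl_pair P"
    and "is_pure P"
    and "rep_of_pair P \<rho>"
    and "irreducible_rep (pair_G P) UNIV \<rho>"
  shows "(\<exists>\<alpha>\<^sub>0. \<forall>\<alpha>. (\<forall>j<length (heavy P). \<alpha>\<^sub>0 j \<le> \<alpha> j) \<longrightarrow>
            (\<exists>V. spherical_rep (G_alpha P \<alpha>) (L_alpha P \<alpha>) V \<rho>)) \<and>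
         (\<forall>\<alpha> \<beta> V W.
            spherical_rep (G_alpha P \<alpha>) (L_alpha P \<alpha>) V \<rho> \<and>
            spherical_rep (G_alpha P \<beta>) (L_alpha P \<beta>) W \<rho> \<longrightarrow>
            equivalent_reps (pair_G P)
              V (\<lambda>g. \<rho> (shift_iso P \<alpha> g))
              W (\<lambda>g. \<rho> (shift_iso P \<beta> g)))"
proof -
  interpret pure_gl_pair P
    by unfold_locales (fact assms)+
  interpret irreducible_group_rep G \<rho>
    using group_G assms(4) by (simp add: irreducible_group_rep_def irreducible_group_rep_axioms_def)
  note asymp = asymptotically_commuting_G_alpha[OF assms(4)]
  have fixed_mono: "fixed_vectors (L_alpha P \<alpha>) \<subseteq> fixed_vectors (L_alpha P \<beta>)"
    if "\<And>j. j < length (heavy P) \<Longrightarrow> \<alpha> j \<le> \<beta> j" for \<alpha> \<beta>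
    using L_alpha_antimono[of \<alpha> \<beta>, OF that] by (auto simp: fixed_vectors_def)
  show ?thesis
  proof (intro conjI allI impI, goal_cases)
    case 1
    have "(UNIV :: 'h set) \<noteq> {0}"
      using assms(4) by (simp add: irreducible_rep_def)
    then obtain u :: 'h where "u \<noteq> 0" by auto
    then obtain N v where v: "v \<noteq> 0" "v \<in> fixed_vectors (L_alpha P (\<lambda>_. N))"
      using ex_fixed_by_L_alpha[OF assms(3) \<open>u \<noteq> 0\<close>] by (auto simp: fixed_vectors_def)
    show ?case
    proof (intro exI allI impI)
      fix \<alpha> :: "nat \<Rightarrow> nat" assume "\<forall>j<length (heavy P). N \<le> \<alpha> j"
      then have "v \<in> fixed_vectors (L_alpha P \<alpha>)"
        using fixed_mono[of "\<lambda>_. N" \<alpha>] v(2) by auto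
      from asymptotically_commuting.spherical_orbit_span[OF asymp this v(1)]
      show "spherical_rep (G_alpha P \<alpha>) (L_alpha P \<alpha>)
          (closed_cspan ((\<lambda>g. \<rho> g v) ` carrier (G_alpha P \<alpha>))) \<rho>"
        by (simp flip: G_alpha_eq)
    qed
  next
    case (2 \<alpha> \<beta> V W)
    have cyclic: "\<exists>v. v \<in> U \<and> v \<in> fixed_vectors (L_alpha P \<gamma>) \<and> norm v = 1 \<and>
        U = closed_cspan ((\<lambda>g. \<rho> (shift_iso P \<gamma> g) v) ` carrier G) \<and>
        unitary_rep G U (\<lambda>g. \<rho> (shift_iso P \<gamma> g))"
      if U: "spherical_rep (G_alpha P \<gamma>) (L_alpha P \<gamma>) U \<rho>" for \<gamma> U
    proof -
      have U': "spherical_rep (G\<lparr>carrier := carrier (G_alpha P \<gamma>)\<rparr>) (L_alpha P \<gamma>) U \<rho>"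
        using U by (simp flip: G_alpha_eq)
      have orbit: "(\<lambda>g. \<rho> g v) ` carrier (G_alpha P \<gamma>) = (\<lambda>g. \<rho> (shift_iso P \<gamma> g) v) ` carrier G" for v
        using shift_G_alpha[of _ \<gamma>] shift_surj[of _ \<gamma>] by (auto simp: image_iff)
      have "unitary_rep (G_alpha P \<gamma>) U \<rho>"
        using U by (simp add: spherical_rep_def irreducible_rep_def)
      then have "unitary_rep (G\<lparr>carrier := carrier (G_alpha P \<gamma>)\<rparr>) U \<rho>"
        by (simp flip: G_alpha_eq)
      then have "unitary_rep G U (\<lambda>g. \<rho> (shift_iso P \<gamma> g))"
        using shift_G_alpha[of _ \<gamma>] by (simp add: unitary_rep_def shift_mult)
      then show ?thesis
        using spherical_rep_cyclic[OF G_alpha_subgroup U'] unfolding orbit by auto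
    qed
    obtain v where v: "v \<in> V" "v \<in> fixed_vectors (L_alpha P \<alpha>)" "norm v = 1"
      "V = closed_cspan ((\<lambda>g. \<rho> (shift_iso P \<alpha> g) v) ` carrier G)"
      "unitary_rep G V (\<lambda>g. \<rho> (shift_iso P \<alpha> g))"
      using cyclic[of \<alpha> V] 2 by auto
    obtain w where w: "w \<in> W" "w \<in> fixed_vectors (L_alpha P \<beta>)" "norm w = 1"
      "W = closed_cspan ((\<lambda>g. \<rho> (shift_iso P \<beta> g) w) ` carrier G)"
      "unitary_rep G W (\<lambda>g. \<rho> (shift_iso P \<beta> g))"
      using cyclic[of \<beta> W] 2 by auto
    \<comment> \<open>Both fixed vectors are also fixed at the common level \<open>\<gamma>\<close>, where the scalar \<open>c\<close> is the same for both.\<close>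
    define \<gamma> where "\<gamma> j = max (\<alpha> j) (\<beta> j)" for j
    have transfer: "cinner (\<rho> (shift_iso P \<delta> g) x) x = cinner (\<rho> (shift_iso P \<gamma> g) x) x"
      if g: "g \<in> carrier G" and x: "x \<in> fixed_vectors (L_alpha P \<delta>)" and le: "\<And>j. \<delta> j \<le> \<gamma> j" for g x \<delta>
    proof -
      obtain \<theta> where \<theta>: "\<theta> \<in> L_alpha P \<delta>" "shift_iso P \<gamma> g = conjugate \<theta> (shift_iso P \<delta> g)"
        using shift_shift[OF g, of \<delta> \<gamma>] le by auto
      have \<theta>G: "\<theta> \<in> carrier G" "inv\<^bsub>G\<^esub> \<theta> \<in> L_alpha P \<delta>"
        using subgroup.mem_carrier[OF L_alpha_subgroup \<theta>(1)] subgroup.m_inv_closed[OF L_alpha_subgroup \<theta>(1)]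
        by simp_all
      have inv_x: "\<rho> (inv\<^bsub>G\<^esub> \<theta>) x = x"
        using x \<theta>G(2) by (simp add: fixed_vectors_def)
      have "\<rho> (shift_iso P \<gamma> g) x = \<rho> \<theta> (\<rho> (shift_iso P \<delta> g) x)"
        unfolding \<theta>(2) using \<theta>G(1) shift_carrier[OF g] by (simp add: rep_mult inv_x)
      then show ?thesis
        using rep_adjoint[OF \<theta>G(1), of "\<rho> (shift_iso P \<delta> g) x" x] inv_x by simp
    qed
    have eq: "cinner (\<rho> (shift_iso P \<alpha> g) v) v = cinner (\<rho> (shift_iso P \<beta> g) w) w"
      if g: "g \<in> carrier G" for g
    proof -
      have vw: "v \<in> fixed_vectors (L_alpha P \<gamma>)" "w \<in> fixed_vectors (L_alpha P \<gamma>)"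
        using fixed_mono[of \<alpha> \<gamma>] fixed_mono[of \<beta> \<gamma>] v(2) w(2) by (auto simp: \<gamma>_def)
      obtain c where c: "\<And>x. x \<in> fixed_vectors (L_alpha P \<gamma>) \<Longrightarrow>
          cinner (\<rho> (shift_iso P \<gamma> g) x) x = c * cinner x x"
        using asymptotically_commuting.compression_scalar[OF asymp shift_G_alpha[OF g, of \<gamma>]] by auto
      have "cinner (\<rho> (shift_iso P \<alpha> g) v) v = cinner (\<rho> (shift_iso P \<gamma> g) v) v"
        by (rule transfer[OF g v(2)]) (simp add: \<gamma>_def)
      also have "\<dots> = cinner (\<rho> (shift_iso P \<gamma> g) w) w"
        using c[OF vw(1)] c[OF vw(2)] v(3) w(3) by (simp add: cinner_self)
      also have "\<dots> = cinner (\<rho> (shift_iso P \<beta> g) w) w"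
        by (rule transfer[OF g w(2), symmetric]) (simp add: \<gamma>_def)
      finally show ?thesis .
    qed
    show ?case
      by (rule equivalent_cyclic_reps[OF group_G v(5,4,1) w(5,4,1) eq])
  qed
qed

end
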